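(* Let $r\ge1$, $d\in\mathbb N$ and $N\in\mathbb N$ with $N\ge r$, and let $\Delta=\Delta(C_r)$ as in the context. Then \begin{align*} \sum_{\substack{a_1,\ldots,a_r\in\mathbb N\\ a_1+\cdots+a_r=N}}\zeta_r(2da_1,\ldots,2da_r) &=\frac{(-1)^r}{2^r}\sum_{J=(j_1,\ldots,j_\nu)\in P_r}\frac{1}{j_1!\cdots j_\nu!}\sum_{(2dk_1,\ldots,2dk_r)\in\mathcal A_r(d,N,J)}\mathcal P_{\Delta_{l+}}\bigl((2dk_1,\ldots,2dk_r),\mathbf 0;\Delta\bigr)\prod_{\rho=1}^r\frac{(2\pi i)^{2dk_\rho}}{(2dk_\rho)!} \end{align*} and this value lies in $\mathbb Q\cdot\pi^{2dN}$.
   Context: Euler–Zagier sum: $\zeta_r(s_1,\ldots,s_r)=\sum_{0<n_1<\cdots<n_r}n_1^{-s_1}\cdots n_r^{-s_r}$. $I_r(d,N)=\{(2da_1,\ldots,2da_r)\in(2d\mathbb N)^r:a_1+\cdots+a_r=N\}$; $P_r=\bigcup_{\nu=1}^r\{(j_1,\ldots,j_\nu)\in\mathbb N^\nu:j_1+\cdots+j_\nu=r\}$; for $J=(j_1,\ldots,j_\nu)\in P_r$, $\mathcal A_r(d,N,J)=\{((2dh_1)^{[j_1]},\ldots,(2dh_\nu)^{[j_\nu]})\in I_r(d,N):h_1<\cdots<h_\nu\}$, where $x^{[j]}$ denotes $j$ consecutive copies of $x$. Type $C_r$: $V=\mathbb R^r$, standard basis $e_i$; $\Delta=\{\pm e_i\pm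 e_j:i<j\}\cup\{\pm2e_i\}$, simple roots $\alpha_i=e_i-e_{i+1}$ ($i<r$), $\alpha_r=2e_r$, $\Delta_+=\{e_i\pm e_j\ (i<j)\}\cup\{2e_i\}$, $\alpha^\vee=2\alpha/\langle\alpha,\alpha\rangle$, $Q^\vee=\bigoplus\mathbb Z\alpha_i^\vee$. $\Delta_{l+}=\{\beta_1,\ldots,\beta_r\}$ with $\beta_i=2e_{r-i+1}$; a tuple $(x_1,\ldots,x_r)$ indexed by $\Delta_{l+}$ attaches $x_i$ to $\beta_i$. Coefficients $\mathcal P_{\Delta^*}$ for $\Delta^*\subset\Delta_+$: $\mathscr V$ = subsets $\mathbf V\subset\Delta_+$ forming bases of $V$; $\{\mu^{\mathbf V}_\beta\}$ dual to $\{\beta^\vee\}_{\beta\in\mathbf V}$; $L(\mathbf V^\vee)=\bigoplus_{\beta\in\mathbf V}\mathbb Z\beta^\vee$; fixed $\phi\in V$ with all $\langle\phi,\mu^{\mathbf V}_\beta\rangle\ne0$; $\{\mathbf y\}_{\mathbf V,\beta}=\{\langle\mathbf y,\mu^{\mathbf V}_\beta\rangle\}$ if $\langle\phi,\mu^{\mathbf V}_\beta\rangle>0$, $=1-\{-\langle\mathbf y,\mu^{\mathbf V}_\beta\rangle\}$ otherwise. With $A=\Delta_+\setminus\Delta^*=\{\nu_1,\ldots,\nu_N\}$, $A_j=\{\nu_1,\ldots,\nu_j\}$, $A_0=\emptyset$, $\mathscr V_A=\{\mathbf V\in\mathscr V:\nu_{j+1}\notin\mathrm{L.h.}[\mathbf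 V\cap A_j],\ 0\le j\le N-1\}$, $$F_{\Delta^*}(\mathbf t_{\Delta^*},\mathbf y;\Delta)=\sum_{\mathbf V\in\mathscr V_A}(-1)^{|A\setminus\mathbf V|}\Bigl(\prod_{\gamma\in\Delta_+\setminus(\mathbf V\cup A)}\frac{t_\gamma}{t_\gamma-\sum_{\beta\in\mathbf V\setminus A}t_\beta\langle\gamma^\vee,\mu^{\mathbf V}_\beta\rangle}\Bigr)\frac{1}{|Q^\vee/L(\mathbf V^\vee)|}\sum_{q\in Q^\vee/L(\mathbf V^\vee)}\prod_{\beta\in\mathbf V\setminus A}\frac{t_\beta e^{t_\beta\{\mathbf y+q\}_{\mathbf V,\beta}}}{e^{t_\beta}-1}=\sum_{\mathbf k}\mathcal P_{\Delta^*}(\mathbf k,\mathbf y;\Delta)\prod_{\alpha\in\Delta^*}\frac{t_\alpha^{k_\alpha}}{k_\alpha!}.$$ (Note the symbol $\nu$ in $J=(j_1,\ldots,j_\nu)$ is the length of $J$.) *)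

theory Defs
  imports "HOL-Analysis.Analysis"
begin

text \<open>Vectors of V = R^r are represented as functions nat => real supported on {0..<r};
coordinate k (0-based) corresponds to e_(k+1) of the paper.\<close>

definition ev :: "nat \<Rightarrow> nat \<Rightarrow> real" where
  "ev i = (\<lambda>k. if k = i then 1 else 0)"

definition Vsp :: "nat \<Rightarrow> (nat \<Rightarrow> real) set" where
  "Vsp r = {x. \<forall>k\<ge>r. x k = 0}"

definition ipr :: "nat \<Rightarrow> (nat \<Rightarrow> real) \<Rightarrow> (nat \<Rightarrow> real) \<Rightarrow> real" where
  "ipr r x y = (\<Sum>k<r. x k * y k)"

definition posroots_C :: "nat \<Rightarrow> (nat \<Rightarrow> real) set" where
  "posroots_C r =
     {(\<lambda>k. ev i k - ev j k) | i j. i < j \<and> j < r}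
   \<union> {(\<lambda>k. ev i k + ev j k) | i j. i < j \<and> j < r}
   \<union> {(\<lambda>k. 2 * ev i k) | i. i < r}"

definition long_posroots_C :: "nat \<Rightarrow> (nat \<Rightarrow> real) set" where
  "long_posroots_C r = {(\<lambda>k. 2 * ev i k) | i. i < r}"

definition coroot :: "nat \<Rightarrow> (nat \<Rightarrow> real) \<Rightarrow> (nat \<Rightarrow> real)" where
  "coroot r a = (\<lambda>k. 2 * a k / ipr r a a)"

definition simple_root_C :: "nat \<Rightarrow> nat \<Rightarrow> (nat \<Rightarrow> real)" where
  "simple_root_C r i = (if Suc i < r then (\<lambda>k. ev i k - ev (Suc i) k) else (\<lambda>k. 2 * ev i k))"

definition Qv :: "nat \<Rightarrow> (nat \<Rightarrow> real) set" where
  "Qv r = {x. \<exists>c::nat \<Rightarrow> int. x = (\<lambda>k. \<Sum>i<r. of_int (c i) * coroot r (simple_root_C r i) k)}"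

definition lat :: "nat \<Rightarrow> (nat \<Rightarrow> real) set \<Rightarrow> (nat \<Rightarrow> real) set" where
  "lat r V = {x. \<exists>c::(nat \<Rightarrow> real) \<Rightarrow> int. x = (\<lambda>k. \<Sum>\<beta>\<in>V. of_int (c \<beta>) * coroot r \<beta> k)}"

definition lin_hull :: "nat \<Rightarrow> (nat \<Rightarrow> real) set \<Rightarrow> (nat \<Rightarrow> real) set" where
  "lin_hull r S = {x. \<exists>c::(nat \<Rightarrow> real) \<Rightarrow> real. x = (\<lambda>k. \<Sum>\<beta>\<in>S. c \<beta> * \<beta> k)}"

definition is_basis :: "nat \<Rightarrow> (nat \<Rightarrow> real) set \<Rightarrow> bool" where
  "is_basis r V \<longleftrightarrow> finite V \<and> V \<subseteq> Vsp r
     \<and> (\<forall>c. (\<forall>k<r. (\<Sum>\<beta>\<in>V. c \<beta> * \<beta> k) = 0) \<longrightarrow> (\<forall>\<beta>\<in>V. c \<beta> = 0))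
     \<and> Vsp r \<subseteq> lin_hull r V"

definition bases_C :: "nat \<Rightarrow> (nat \<Rightarrow> real) set set" where
  "bases_C r = {V. V \<subseteq> posroots_C r \<and> is_basis r V}"

definition mu :: "nat \<Rightarrow> (nat \<Rightarrow> real) set \<Rightarrow> (nat \<Rightarrow> real) \<Rightarrow> (nat \<Rightarrow> real)" where
  "mu r V \<beta> = (THE m. m \<in> Vsp r \<and>
      (\<forall>\<beta>'\<in>V. ipr r (coroot r \<beta>') m = (if \<beta>' = \<beta> then 1 else 0)))"

definition brk :: "nat \<Rightarrow> (nat \<Rightarrow> real) \<Rightarrow> (nat \<Rightarrow> real) set \<Rightarrow> (nat \<Rightarrow> real) \<Rightarrow> (nat \<Rightarrow> real) \<Rightarrow> real" where
  "brk r \<phi> V \<beta> y = (if ipr r \<phi> (mu r V \<beta>) > 0 then frac (ipr r y (mu r V \<beta>))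
                     else 1 - frac (- ipr r y (mu r V \<beta>)))"

text \<open>script-V_A, where A = Delta_+ - Delta^* is enumerated by the list nus = [nu_1,...,nu_N].\<close>
definition bases_A :: "nat \<Rightarrow> (nat \<Rightarrow> real) list \<Rightarrow> (nat \<Rightarrow> real) set set" where
  "bases_A r nus = {V \<in> bases_C r. \<forall>j<length nus. nus ! j \<notin> lin_hull r (V \<inter> set (take j nus))}"

definition qrel :: "nat \<Rightarrow> (nat \<Rightarrow> real) set \<Rightarrow> ((nat \<Rightarrow> real) \<times> (nat \<Rightarrow> real)) set" where
  "qrel r V = {(x, y). x \<in> Qv r \<and> y \<in> Qv r \<and> (\<lambda>k. x k - y k) \<in> lat r V}"

text \<open>The generating function F_{Delta^*}(t, y; Delta), Delta^* = Delta_+ - set nus.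
  The variables t are indexed by roots.\<close>
definition genF :: "nat \<Rightarrow> (nat \<Rightarrow> real) \<Rightarrow> (nat \<Rightarrow> real) list \<Rightarrow> ((nat \<Rightarrow> real) \<Rightarrow> complex)
                     \<Rightarrow> (nat \<Rightarrow> real) \<Rightarrow> complex" where
  "genF r \<phi> nus t y =
    (\<Sum>V\<in>bases_A r nus.
       (-1) ^ card (set nus - V) *
       (\<Prod>\<gamma>\<in>posroots_C r - (V \<union> set nus).
          t \<gamma> / (t \<gamma> - (\<Sum>\<beta>\<in>V - set nus. t \<beta> * of_real (ipr r (coroot r \<gamma>) (mu r V \<beta>))))) *
       (1 / of_nat (card (Qv r // qrel r V))) *
       (\<Sum>C\<in>Qv r // qrel r V.
          (\<Prod>\<beta>\<in>V - set nus.
             t \<beta> * exp (t \<beta> * of_real (brk r \<phi> V \<beta> (\<lambda>k. y k + (SOME q. q \<in> C) k)))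
               / (exp (t \<beta>) - 1))))"

definition genF_generic :: "nat \<Rightarrow> (nat \<Rightarrow> real) list \<Rightarrow> ((nat \<Rightarrow> real) \<Rightarrow> complex) \<Rightarrow> bool" where
  "genF_generic r nus t \<longleftrightarrow>
    (\<forall>V\<in>bases_A r nus.
       (\<forall>\<gamma>\<in>posroots_C r - (V \<union> set nus).
          t \<gamma> - (\<Sum>\<beta>\<in>V - set nus. t \<beta> * of_real (ipr r (coroot r \<gamma>) (mu r V \<beta>))) \<noteq> 0)
     \<and> (\<forall>\<beta>\<in>V - set nus. exp (t \<beta>) \<noteq> 1))"

text \<open>Coefficients P_{Delta^*}(k, y; Delta): the Taylor coefficients of genF at t = 0,
  i.e. the unique c (supported on exponent vectors k indexed by Delta^*) such that
  genF t y = sum_k c k prod (t_alpha^k_alpha / k_alpha!) on a neighbourhood of 0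
  (off the polar hyperplanes of the individual summands).\<close>
definition coefP :: "nat \<Rightarrow> (nat \<Rightarrow> real) \<Rightarrow> (nat \<Rightarrow> real) list \<Rightarrow> (nat \<Rightarrow> real)
                     \<Rightarrow> ((nat \<Rightarrow> real) \<Rightarrow> nat) \<Rightarrow> complex" where
  "coefP r \<phi> nus y =
    (THE c. (\<forall>k. (\<exists>\<alpha>. \<alpha> \<notin> posroots_C r - set nus \<and> k \<alpha> \<noteq> 0) \<longrightarrow> c k = 0) \<and>
       (\<exists>\<epsilon>>0. \<forall>t. genF_generic r nus t \<and> (\<forall>\<alpha>\<in>posroots_C r - set nus. norm (t \<alpha>) < \<epsilon>) \<longrightarrow>
          ((\<lambda>k. c k * (\<Prod>\<alpha>\<in>posroots_C r - set nus. t \<alpha> ^ k \<alpha> / of_nat (fact (k \<alpha>))))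
             has_sum genF r \<phi> nus t y)
            {k. \<forall>\<alpha>. \<alpha> \<notin> posroots_C r - set nus \<longrightarrow> k \<alpha> = 0}))"

text \<open>A tuple (x_1,...,x_r) (a list, 0-based) indexed by Delta_{l+}: x_i is attached to
  beta_i = 2 e_{r-i+1}, i.e. list position rho goes to 2 * ev (r - 1 - rho).\<close>
definition attach_long :: "nat \<Rightarrow> nat list \<Rightarrow> ((nat \<Rightarrow> real) \<Rightarrow> nat)" where
  "attach_long r xs = (\<lambda>\<alpha>. if \<exists>\<rho><r. \<alpha> = (\<lambda>k. 2 * ev (r - 1 - \<rho>) k)
      then xs ! (THE \<rho>. \<rho> < r \<and> \<alpha> = (\<lambda>k. 2 * ev (r - 1 - \<rho>) k)) else 0)"

definition EZ_zeta :: "nat \<Rightarrow> (nat \<Rightarrow> nat) \<Rightarrow> real" where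
  "EZ_zeta r s = infsum (\<lambda>n. \<Prod>i<r. 1 / real (n i) ^ s i)
      {n. (\<forall>i\<ge>r. n i = 0) \<and> (\<forall>i<r. 0 < n i) \<and> (\<forall>i. Suc i < r \<longrightarrow> n i < n (Suc i))}"

definition comps :: "nat \<Rightarrow> nat \<Rightarrow> (nat \<Rightarrow> nat) set" where
  "comps r N = {a. (\<forall>i<r. 0 < a i) \<and> (\<forall>i\<ge>r. a i = 0) \<and> (\<Sum>i<r. a i) = N}"

definition Pr :: "nat \<Rightarrow> nat list set" where
  "Pr r = {J. J \<noteq> [] \<and> (\<forall>j\<in>set J. 0 < j) \<and> sum_list J = r}"

definition Ar :: "nat \<Rightarrow> nat \<Rightarrow> nat list \<Rightarrow> nat list set" where
  "Ar d N J = {concat (map2 (\<lambda>j h. replicate j (2 * d * h)) J hs) | hs.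
      length hs = length J \<and> sorted_wrt (<) hs \<and> (\<forall>h\<in>set hs. 0 < h)
      \<and> sum_list (concat (map2 replicate J hs)) = N}"

end

(* Let u_i denote plus or minus t_i. The generating function is a sum over bases V of long and short
   roots. Fix B, the set of short roots in V: it has no broken circuits for the given enumeration, and
   its orthogonal complement is cut out by equations x_i = plus or minus x_j inside blocks of indices
   (and x_i = 0 outside them). The long roots completing B to a basis are exactly the choices of one
   index per block, so summing over them gives a product over the blocks of interpolation sums for
   u/(exp u - 1), whose Taylor coefficients are Bernoulli numbers of the total block degree. At even
   positive exponents these are sums over nonzero integers, hence the contribution of B is, up to
   sign, the sum of prod x_i^(-k_i) over nonzero integer points orthogonal to B. In the alternating
   sum over B everything cancels except the points x with pairwise distinct |x_i|: toggling the last
   short root orthogonal to x is a sign-reversing involution. The hyperoctahedral group acts freely on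
   these points, with the increasing positive ones as representatives, which yields the zeta sums. *)

theory Submission
  imports Defs "HOL-Combinatorics.Multiset_Permutations"
begin

section \<open>The Bernoulli generating function\<close>

text \<open>The average over the classes of the coroot lattice contributes nothing at
  \<open>y = 0\<close>: the vector dual to a long root is a signed indicator of a block, hence pairs
  integrally with the lattice Z^r, so all classes give the same summand and the index cancels. The
  numbers B_m/m! are defined through even zeta values, which builds in their reading as lattice
  sums; the price is that their generating function needs the cotangent expansion and their
  rationality a recursion. A further obstacle is that \<open>coefP\<close> is a definite description
  that constrains the series only at generic arguments, so uniqueness of multivariate power series
  has to follow from their values at positive, pairwise distinct reals. The signs fit because the
  number of short roots is even. A single zeta weight is not invariant under permutations of
  coordinates; only the sum over all compositions is, which is why the final identity concerns that
  sum. The group has order \<open>2 ^ r * fact r\<close>; the \<open>fact r\<close> is absorbed by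
  the factors 1/(j_1! ...), since a multiset with multiplicities j_1, ... has r!/(j_1! ...)
  orderings, and the \<open>2 ^ r\<close> remains.\<close>

lemma exp_neq_1_of_small:
  fixes u :: complex
  assumes "norm u < 2 * pi" "u \<noteq> 0"
  shows "exp u \<noteq> 1"
proof
  assume "exp u = 1"
  then obtain n :: int where n: "Im u = of_int (2 * n) * pi" "Re u = 0" by (auto simp: exp_eq_1)
  have u: "u = of_int n * (2 * pi * \<i>)" using n by (auto simp: complex_eq_iff)
  have "norm u = \<bar>real_of_int n\<bar> * (2 * pi)" unfolding u by (simp add: norm_mult)
  moreover have "\<bar>real_of_int n\<bar> \<ge> 1" using u assms(2) by (cases "n = 0") auto
  ultimately have "norm u \<ge> 1 * (2 * pi)" using mult_right_mono[of 1 "\<bar>real_of_int n\<bar>" "2 * pi"] by simp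
  thus False using assms by simp
qed

lemma cot_series_sums:
  fixes z :: complex
  assumes z: "norm z < 1" "z \<noteq> 0"
  shows "(\<lambda>k. 2 * z\<^sup>2 / ((of_nat (Suc k))\<^sup>2 - z\<^sup>2)) sums (1 - pi * z * cot (pi * z))"
proof -
  have nn: "1 + w \<notin> \<int>\<^sub>\<le>\<^sub>0" if "norm w < 1" for w :: complex
  proof
    assume "1 + w \<in> \<int>\<^sub>\<le>\<^sub>0"
    then obtain n where n: "1 + w = - of_nat n" by (auto elim!: nonpos_Ints_cases')
    have "w = (1 + w) - 1" by simp
    also have "\<dots> = - of_nat (Suc n)" unfolding n by simp
    finally have "w = - of_nat (Suc n)" .
    hence "norm w = real (Suc n)" by (metis norm_minus_cancel norm_of_nat)
    thus False using that by simp
  qed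
  have nz1: "1 + z \<notin> \<int>\<^sub>\<le>\<^sub>0" and nz2: "1 - z \<notin> \<int>\<^sub>\<le>\<^sub>0"
    using nn[of z] nn[of "-z"] z by simp_all
  define P where "P w = rGamma (1 + w) * rGamma (1 - w)" for w :: complex
  \<comment> \<open>With the reciprocal gamma function, which is entire, the reflection formula
    holds at every \<open>w\<close>; the two sides may therefore be differentiated as functions
    without excluding poles.\<close>
  have refl: "w * P w = sin (pi * w) / pi" for w :: complex
  proof (cases "w = 0")
    case False
    have 1: "w * rGamma (1 + w) = rGamma w" using rGamma_plus1[of w] by (simp add: add.commute)
    have 2: "(- w) * rGamma (1 - w) = rGamma (- w)" using rGamma_plus1[of "- w"] by simp
    have "(- w) * (w * P w) = rGamma w * rGamma (- w)"
      unfolding P_def 1[symmetric] 2[symmetric] by (simp only: mult_ac)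
    also have "\<dots> = (- w) * (sin (pi * w) / pi)"
      by (subst rGamma_reflection_complex') simp
    finally show ?thesis using False by (simp only: mult_cancel_left) simp
  qed simp
  have d1: "((\<lambda>w. w * P w) has_field_derivative
      (P z + z * (P z * (Digamma (1 - z) - Digamma (1 + z))))) (at z)"
  proof -
    have a: "((\<lambda>w. rGamma (1 + w)) has_field_derivative (- rGamma (1 + z) * Digamma (1 + z) * 1)) (at z)"
      by (rule DERIV_chain2[where f = rGamma and g = "\<lambda>w. 1 + w", OF has_field_derivative_rGamma_no_nonpos_int[OF nz1]])
         (rule derivative_eq_intros refl | simp)+
    have b: "((\<lambda>w. rGamma (1 - w)) has_field_derivative (- rGamma (1 - z) * Digamma (1 - z) * (- 1))) (at z)"
      by (rule DERIV_chain2[where f = rGamma and g = "\<lambda>w. 1 - w", OF has_field_derivative_rGamma_no_nonpos_int[OF nz2]])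
         (rule derivative_eq_intros refl | simp)+
    show ?thesis
      unfolding P_def using DERIV_mult[OF DERIV_ident DERIV_mult[OF a b]]
      by (simp add: algebra_simps)
  qed
  have d2: "((\<lambda>w. sin (pi * w) / pi) has_field_derivative (cos (pi * z))) (at z)"
    by (rule derivative_eq_intros refl | simp)+
  have "P z + z * (P z * (Digamma (1 - z) - Digamma (1 + z))) = cos (pi * z)"
    using DERIV_unique[OF d1[unfolded refl] d2] .
  hence "z * P z * (1 + z * (Digamma (1 - z) - Digamma (1 + z))) = z * cos (pi * z)"
    by (metis (no_types, opaque_lifting) distrib_left mult.assoc mult.left_commute mult.right_neutral)
  hence eq: "sin (pi * z) * (1 + z * (Digamma (1 - z) - Digamma (1 + z))) = pi * z * cos (pi * z)"
    unfolding refl by (simp add: field_simps)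
  have sn: "sin (pi * z) \<noteq> 0"
  proof
    assume "sin (pi * z) = 0"
    hence "exp (\<i> * (pi * z)) = exp (- (\<i> * (pi * z)))" by (simp add: sin_exp_eq)
    hence "exp (\<i> * (pi * z)) * exp (\<i> * (pi * z)) = exp (\<i> * (pi * z)) * exp (- (\<i> * (pi * z)))" by (rule arg_cong)
    also have "\<dots> = 1" by (simp add: exp_minus)
    finally have "exp (\<i> * (pi * z) + \<i> * (pi * z)) = 1" unfolding exp_add .
    moreover have "exp (\<i> * (pi * z) + \<i> * (pi * z)) \<noteq> 1"
      using z by (intro exp_neq_1_of_small) (simp_all add: norm_mult flip: mult_2)
    ultimately show False by simp
  qed
  have cot: "z * (Digamma (1 + z) - Digamma (1 - z)) = 1 - pi * z * cot (pi * z)"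
    using eq sn by (simp add: cot_def field_simps)
  have s1: "(\<lambda>k. inverse (of_nat (Suc k)) - inverse (w + of_nat k)) sums (Digamma w + euler_mascheroni)"
    if "w \<notin> \<int>\<^sub>\<le>\<^sub>0" for w :: complex
    using that summable_sums[OF summable_Digamma[of w]] by (auto simp: Digamma_def)
  \<comment> \<open>In the difference of the digamma series at 1 + z and 1 - z the harmonic terms
    and Euler's constant cancel.\<close>
  have "(\<lambda>k. z * ((inverse (of_nat (Suc k)) - inverse (1 + z + of_nat k)) - (inverse (of_nat (Suc k)) - inverse (1 - z + of_nat k))))
     sums (z * ((Digamma (1 + z) + euler_mascheroni) - (Digamma (1 - z) + euler_mascheroni)))"
    by (intro sums_mult sums_diff s1 nz1 nz2)
  also have "z * ((Digamma (1 + z) + euler_mascheroni) - (Digamma (1 - z) + euler_mascheroni)) = 1 - pi * z * cot (pi * z)"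
    using cot by simp
  also have "(\<lambda>k. z * ((inverse (of_nat (Suc k)) - inverse (1 + z + of_nat k)) - (inverse (of_nat (Suc k)) - inverse (1 - z + of_nat k))))
     = (\<lambda>k. 2 * z\<^sup>2 / ((of_nat (Suc k))\<^sup>2 - z\<^sup>2))"
  proof
    fix k
    have n: "norm z < norm (of_nat (Suc k) :: complex)" using z(1) unfolding norm_of_nat by simp
    have a: "1 + z + of_nat k \<noteq> 0" "1 - z + of_nat k \<noteq> 0"
    proof -
      have 1: "1 + z + of_nat k = of_nat (Suc k) - (- z)" "1 - z + of_nat k = of_nat (Suc k) - z" by simp_all
      have "of_nat (Suc k) \<noteq> - z" "of_nat (Suc k) \<noteq> z"
        using n by (metis norm_minus_cancel less_irrefl) (use n in blast)
      thus "1 + z + of_nat k \<noteq> 0" "1 - z + of_nat k \<noteq> 0" unfolding 1 right_minus_eq .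
    qed
    have b: "(of_nat (Suc k))\<^sup>2 - z\<^sup>2 = (1 + z + of_nat k) * (1 - z + of_nat k)"
      by (simp add: power2_eq_square algebra_simps)
    show "z * ((inverse (of_nat (Suc k)) - inverse (1 + z + of_nat k)) - (inverse (of_nat (Suc k)) - inverse (1 - z + of_nat k)))
       = 2 * z\<^sup>2 / ((of_nat (Suc k))\<^sup>2 - z\<^sup>2)"
      unfolding b using a by (simp add: field_simps power2_eq_square)
  qed
  finally show ?thesis .
qed

section \<open>Even zeta values and the numbers B_m/m!\<close>

definition zetaz :: "nat \<Rightarrow> complex" where
  "zetaz m = (\<Sum>k. 1 / of_nat (Suc k) ^ m)"

lemma zetaz_abs_summable:
  assumes "2 \<le> m"
  shows "summable (\<lambda>k. norm (1 / of_nat (Suc k) ^ m :: complex))"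
proof -
  have "summable (\<lambda>k. 1 / real (Suc k) ^ m)"
    using inverse_power_summable[of m, where 'a = real] assms
    by (subst summable_Suc_iff[of "\<lambda>k. 1 / real k ^ m"]) (simp add: field_simps)
  thus ?thesis by (simp add: norm_divide norm_power del: of_nat_Suc)
qed

text \<open>A bound that does not depend on \<open>m\<close>: it makes the double series behind the
  cotangent summable and the coefficients \<open>bernc\<close> bounded.\<close>

lemma zetaz_norm_sum_le:
  assumes "2 \<le> m"
  shows "(\<Sum>k. norm (1 / of_nat (Suc k) ^ m :: complex)) \<le> (\<Sum>k. norm (1 / of_nat (Suc k) ^ 2 :: complex))"
  by (intro suminf_le zetaz_abs_summable assms order_refl)
     (use assms in \<open>auto simp: norm_divide norm_power simp del: of_nat_Suc intro!: divide_left_mono power_increasing\<close>)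

text \<open>These are the numbers B_m/m!, with B_1 = -1/2, defined by Euler's evaluation of the even
  zeta values read backwards.\<close>

definition bernc :: "nat \<Rightarrow> complex" where
  "bernc m = (if m = 0 then 1 else if m = 1 then -1/2 else if odd m then 0
     else - 2 * zetaz m / (2 * pi * \<i>) ^ m)"

lemma bernc_even: "even m \<Longrightarrow> m \<noteq> 0 \<Longrightarrow> bernc m * (2 * pi * \<i>) ^ m = - 2 * zetaz m"
  by (auto simp: bernc_def)

lemma geometric_even_has_sum:
  fixes w :: complex
  assumes "norm w < 1"
  shows "((\<lambda>m. 2 * w ^ (2 * m + 2)) has_sum (2 * w\<^sup>2 / (1 - w\<^sup>2))) UNIV"
proof -
  have q: "norm (w\<^sup>2) < 1" using assms by (simp add: norm_power power_less_one_iff)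
  have "(\<lambda>m. 2 * w\<^sup>2 * (w\<^sup>2) ^ m) sums (2 * w\<^sup>2 * (1 / (1 - w\<^sup>2)))"
    by (rule sums_mult[OF geometric_sums[OF q]])
  moreover have "summable (\<lambda>m. norm (2 * w\<^sup>2) * norm (w\<^sup>2) ^ m)"
    by (rule summable_mult[OF summable_geometric]) (use q in simp)
  hence "summable (\<lambda>m. norm (2 * w\<^sup>2 * (w\<^sup>2) ^ m))" by (simp only: norm_mult norm_power)
  ultimately have "((\<lambda>m. 2 * w\<^sup>2 * (w\<^sup>2) ^ m) has_sum (2 * w\<^sup>2 * (1 / (1 - w\<^sup>2)))) UNIV"
    by (intro norm_summable_imp_has_sum)
  thus ?thesis unfolding power_add power_mult[of w 2] by (simp add: mult_ac)
qed

text \<open>One absolutely summable double family is summed in both orders: over \<open>k\<close> it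
  gives zeta values, over \<open>m\<close> geometric series that add up to the partial fractions of
  the cotangent.\<close>

lemma cot_zeta_sums:
  fixes z :: complex
  assumes z: "norm z < 1" "z \<noteq> 0"
  shows "(\<lambda>m. 2 * zetaz (2 * m + 2) * z ^ (2 * m + 2)) sums (1 - pi * z * cot (pi * z))"
proof -
  define C where "C = (\<Sum>k. norm (1 / of_nat (Suc k) ^ 2 :: complex))"
  define f :: "nat \<times> nat \<Rightarrow> complex"
    where "f = (\<lambda>(m, k). 2 * z ^ (2 * m + 2) * (1 / of_nat (Suc k) ^ (2 * m + 2)))"
  have C0: "C \<ge> 0" unfolding C_def by (rule suminf_nonneg[OF zetaz_abs_summable]) auto
  have z2: "norm (norm z ^ 2) < 1" using z by (simp add: power_less_one_iff)
  have abs1: "(\<lambda>k. norm (f (m, k))) summable_on UNIV" for m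
    unfolding f_def split norm_mult[of "2 * _"]
    by (intro summable_on_cmult_right norm_summable_imp_summable_on) (use zetaz_abs_summable[of "2*m+2"] in simp)
  \<comment> \<open>The inner sums are at most a constant times an even power of the norm of
    \<open>z\<close>, so the outer sum is dominated by a geometric series.\<close>
  have bound: "infsum (\<lambda>k. norm (f (m, k))) UNIV \<le> 2 * norm z ^ (2 * m + 2) * C" for m
  proof -
    have "infsum (\<lambda>k. norm (f (m, k))) UNIV
        = 2 * norm z ^ (2 * m + 2) * infsum (\<lambda>k. norm (1 / of_nat (Suc k) ^ (2*m+2) :: complex)) UNIV"
      unfolding f_def split norm_mult[of "2 * _"] by (subst infsum_cmult_right') (simp add: norm_mult norm_power)
    also have "infsum (\<lambda>k. norm (1 / of_nat (Suc k) ^ (2*m+2) :: complex)) UNIV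
       = (\<Sum>k. norm (1 / of_nat (Suc k) ^ (2*m+2) :: complex))"
      by (intro infsumI norm_summable_imp_has_sum summable_sums) (use zetaz_abs_summable[of "2*m+2"] in simp_all)
    finally show ?thesis unfolding C_def using zetaz_norm_sum_le[of "2*m+2"] by (auto intro!: mult_left_mono)
  qed
  have abs: "(\<lambda>x. norm (f x)) summable_on (UNIV \<times> UNIV)"
    unfolding Infinite_Sum.abs_summable_on_Sigma_iff
  proof (intro conjI ballI abs1)
    show "(\<lambda>m. norm (infsum (\<lambda>k. norm (f (m, k))) UNIV)) summable_on UNIV"
    proof (rule Infinite_Sum.abs_summable_on_comparison_test')
      have "summable (\<lambda>m. 2 * norm z ^ 2 * C * (norm z ^ 2) ^ m)"
        by (intro summable_mult summable_geometric z2)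
      hence "(\<lambda>m. 2 * norm z ^ 2 * C * (norm z ^ 2) ^ m) summable_on UNIV"
        by (subst summable_on_UNIV_nonneg_real_iff)
           (use C0 in simp_all)
      moreover have "2 * norm z ^ 2 * C * (norm z ^ 2) ^ m = 2 * norm z ^ (2 * m + 2) * C" for m
        unfolding power_add power_mult[of "norm z" 2 m] by (simp only: mult_ac)
      ultimately show "(\<lambda>m. 2 * norm z ^ (2 * m + 2) * C) summable_on UNIV"
        by (simp only:)
    qed (use bound in \<open>simp add: infsum_nonneg\<close>)
  qed
  have fs: "(f has_sum infsum f (UNIV \<times> UNIV)) (UNIV \<times> UNIV)"
    by (intro has_sum_infsum abs_summable_summable[OF abs])
  have "(\<lambda>m. 2 * zetaz (2 * m + 2) * z ^ (2 * m + 2)) sums infsum f (UNIV \<times> UNIV)"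
  proof (rule has_sum_imp_sums, rule has_sum_Sigma'[OF fs])
    fix m
    have "((\<lambda>k. 1 / of_nat (Suc k) ^ (2*m+2) :: complex) has_sum zetaz (2*m+2)) UNIV"
      unfolding zetaz_def
      by (rule norm_summable_imp_has_sum[OF zetaz_abs_summable summable_sums[OF summable_norm_cancel[OF zetaz_abs_summable]]]) auto
    from has_sum_cmult_right[OF this, of "2 * z ^ (2*m+2)"]
    show "((\<lambda>k. f (m, k)) has_sum 2 * zetaz (2 * m + 2) * z ^ (2 * m + 2)) UNIV"
      by (simp only: f_def split mult_ac)
  qed
  moreover have "(\<lambda>k. 2 * z\<^sup>2 / ((of_nat (Suc k))\<^sup>2 - z\<^sup>2)) sums infsum f (UNIV \<times> UNIV)"
  proof (rule has_sum_imp_sums)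
    have fs': "((\<lambda>(k, m). f (m, k)) has_sum infsum f (UNIV \<times> UNIV)) (UNIV \<times> UNIV)"
      using fs by (subst (asm) has_sum_swap)
    show "((\<lambda>k. 2 * z\<^sup>2 / ((of_nat (Suc k))\<^sup>2 - z\<^sup>2)) has_sum infsum f (UNIV \<times> UNIV)) UNIV"
    proof (rule has_sum_Sigma'[OF fs'])
      fix k
      define K :: complex where "K = of_nat (Suc k)"
      have K: "K \<noteq> 0" unfolding K_def of_nat_eq_0_iff by simp
      have "norm z < norm K" using z unfolding K_def norm_of_nat by simp
      hence nq: "norm (z / K) < 1" using K by (simp add: norm_divide)
      have "2 * (z / K) ^ (2 * m + 2) = f (m, k)" for m
        unfolding f_def split K_def[symmetric] power_divide by simp
      moreover have "2 * (z / K)\<^sup>2 / (1 - (z / K)\<^sup>2) = 2 * z\<^sup>2 / (K\<^sup>2 - z\<^sup>2)"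
      proof -
        have e: "1 - (z / K)\<^sup>2 = (K\<^sup>2 - z\<^sup>2) / K\<^sup>2"
          unfolding diff_divide_distrib power_divide using K by simp
        show ?thesis unfolding e using K by (simp add: power_divide)
      qed
      ultimately show "((\<lambda>m. case (k, m) of (k, m) \<Rightarrow> f (m, k)) has_sum 2 * z\<^sup>2 / ((of_nat (Suc k))\<^sup>2 - z\<^sup>2)) UNIV"
        using geometric_even_has_sum[OF nq] unfolding split K_def[symmetric] by (simp only:)
    qed
  qed
  ultimately show ?thesis
    using sums_unique2[OF cot_series_sums[OF z]] by (simp only:)
qed


text \<open>With u = 2 pi i z one has u/(exp u - 1) = pi z cot (pi z) - u/2, so the cotangent
  expansion supplies exactly the even coefficients from 2 on.\<close>

lemma bernc_sums:
  assumes "norm u < 2 * pi" "u \<noteq> 0"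
  shows "(\<lambda>m. bernc m * u ^ m) sums (u / (exp u - 1))"
proof -
  define z where "z = u / (2 * pi * \<i>)"
  have u: "u = 2 * pi * \<i> * z" by (simp add: z_def)
  have z: "norm z < 1" "z \<noteq> 0" using assms by (simp_all add: z_def norm_divide norm_mult)
  define h where "h m = bernc (m + 2) * u ^ (m + 2)" for m
  have h: "h (2 * m) = - (2 * zetaz (2 * m + 2) * z ^ (2 * m + 2))" for m
  proof -
    have "bernc (2 * m + 2) * (2 * pi * \<i>) ^ (2 * m + 2) = - 2 * zetaz (2 * m + 2)"
      by (rule bernc_even) auto
    hence "bernc (2 * m + 2) * (2 * pi * \<i>) ^ (2 * m + 2) * z ^ (2 * m + 2) = - 2 * zetaz (2 * m + 2) * z ^ (2 * m + 2)"
      by (rule arg_cong)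
    thus ?thesis unfolding h_def u power_mult_distrib[of _ z] by (simp only: mult.assoc mult_minus_left)
  qed
  have "(\<lambda>m. h (2 * m)) sums (- (1 - pi * z * cot (pi * z)))"
    unfolding h by (intro sums_minus cot_zeta_sums z)
  moreover have "strict_mono (\<lambda>m::nat. 2 * m)" by (simp add: strict_mono_def)
  moreover have "h n = 0" if "n \<notin> range (\<lambda>m::nat. 2 * m)" for n
  proof -
    have "odd n" using that by (auto elim!: evenE)
    thus ?thesis by (simp add: h_def bernc_def)
  qed
  ultimately have "h sums (- (1 - pi * z * cot (pi * z)))"
    by (subst (asm) sums_mono_reindex) auto
  \<comment> \<open>\<open>h\<close> starts at exponent 2; the shift adds back the exceptional terms
    1 and -u/2.\<close>
  hence "(\<lambda>m. bernc m * u ^ m) sums (- (1 - pi * z * cot (pi * z)) + (\<Sum>i<2. bernc i * u ^ i))"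
    unfolding h_def by (subst (asm) sums_iff_shift)
  also have "- (1 - pi * z * cot (pi * z)) + (\<Sum>i<2. bernc i * u ^ i) = pi * z * cot (pi * z) - u / 2"
    by (simp add: numeral_2_eq_2 bernc_def)
  also have "\<dots> = u / (exp u - 1)"
  proof -
    define w where "w = \<i> * (pi * z)"
    have e: "exp u = (exp w)\<^sup>2" unfolding exp_double[symmetric] by (simp add: u w_def mult_ac)
    have ne: "exp u \<noteq> 1" by (rule exp_neq_1_of_small[OF assms])
    have s: "sin (pi * z) = (exp w - exp (- w)) / (2 * \<i>)" and c: "cos (pi * z) = (exp w + exp (- w)) / 2"
      by (simp_all add: w_def sin_exp_eq cos_exp_eq)
    define x where "x = exp w"
    have x: "x \<noteq> 0" "x\<^sup>2 \<noteq> 1" using ne by (simp_all add: x_def e)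
    have ew: "exp (- w) = 1 / x" by (simp add: x_def exp_minus field_simps)
    have a1: "(x - 1 / x) / (2 * \<i>) = (x\<^sup>2 - 1) / (2 * \<i> * x)" and a2: "(x + 1 / x) / 2 = (x\<^sup>2 + 1) / (2 * x)"
      using x by (simp_all add: field_simps power2_eq_square)
    have "cot (pi * z) = ((x\<^sup>2 + 1) / (2 * x)) / ((x\<^sup>2 - 1) / (2 * \<i> * x))"
      unfolding cot_def s c ew x_def[symmetric] a1 a2 ..
    also have "\<dots> = ((x\<^sup>2 + 1) * (2 * \<i> * x)) / ((2 * x) * (x\<^sup>2 - 1))" by (simp only: divide_divide_times_eq)
    also have "\<dots> = ((2 * x) * (\<i> * (x\<^sup>2 + 1))) / ((2 * x) * (x\<^sup>2 - 1))" by (simp only: mult_ac)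
    also have "\<dots> = \<i> * (x\<^sup>2 + 1) / (x\<^sup>2 - 1)" using x by (subst mult_divide_mult_cancel_left) simp_all
    finally have ct: "cot (pi * z) = \<i> * (x\<^sup>2 + 1) / (x\<^sup>2 - 1)" .
    have pz: "pi * z = - \<i> * u / 2" unfolding u by (simp add: algebra_simps)
    define y where "y = x\<^sup>2 - 1"
    have y: "y \<noteq> 0" "x\<^sup>2 + 1 = y + 2" using x by (simp_all add: y_def)
    have "pi * z * cot (pi * z) - u / 2 = - \<i> * u / 2 * (\<i> * (y + 2) / y) - u / 2"
      unfolding ct unfolding pz y(2) y_def[symmetric] ..
    also have "\<dots> = u / y" using y(1) by (simp add: field_simps)
    finally show ?thesis by (simp add: e x_def y_def)
  qed
  finally show ?thesis .
qed

text \<open>A crude bound is enough: it dominates all later expansions in the open unit polydisc by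
  geometric series.\<close>

lemma bernc_bounded: "\<exists>C>0. \<forall>m. norm (bernc m) \<le> C"
proof -
  define D where "D = (\<Sum>k. norm (1 / of_nat (Suc k) ^ 2 :: complex))"
  have D: "D \<ge> 0" unfolding D_def by (rule suminf_nonneg[OF zetaz_abs_summable]) auto
  have "norm (bernc m) \<le> 1 + 2 * D" for m
  proof (cases "m \<ge> 2 \<and> even m")
    case True
    have "norm (zetaz m) \<le> D" unfolding zetaz_def D_def
      by (rule order_trans[OF summable_norm zetaz_norm_sum_le]) (use True zetaz_abs_summable in auto)
    moreover have "1 \<le> norm ((2 * pi * \<i>) ^ m)"
      unfolding norm_power by (intro one_le_power) (use pi_gt3 in \<open>simp add: norm_mult\<close>)
    ultimately have "2 * norm (zetaz m) / norm ((2 * pi * \<i>) ^ m) \<le> 2 * D / 1"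
      using D by (intro frac_le) auto
    thus ?thesis using True by (auto simp: bernc_def norm_divide norm_mult)
  qed (use D in \<open>auto simp: bernc_def not_le less_2_cases_iff norm_divide\<close>)
  thus ?thesis using D by (intro exI[of _ "1 + 2 * D"]) auto
qed

text \<open>Comparison of coefficients in F * (exp - 1) = X. The identity of formal series is
  inferred from the equality of the sums near 0.\<close>

lemma bernc_recursion: "(\<Sum>k\<le>n. bernc k / fact (Suc n - k)) = (if n = 0 then 1 else 0)"
proof -
  define F where "F = Abs_fps bernc"
  obtain C where C: "C > 0" "\<And>m. norm (bernc m) \<le> C" using bernc_bounded by auto
  have sm: "summable (\<lambda>m. bernc m * u ^ m)" if "norm u < 1" for u
  proof (rule summable_comparison_test')
    show "summable (\<lambda>m. C * norm u ^ m)" using that by (intro summable_mult summable_geometric) auto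
    show "norm (bernc m * u ^ m) \<le> C * norm u ^ m" for m
      using C by (simp add: norm_mult norm_power mult_right_mono)
  qed
  have "conv_radius bernc \<ge> norm (1/2 :: complex)"
    by (rule conv_radius_geI[OF sm]) simp
  moreover have "fps_nth F = bernc" by (rule ext) (simp add: F_def)
  ultimately have "fps_conv_radius F \<ge> norm (1/2 :: complex)" unfolding fps_conv_radius_def by (simp only:)
  hence rF: "fps_conv_radius F > 0" by (rule less_le_trans[rotated]) simp
  define E where "E = (fps_exp 1 - 1 :: complex fps)"
  have rE: "fps_conv_radius E = \<infinity>" unfolding E_def using fps_conv_radius_diff[of "fps_exp 1 :: complex fps" 1] by simp
  have FE: "F * E = fps_X"
  proof (rule eval_fps_eqD)
    show r: "fps_conv_radius (F * E) > 0"
      by (rule less_le_trans[OF _ fps_conv_radius_mult]) (use rF rE in simp)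
    show "eventually (\<lambda>z. eval_fps (F * E) z = eval_fps fps_X z) (nhds 0)"
    proof -
      have "eventually (\<lambda>z::complex. z \<in> eball 0 (min (fps_conv_radius F) 1)) (nhds 0)"
        by (rule eventually_nhds_in_open) (use rF in \<open>simp_all add: zero_ereal_def[symmetric]\<close>)
      thus ?thesis
      proof eventually_elim
        case (elim z)
        hence z: "norm z < fps_conv_radius F" "norm z < 1" by (auto simp: in_eball_iff)
        have e: "eval_fps E z = exp z - 1" unfolding E_def by (subst eval_fps_diff) auto
        show ?case
        proof (cases "z = 0")
          case False
          have "norm z < 2 * pi" using z pi_gt3 by simp
          from sums_unique[OF bernc_sums[OF this False]]
          have "eval_fps F z = z / (exp z - 1)" by (simp add: eval_fps_def F_def)
          moreover have "exp z \<noteq> 1" by (rule exp_neq_1_of_small) fact+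
          ultimately show ?thesis using z rE by (subst eval_fps_mult) (auto simp: e)
        qed (simp add: eval_fps_at_0 E_def)
      qed
    qed
  qed simp
  have "fps_nth (F * E) (Suc n) = (if n = 0 then 1 else 0)" unfolding FE by simp
  moreover have "fps_nth (F * E) (Suc n) = (\<Sum>k\<le>n. bernc k / fact (Suc n - k))"
  proof -
    have "fps_nth (F * E) (Suc n) = (\<Sum>k=0..Suc n. bernc k * fps_nth E (Suc n - k))"
      by (simp add: fps_mult_nth F_def)
    also have "\<dots> = (\<Sum>k=0..n. bernc k * fps_nth E (Suc n - k))" by (subst sum.atLeast0_atMost_Suc) (simp add: E_def)
    also have "\<dots> = (\<Sum>k\<le>n. bernc k / fact (Suc n - k))"
      unfolding atLeast0AtMost by (intro sum.cong refl) (simp add: E_def del: fact_Suc)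
    finally show ?thesis .
  qed
  ultimately show ?thesis by simp
qed

text \<open>The definition by zeta values and powers of pi does not display rationality. In the
  recursion the term \<open>k = n\<close> has denominator 1, so it is determined rationally by the
  earlier ones.\<close>

lemma bernc_Rats: "bernc n \<in> \<rat>"
proof (induction n rule: less_induct)
  case (less n)
  have "{..n} = insert n {..<n}" by auto
  hence "bernc n = (if n = 0 then 1 else 0) - (\<Sum>k<n. bernc k / fact (Suc n - k))"
    using bernc_recursion[of n] by (simp add: algebra_simps)
  also have "\<dots> \<in> \<rat>"
  proof (intro Rats_diff Rats_sum)
    show "bernc k / fact (Suc n - k) \<in> \<rat>" if "k \<in> {..<n}" for k
    proof (rule Rats_divide)
      show "bernc k \<in> \<rat>" using less that by simp
      show "fact (Suc n - k) \<in> (\<rat> :: complex set)"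
        using Rats_of_nat[of "fact (Suc n - k)", where 'a = complex] unfolding of_nat_fact .
    qed
  qed simp
  finally show ?case .
qed

section \<open>Interpolation at zero\<close>

lemma divide_diff_swap: "x / (y - z) = - (x / (z - y))" for x y z :: "'b::field"
  using minus_divide_right[of x "z - y"] by simp

text \<open>Partial fractions in \<open>x\<close> for a rational function with simple poles at the
  nodes. The weight at the pole \<open>u i\<close> is the one that appears in
  \<open>interp\<close>.\<close>

lemma partial_fraction_prod:
  fixes u :: "'a \<Rightarrow> 'b::field"
  assumes "finite b" "b \<noteq> {}" "inj_on u b" "x \<notin> u ` b"
  shows "(\<Prod>j\<in>b. u j / (u j - x)) = (\<Sum>i\<in>b. (\<Prod>j\<in>b-{i}. u j / (u j - u i)) * (u i / (u i - x)))"
  using assms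
proof (induction b arbitrary: x rule: finite_ne_induct)
  case (singleton a)
  thus ?case by simp
next
  case (insert a F)
  have ua: "u a \<notin> u ` F" and inj: "inj_on u F" using insert by auto
  have xa: "x \<noteq> u a" and xF: "x \<notin> u ` F" using insert by auto
  define w where "w i = (\<Prod>j\<in>F-{i}. u j / (u j - u i))" for i
  have IH: "(\<Prod>j\<in>F. u j / (u j - y)) = (\<Sum>i\<in>F. w i * (u i / (u i - y)))" if "y \<notin> u ` F" for y
    unfolding w_def using insert.IH[OF inj that] .
  have ne: "u i \<noteq> u a" "u i \<noteq> x" if "i \<in> F" for i using imageI[OF that, of u] ua xF by metis+
  have "(\<Prod>j\<in>insert a F. u j / (u j - x)) = (\<Sum>i\<in>F. u a / (u a - x) * (w i * (u i / (u i - x))))"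
    using insert.hyps by (simp add: IH[OF xF] sum_distrib_left)
  \<comment> \<open>A product of two simple fractions is split. The parts with pole
    \<open>u a\<close> still carry a sum over \<open>F\<close>, which the induction hypothesis, used
    a second time at \<open>u a\<close>, turns into the weight of the new node.\<close>
  also have "\<dots> = (\<Sum>i\<in>F. w i * (u a / (u a - u i)) * (u i / (u i - x)) + u a / (u a - x) * (w i * (u i / (u i - u a))))"
  proof (rule sum.cong[OF refl])
    fix i assume "i \<in> F"
    have n: "u i - x \<noteq> 0" "u a - x \<noteq> 0" "u a - u i \<noteq> 0" using ne[OF \<open>i \<in> F\<close>] xa by auto
    have "1 / ((u a - x) * (u i - x)) = 1 / ((u a - u i) * (u i - x)) - 1 / ((u a - x) * (u a - u i))"
      using n by (simp add: divide_simps)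
    hence "w i * u i * u a * (1 / ((u a - x) * (u i - x)))
       = w i * u i * u a * (1 / ((u a - u i) * (u i - x)) - 1 / ((u a - x) * (u a - u i)))" by (rule arg_cong)
    moreover have "u i / (u i - u a) = - (u i / (u a - u i))" by (rule divide_diff_swap)
    ultimately show "u a / (u a - x) * (w i * (u i / (u i - x))) = w i * (u a / (u a - u i)) * (u i / (u i - x)) + u a / (u a - x) * (w i * (u i / (u i - u a)))"
      by (simp add: algebra_simps)
  qed
  also have "\<dots> = (\<Sum>i\<in>F. w i * (u a / (u a - u i)) * (u i / (u i - x))) + u a / (u a - x) * (\<Prod>j\<in>F. u j / (u j - u a))"
    unfolding sum.distrib IH[OF ua] sum_distrib_left ..
  also have "\<dots> = (\<Sum>i\<in>insert a F. (\<Prod>j\<in>insert a F-{i}. u j / (u j - u i)) * (u i / (u i - x)))"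
  proof -
    have "insert a F - {i} = insert a (F - {i})" if "i \<in> F" for i using that insert.hyps by auto
    hence "(\<Sum>i\<in>F. (\<Prod>j\<in>insert a F-{i}. u j / (u j - u i)) * (u i / (u i - x)))
       = (\<Sum>i\<in>F. w i * (u a / (u a - u i)) * (u i / (u i - x)))"
      using insert.hyps by (intro sum.cong refl) (simp add: w_def mult_ac)
    moreover have "insert a F - {a} = F" using insert.hyps by auto
    ultimately show ?thesis using insert.hyps by (simp add: add.commute)
  qed
  finally show ?case .
qed

text \<open>The value at 0 of the Lagrange interpolation polynomial of \<open>h\<close> with nodes
  \<open>u i\<close>: the product is the \<open>i\<close>-th Lagrange basis polynomial evaluated at
  0.\<close>

definition interp :: "'a set \<Rightarrow> ('a \<Rightarrow> complex) \<Rightarrow> (complex \<Rightarrow> complex) \<Rightarrow> complex" where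
  "interp b u h = (\<Sum>i\<in>b. (\<Prod>j\<in>b-{i}. u j / (u j - u i)) * h (u i))"

lemma interp_insert:
  assumes "finite F" "a \<notin> F"
  shows "interp (insert a F) u h
    = (\<Sum>i\<in>F. (\<Prod>j\<in>F-{i}. u j / (u j - u i)) * (u a / (u a - u i)) * h (u i)) + (\<Prod>j\<in>F. u j / (u j - u a)) * h (u a)"
proof -
  have "insert a F - {i} = insert a (F - {i})" if "i \<in> F" for i using that assms by auto
  hence "(\<Sum>i\<in>F. (\<Prod>j\<in>insert a F-{i}. u j / (u j - u i)) * h (u i))
     = (\<Sum>i\<in>F. (\<Prod>j\<in>F-{i}. u j / (u j - u i)) * (u a / (u a - u i)) * h (u i))"
    using assms by (intro sum.cong refl) (simp add: mult_ac)
  moreover have "insert a F - {a} = F" using assms by auto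
  ultimately show ?thesis using assms unfolding interp_def by (simp add: add.commute)
qed

text \<open>Constants are reproduced by interpolation. In the induction the weight of the new node
  is expanded by \<open>partial_fraction_prod\<close> at \<open>u a\<close>, after which the two
  contributions of an old node add up to its old weight.\<close>

lemma interp_one:
  assumes "finite b" "b \<noteq> {}" "inj_on u b"
  shows "interp b u (\<lambda>_. 1) = 1"
  using assms
proof (induction b rule: finite_ne_induct)
  case (singleton a)
  thus ?case by (simp add: interp_def)
next
  case (insert a F)
  have ua: "u a \<notin> u ` F" and inj: "inj_on u F" using insert by auto
  have "interp (insert a F) u (\<lambda>_. 1) = (\<Sum>i\<in>F. (\<Prod>j\<in>F-{i}. u j / (u j - u i)) * (u a / (u a - u i))
        + (\<Prod>j\<in>F-{i}. u j / (u j - u i)) * (u i / (u i - u a)))"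
    unfolding interp_insert[OF insert.hyps(1,3)]
    using partial_fraction_prod[OF insert.hyps(1,2) inj ua] by (simp add: sum.distrib)
  also have "\<dots> = interp F u (\<lambda>_. 1)"
    unfolding interp_def
  proof (rule sum.cong[OF refl])
    fix i assume "i \<in> F"
    hence n: "u a - u i \<noteq> 0" using ua imageI[of i F u] by (metis right_minus_eq)
    have "u i / (u i - u a) = - (u i / (u a - u i))" by (rule divide_diff_swap)
    hence "u a / (u a - u i) + u i / (u i - u a) = 1" using n by (simp flip: diff_divide_distrib)
    thus "(\<Prod>j\<in>F-{i}. u j / (u j - u i)) * (u a / (u a - u i))
        + (\<Prod>j\<in>F-{i}. u j / (u j - u i)) * (u i / (u i - u a)) = (\<Prod>j\<in>F-{i}. u j / (u j - u i)) * 1"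
      by (simp only: distrib_left[symmetric])
  qed
  finally show ?case using insert.IH[OF inj] by simp
qed

text \<open>A new node multiplies an old weight by \<open>u a / (u a - u i)\<close>; dividing
  \<open>u a ^ m - u i ^ m\<close> by \<open>u a - u i\<close> removes this factor and leaves lower
  powers over the old nodes.\<close>

lemma interp_power_insert:
  assumes "finite F" "F \<noteq> {}" "a \<notin> F" "inj_on u (insert a F)" "1 \<le> m"
  shows "interp (insert a F) u (\<lambda>x. x ^ m) = - (\<Sum>l\<in>{1..<m}. u a ^ (m - l) * interp F u (\<lambda>x. x ^ l))"
proof -
  have ua: "u a \<notin> u ` F" and inj: "inj_on u F" using assms by auto
  define w where "w i = (\<Prod>j\<in>F-{i}. u j / (u j - u i))" for i
  have tele: "u a / (u a - x) * x ^ m = u a ^ m * (u a / (u a - x)) - (\<Sum>l<m. u a ^ (m - l) * x ^ l)" if "x \<noteq> u a" for x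
  proof -
    have "u a ^ m - x ^ m = (u a - x) * (\<Sum>l<m. u a ^ (m - Suc l) * x ^ l)"
      using power_diff_sumr2[of x m "u a"] by (simp add: algebra_simps)
    hence "u a / (u a - x) * (u a ^ m - x ^ m) = u a * (\<Sum>l<m. u a ^ (m - Suc l) * x ^ l)"
      using that by simp
    also have "\<dots> = (\<Sum>l<m. u a ^ (m - l) * x ^ l)"
      unfolding sum_distrib_left by (intro sum.cong refl) (simp add: Suc_diff_Suc flip: power_Suc mult.assoc)
    finally show ?thesis by (simp add: algebra_simps)
  qed
  have "(\<Sum>i\<in>F. w i * (u a / (u a - u i)) * u i ^ m)
     = (\<Sum>i\<in>F. u a ^ m * (w i * (u a / (u a - u i)) * 1) - (\<Sum>l<m. u a ^ (m - l) * (w i * u i ^ l)))"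
  proof (rule sum.cong[OF refl])
    fix i assume "i \<in> F"
    hence "u i \<noteq> u a" using ua imageI[of i F u] by metis
    from tele[OF this] have "w i * (u a / (u a - u i) * u i ^ m) = w i * (u a ^ m * (u a / (u a - u i)) - (\<Sum>l<m. u a ^ (m - l) * u i ^ l))"
      by (rule arg_cong)
    thus "w i * (u a / (u a - u i)) * u i ^ m = u a ^ m * (w i * (u a / (u a - u i)) * 1) - (\<Sum>l<m. u a ^ (m - l) * (w i * u i ^ l))"
      by (simp add: right_diff_distrib sum_distrib_left mult_ac)
  qed
  also have "\<dots> = u a ^ m * (\<Sum>i\<in>F. w i * (u a / (u a - u i)) * 1) - (\<Sum>l<m. u a ^ (m - l) * interp F u (\<lambda>x. x ^ l))"
    unfolding sum_subtractf sum_distrib_left interp_def w_def by (subst (2) sum.swap) simp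
  finally have 1: "interp (insert a F) u (\<lambda>x. x ^ m) = u a ^ m * interp (insert a F) u (\<lambda>_. 1)
      - (\<Sum>l<m. u a ^ (m - l) * interp F u (\<lambda>x. x ^ l))"
    unfolding interp_insert[OF assms(1,3)] w_def by (simp add: algebra_simps)
  \<comment> \<open>The term \<open>l = 0\<close> equals \<open>u a ^ m\<close> by
    \<open>interp_one\<close> and cancels the leading term, so only positive exponents
    survive.\<close>
  have "{..<m} = insert 0 {1..<m}" using assms(5) by auto
  hence "(\<Sum>l<m. u a ^ (m - l) * interp F u (\<lambda>x. x ^ l)) = u a ^ m + (\<Sum>l\<in>{1..<m}. u a ^ (m - l) * interp F u (\<lambda>x. x ^ l))"
    using interp_one[OF assms(1,2) inj] by simp
  thus ?thesis using 1 interp_one[of "insert a F" u] assms by simp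
qed

section \<open>Interpolated powers as sums over positive compositions\<close>

definition pos_comps :: "'a set \<Rightarrow> nat \<Rightarrow> ('a \<Rightarrow> nat) set" where
  "pos_comps b m = {k. (\<forall>i\<in>b. 1 \<le> k i) \<and> (\<forall>i. i \<notin> b \<longrightarrow> k i = 0) \<and> sum k b = m}"

text \<open>Here \<open>l\<close> is the degree carried by \<open>F\<close>. It is at least 1
  because \<open>F\<close> is nonempty, and less than \<open>m\<close> because the new entry is
  positive.\<close>

lemma pos_comps_insert:
  assumes "finite F" "F \<noteq> {}" "a \<notin> F"
  shows "bij_betw (\<lambda>(l, k). k(a := m - l)) (SIGMA l:{1..<m}. pos_comps F l) (pos_comps (insert a F) m)"
proof (rule bij_betw_byWitness[where f' = "\<lambda>k. (sum k F, k(a := 0))"])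
  have upd: "sum (k(a := x)) F = sum k F" for k :: "'a \<Rightarrow> nat" and x
    using assms by (intro sum.cong) auto
  have upd2: "(\<Sum>i\<in>F. if i = a then x else k i) = sum k F" for k :: "'a \<Rightarrow> nat" and x
    using assms by (intro sum.cong) auto
  show "\<forall>p\<in>SIGMA l:{1..<m}. pos_comps F l. (\<lambda>k. (sum k F, k(a := 0))) ((\<lambda>(l, k). k(a := m - l)) p) = p"
    using assms by (auto simp: pos_comps_def upd2 fun_eq_iff)
  show "\<forall>k\<in>pos_comps (insert a F) m. (\<lambda>(l, k). k(a := m - l)) (sum k F, k(a := 0)) = k"
    using assms by (auto simp: pos_comps_def fun_eq_iff)
  show "(\<lambda>(l, k). k(a := m - l)) ` (SIGMA l:{1..<m}. pos_comps F l) \<subseteq> pos_comps (insert a F) m"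
    using assms by (auto simp: pos_comps_def upd2 upd)
  show "(\<lambda>k. (sum k F, k(a := 0))) ` pos_comps (insert a F) m \<subseteq> (SIGMA l:{1..<m}. pos_comps F l)"
  proof (intro image_subsetI)
    fix k assume k: "k \<in> pos_comps (insert a F) m"
    obtain i where i: "i \<in> F" using assms by auto
    have "k i \<le> sum k F" using member_le_sum[OF i, of k] assms by simp
    moreover have "1 \<le> k i" using k i by (auto simp: pos_comps_def)
    ultimately show "(sum k F, k(a := 0)) \<in> (SIGMA l:{1..<m}. pos_comps F l)"
      using k assms by (auto simp: pos_comps_def upd upd2)
  qed
qed

lemma finite_pos_comps:
  assumes "finite b" shows "finite (pos_comps b m)"
proof (rule finite_subset)
  show "pos_comps b m \<subseteq> {k. \<forall>i. (i \<in> b \<longrightarrow> k i \<in> {..m}) \<and> (i \<notin> b \<longrightarrow> k i = 0)}"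
    using member_le_sum[of _ b] assms by (auto simp: pos_comps_def)
  show "finite {k. \<forall>i. (i \<in> b \<longrightarrow> k i \<in> {..m}) \<and> (i \<notin> b \<longrightarrow> k i = 0)}"
    by (rule finite_set_of_finite_funs[OF assms]) simp
qed

text \<open>The sum over compositions is the product of the nodes times a complete homogeneous
  symmetric polynomial of degree \<open>m - card b\<close>; for \<open>m < card b\<close> both sides
  vanish, as interpolation is exact there. In the induction each new node costs one sign.\<close>

lemma interp_power:
  assumes "finite b" "b \<noteq> {}" "inj_on u b" "1 \<le> m"
  shows "interp b u (\<lambda>x. x ^ m) = (- 1) ^ (card b - 1) * (\<Sum>k\<in>pos_comps b m. \<Prod>i\<in>b. u i ^ k i)"
  using assms
proof (induction b arbitrary: m rule: finite_ne_induct)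
  case (singleton a)
  have "pos_comps {a} m = {(\<lambda>_. 0)(a := m)}" using singleton by (auto simp: pos_comps_def)
  thus ?case by (simp add: interp_def)
next
  case (insert a F)
  have inj: "inj_on u F" using insert by auto
  have c: "card F \<ge> 1" using insert.hyps by (simp add: Suc_leI card_gt_0_iff)
  have "(\<Sum>k\<in>pos_comps (insert a F) m. \<Prod>i\<in>insert a F. u i ^ k i)
     = (\<Sum>(l, k)\<in>(SIGMA l:{1..<m}. pos_comps F l). \<Prod>i\<in>insert a F. u i ^ (k(a := m - l)) i)"
    by (subst sum.reindex_bij_betw[OF pos_comps_insert[OF insert.hyps], symmetric]) (simp add: case_prod_unfold)
  also have "\<dots> = (\<Sum>l\<in>{1..<m}. \<Sum>k\<in>pos_comps F l. \<Prod>i\<in>insert a F. u i ^ (k(a := m - l)) i)"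
    by (subst sum.Sigma) (auto simp: finite_pos_comps insert.hyps)
  also have "\<dots> = (\<Sum>l\<in>{1..<m}. u a ^ (m - l) * (\<Sum>k\<in>pos_comps F l. \<Prod>i\<in>F. u i ^ k i))"
    unfolding sum_distrib_left
  proof (intro sum.cong refl)
    fix l k
    have "(\<Prod>i\<in>F. u i ^ (k(a := m - l)) i) = (\<Prod>i\<in>F. u i ^ k i)"
      using insert.hyps by (intro prod.cong) auto
    thus "(\<Prod>i\<in>insert a F. u i ^ (k(a := m - l)) i) = u a ^ (m - l) * (\<Prod>i\<in>F. u i ^ k i)"
      using insert.hyps by simp
  qed
  finally have 1: "(\<Sum>k\<in>pos_comps (insert a F) m. \<Prod>i\<in>insert a F. u i ^ k i)
     = (\<Sum>l\<in>{1..<m}. u a ^ (m - l) * (\<Sum>k\<in>pos_comps F l. \<Prod>i\<in>F. u i ^ k i))" .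
  have "interp (insert a F) u (\<lambda>x. x ^ m) = - (\<Sum>l\<in>{1..<m}. u a ^ (m - l) * interp F u (\<lambda>x. x ^ l))"
    by (rule interp_power_insert) (use insert in auto)
  also have "(\<Sum>l\<in>{1..<m}. u a ^ (m - l) * interp F u (\<lambda>x. x ^ l))
     = (\<Sum>l\<in>{1..<m}. u a ^ (m - l) * ((- 1) ^ (card F - 1) * (\<Sum>k\<in>pos_comps F l. \<Prod>i\<in>F. u i ^ k i)))"
    using insert.IH[OF inj] by (intro sum.cong) auto
  also have "- \<dots> = (- 1) ^ (card (insert a F) - 1) * (\<Sum>l\<in>{1..<m}. u a ^ (m - l) * (\<Sum>k\<in>pos_comps F l. \<Prod>i\<in>F. u i ^ k i))"
  proof -
    have "(- 1 :: complex) ^ (card (insert a F) - 1) = - ((- 1) ^ (card F - 1))"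
      using insert.hyps c by (cases "card F") auto
    thus ?thesis by (simp add: sum_distrib_left mult_ac sum_negf)
  qed
  finally show ?case unfolding 1 .
qed

text \<open>A product set of total functions with prescribed values off \<open>I\<close>. Unlike
  \<open>PiE\<close>, the default is a parameter: exponent vectors and lattice points are 0 outside
  their index set.\<close>

definition fun_box :: "'a set \<Rightarrow> ('a \<Rightarrow> 'b set) \<Rightarrow> ('a \<Rightarrow> 'b) \<Rightarrow> ('a \<Rightarrow> 'b) set" where
  "fun_box I B z = {k. (\<forall>i\<in>I. k i \<in> B i) \<and> (\<forall>i. i \<notin> I \<longrightarrow> k i = z i)}"

lemma fun_box_insert:
  assumes "a \<notin> I"
  shows "bij_betw (\<lambda>(x, k). k(a := x)) (B a \<times> fun_box I B z) (fun_box (insert a I) B z)"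
  by (rule bij_betw_byWitness[where f' = "\<lambda>k. (k a, k(a := z a))"])
     (use assms in \<open>auto simp: fun_box_def fun_eq_iff\<close>)

text \<open>Absolute summability is carried through the induction together with the value, since it
  is what permits the iterated sum to be read as a sum over the product set.\<close>

lemma has_sum_prod_fun_box:
  fixes f :: "'a \<Rightarrow> 'b \<Rightarrow> complex"
  assumes "finite I" "\<And>i. i \<in> I \<Longrightarrow> (f i has_sum s i) (B i)"
    "\<And>i. i \<in> I \<Longrightarrow> (\<lambda>x. norm (f i x)) summable_on B i"
  shows "((\<lambda>k. \<Prod>i\<in>I. f i (k i)) has_sum (\<Prod>i\<in>I. s i)) (fun_box I B z)
    \<and> (\<lambda>k. norm (\<Prod>i\<in>I. f i (k i))) summable_on fun_box I B z"
  using assms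
proof (induction I rule: finite_induct)
  case empty
  have "fun_box {} B z = {z}" by (auto simp: fun_box_def)
  thus ?case using has_sum_finite[of "{z}" "\<lambda>k. 1::complex"] by simp
next
  case (insert a I)
  define g where "g k = (\<Prod>i\<in>I. f i (k i))" for k
  have IH: "(g has_sum (\<Prod>i\<in>I. s i)) (fun_box I B z)" "(\<lambda>k. norm (g k)) summable_on fun_box I B z"
    using insert unfolding g_def by auto
  have fa: "(f a has_sum s a) (B a)" "(\<lambda>x. norm (f a x)) summable_on B a" using insert by auto
  have prod: "(\<Prod>i\<in>insert a I. f i ((k(a := x)) i)) = f a x * g k" for x k
  proof -
    have "(\<Prod>i\<in>I. f i ((k(a := x)) i)) = g k"
      unfolding g_def using insert.hyps by (intro prod.cong) auto
    thus ?thesis using insert.hyps by simp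
  qed
  have abs: "(\<lambda>p. norm (case p of (x, k) \<Rightarrow> f a x * g k)) summable_on (B a \<times> fun_box I B z)"
  proof (rule summable_on_SigmaI)
    show "((\<lambda>k. norm (case (x, k) of (x, k) \<Rightarrow> f a x * g k)) has_sum norm (f a x) * infsum (\<lambda>k. norm (g k)) (fun_box I B z)) (fun_box I B z)" for x
      unfolding split norm_mult by (intro has_sum_cmult_right has_sum_infsum IH)
    show "(\<lambda>x. norm (f a x) * infsum (\<lambda>k. norm (g k)) (fun_box I B z)) summable_on B a"
      by (intro summable_on_cmult_left fa)
  qed simp
  have hs: "((\<lambda>p. case p of (x, k) \<Rightarrow> f a x * g k) has_sum s a * (\<Prod>i\<in>I. s i)) (B a \<times> fun_box I B z)"
  proof (rule has_sum_SigmaI)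
    show "((\<lambda>k. case (x, k) of (x, k) \<Rightarrow> f a x * g k) has_sum f a x * (\<Prod>i\<in>I. s i)) (fun_box I B z)" for x
      unfolding split by (intro has_sum_cmult_right IH)
    show "((\<lambda>x. f a x * (\<Prod>i\<in>I. s i)) has_sum s a * (\<Prod>i\<in>I. s i)) (B a)"
      by (intro has_sum_cmult_left fa)
    show "(\<lambda>p. case p of (x, k) \<Rightarrow> f a x * g k) summable_on (B a \<times> fun_box I B z)"
      by (rule Infinite_Sum.abs_summable_summable[OF abs])
  qed
  let ?h = "\<lambda>k. \<Prod>i\<in>insert a I. f i (k i)"
  have eq: "(\<lambda>p. ?h (case p of (x, k) \<Rightarrow> k(a := x))) = (\<lambda>p. case p of (x, k) \<Rightarrow> f a x * g k)"
  proof (rule ext)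
    fix p :: "'b \<times> ('a \<Rightarrow> 'b)"
    show "?h (case p of (x, k) \<Rightarrow> k(a := x)) = (case p of (x, k) \<Rightarrow> f a x * g k)"
      by (cases p) (simp only: prod split)
  qed
  show ?case
  proof
    have "(?h has_sum s a * (\<Prod>i\<in>I. s i)) (fun_box (insert a I) B z)"
      by (subst has_sum_reindex_bij_betw[OF fun_box_insert[OF insert.hyps(2)], symmetric])
         (use hs in \<open>simp only: eq\<close>)
    thus "(?h has_sum (\<Prod>i\<in>insert a I. s i)) (fun_box (insert a I) B z)"
      using insert.hyps by simp
    have "(\<lambda>p. norm (?h (case p of (x, k) \<Rightarrow> k(a := x)))) summable_on (B a \<times> fun_box I B z)"
      using abs by (simp only: fun_cong[OF eq])
    thus "(\<lambda>k. norm (?h k)) summable_on fun_box (insert a I) B z"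
      by (subst summable_on_reindex_bij_betw[OF fun_box_insert[OF insert.hyps(2)], symmetric])
  qed
qed

text \<open>Taylor coefficient of the interpolation of x/(exp x - 1) at 0 as a function of the
  nodes: the constant term gives 1, a power of positive degree only reaches exponent vectors without
  zero entry, and mixed vectors get 0.\<close>

definition blk_coeff :: "'a set \<Rightarrow> ('a \<Rightarrow> nat) \<Rightarrow> complex" where
  "blk_coeff b k = (if \<forall>i\<in>b. k i = 0 then 1
     else if \<forall>i\<in>b. 1 \<le> k i then (- 1) ^ (card b - 1) * bernc (sum k b) else 0)"

text \<open>The single-variable series is interpolated degree by degree with
  \<open>interp_power\<close>; the exponent vectors without zero entry are then grouped by their
  total degree, which is the only datum that the Bernoulli coefficient sees.\<close>

lemma interp_bernoulli_has_sum:
  assumes b: "finite b" "b \<noteq> {}" "inj_on u b" and u: "\<And>i. i \<in> b \<Longrightarrow> u i \<noteq> 0 \<and> norm (u i) < 1"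
  shows "((\<lambda>k. blk_coeff b k * (\<Prod>i\<in>b. u i ^ k i)) has_sum interp b u (\<lambda>x. x / (exp x - 1))) (fun_box b (\<lambda>_. UNIV) (\<lambda>_. 0))"
    and "(\<lambda>k. norm (blk_coeff b k * (\<Prod>i\<in>b. u i ^ k i))) summable_on (fun_box b (\<lambda>_. UNIV) (\<lambda>_. 0))"
proof -
  let ?F = "fun_box b (\<lambda>_. UNIV) (\<lambda>_. 0) :: ('a \<Rightarrow> nat) set"
  obtain C where C: "C > 0" "\<And>m. norm (bernc m) \<le> C" using bernc_bounded by auto
  have geo: "(\<lambda>k. norm (\<Prod>i\<in>b. u i ^ k i)) summable_on ?F"
  proof (rule has_sum_prod_fun_box[where f = "\<lambda>i n. u i ^ n", THEN conjunct2])
    fix i assume "i \<in> b"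
    have sn: "summable (\<lambda>n. norm (u i ^ n))"
      unfolding norm_power by (rule summable_geometric) (use u[OF \<open>i \<in> b\<close>] in simp)
    show "(\<lambda>n. norm (u i ^ n)) summable_on UNIV"
      by (subst summable_on_UNIV_nonneg_real_iff) (use sn in auto)
    show "((\<lambda>n. u i ^ n) has_sum (\<Sum>n. u i ^ n)) UNIV"
      by (rule norm_summable_imp_has_sum[OF sn summable_sums[OF summable_norm_cancel[OF sn]]])
  qed (rule b)
  have le: "norm (blk_coeff b k) \<le> 1 + C" for k
    using C by (auto simp: blk_coeff_def norm_mult norm_power intro: add_increasing)
  show abs: "(\<lambda>k. norm (blk_coeff b k * (\<Prod>i\<in>b. u i ^ k i))) summable_on ?F"
  proof (rule Infinite_Sum.abs_summable_on_comparison_test')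
    show "(\<lambda>k. (1 + C) * norm (\<Prod>i\<in>b. u i ^ k i)) summable_on ?F"
      by (rule summable_on_cmult_right[OF geo])
    show "norm (blk_coeff b k * (\<Prod>i\<in>b. u i ^ k i)) \<le> (1 + C) * norm (\<Prod>i\<in>b. u i ^ k i)" for k
      unfolding norm_mult[of "blk_coeff b k"] by (rule mult_right_mono[OF le]) simp
  qed
  define P where "P = {k\<in>?F. \<forall>i\<in>b. 1 \<le> k i}"
  define c where "c k = (- 1) ^ (card b - 1) * bernc (sum k b) * (\<Prod>i\<in>b. u i ^ k i)" for k
  have F0: "(\<lambda>_. 0) \<in> ?F" "(\<lambda>_. 0) \<notin> P" "P \<subseteq> ?F" using b by (auto simp: P_def fun_box_def)
  have cP: "c k = blk_coeff b k * (\<Prod>i\<in>b. u i ^ k i)" if "k \<in> P" for k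
  proof -
    have "\<not> (\<forall>i\<in>b. k i = 0)" using that b(2) by (force simp: P_def)
    thus ?thesis using that by (auto simp: c_def blk_coeff_def P_def)
  qed
  have sP: "(\<lambda>k. norm (c k)) summable_on P"
    using summable_on_subset[OF abs F0(3)] by (rule summable_on_cong[THEN iffD1, rotated]) (simp add: cP)
  have cs: "(c has_sum infsum c P) P"
    by (rule has_sum_infsum[OF Infinite_Sum.abs_summable_summable[OF sP]])
  have bij: "bij_betw snd (SIGMA m:{1..}. pos_comps b m) P"
  proof (rule bij_betw_byWitness[where f' = "\<lambda>k. (sum k b, k)"])
    obtain i where i: "i \<in> b" using b by auto
    have "1 \<le> sum k b" if "k \<in> P" for k
    proof -
      have "k i \<le> sum k b" using member_le_sum[OF i, of k] b by simp
      moreover have "1 \<le> k i" using that i by (auto simp: P_def)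
      ultimately show ?thesis by simp
    qed
    thus "(\<lambda>k. (sum k b, k)) ` P \<subseteq> (SIGMA m:{1..}. pos_comps b m)"
      by (auto simp: P_def pos_comps_def fun_box_def)
  qed (auto simp: P_def pos_comps_def fun_box_def)
  have cs2: "((\<lambda>p. c (snd p)) has_sum infsum c P) (SIGMA m:{1..}. pos_comps b m)"
    using cs by (subst has_sum_reindex_bij_betw[OF bij])
  have "((\<lambda>m. bernc m * interp b u (\<lambda>x. x ^ m)) has_sum infsum c P) {1..}"
  proof (rule has_sum_Sigma'[OF cs2])
    fix m :: nat assume m: "m \<in> {1..}"
    have "(\<Sum>k\<in>pos_comps b m. c k) = bernc m * interp b u (\<lambda>x. x ^ m)"
    proof -
      have "(\<Sum>k\<in>pos_comps b m. c k) = (\<Sum>k\<in>pos_comps b m. (- 1) ^ (card b - 1) * bernc m * (\<Prod>i\<in>b. u i ^ k i))"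
        by (intro sum.cong refl) (simp add: c_def pos_comps_def)
      thus ?thesis using m unfolding sum_distrib_left[symmetric] by (subst interp_power[OF b]) (auto simp: mult_ac)
    qed
    thus "((\<lambda>k. c (snd (m, k))) has_sum bernc m * interp b u (\<lambda>x. x ^ m)) (pos_comps b m)"
      by (intro has_sum_finiteI finite_pos_comps b) simp
  qed
  \<comment> \<open>Degree 0 is added by hand: its contribution is 1 by \<open>interp_one\<close>,
    whereas the formula of \<open>interp_power\<close> needs positive degree.\<close>
  hence "((\<lambda>m. bernc m * interp b u (\<lambda>x. x ^ m)) has_sum (bernc 0 * interp b u (\<lambda>x. x ^ 0) + infsum c P)) (insert 0 {1..})"
    by (rule has_sum_insert[rotated]) simp
  moreover have "insert 0 {1..} = (UNIV :: nat set)" by auto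
  ultimately have "(\<lambda>m. bernc m * interp b u (\<lambda>x. x ^ m)) sums (1 + infsum c P)"
    using interp_one[OF b] by (auto intro!: has_sum_imp_sums simp: bernc_def)
  moreover have "(\<lambda>m. bernc m * interp b u (\<lambda>x. x ^ m)) sums interp b u (\<lambda>x. x / (exp x - 1))"
  proof -
    have "(\<lambda>m. \<Sum>i\<in>b. (\<Prod>j\<in>b-{i}. u j / (u j - u i)) * (bernc m * u i ^ m)) sums
       (\<Sum>i\<in>b. (\<Prod>j\<in>b-{i}. u j / (u j - u i)) * (u i / (exp (u i) - 1)))"
    proof (intro sums_sum sums_mult bernc_sums)
      fix i assume "i \<in> b"
      show "norm (u i) < 2 * pi" "u i \<noteq> 0" using u[OF \<open>i \<in> b\<close>] pi_gt3 by auto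
    qed
    thus ?thesis unfolding interp_def sum_distrib_left by (simp only: mult_ac)
  qed
  ultimately have val: "interp b u (\<lambda>x. x / (exp x - 1)) = 1 + infsum c P" by (rule sums_unique2[symmetric])
  have "(c has_sum infsum c P) P \<longleftrightarrow> ((\<lambda>k. blk_coeff b k * (\<Prod>i\<in>b. u i ^ k i)) has_sum infsum c P) (?F - {\<lambda>_. 0})"
  proof (rule has_sum_cong_neutral)
    fix k assume k: "k \<in> ?F - {\<lambda>_. 0} - P"
    hence "\<not> (\<forall>i\<in>b. k i = 0)" by (auto simp: fun_box_def fun_eq_iff) 
    moreover have "\<not> (\<forall>i\<in>b. 1 \<le> k i)" using k by (auto simp: P_def)
    ultimately have "blk_coeff b k = 0" unfolding blk_coeff_def by (simp only: if_False)
    thus "blk_coeff b k * (\<Prod>i\<in>b. u i ^ k i) = 0" by simp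
  qed (use F0 cP in auto)
  with cs have "((\<lambda>k. blk_coeff b k * (\<Prod>i\<in>b. u i ^ k i)) has_sum infsum c P) (?F - {\<lambda>_. 0})" by simp
  from has_sum_insert[OF _ this, of "\<lambda>_. 0"]
  have "((\<lambda>k. blk_coeff b k * (\<Prod>i\<in>b. u i ^ k i)) has_sum (1 + infsum c P)) (insert (\<lambda>_. 0) (?F - {\<lambda>_. 0}))"
    by (simp add: blk_coeff_def)
  moreover have "insert (\<lambda>_. 0) (?F - {\<lambda>_. 0}) = ?F" using F0 by auto
  ultimately show "((\<lambda>k. blk_coeff b k * (\<Prod>i\<in>b. u i ^ k i)) has_sum interp b u (\<lambda>x. x / (exp x - 1))) ?F"
    unfolding val by simp
qed

section \<open>Uniqueness of multivariate power series\<close>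

text \<open>Vanishing is only assumed on a real interval to the right of 0. Once the lower
  coefficients are known to vanish, division by \<open>s ^ n\<close> and the limit from the right
  isolate coefficient \<open>n\<close>.\<close>

lemma powser_eq_0_imp_coeff_0:
  fixes B :: "nat \<Rightarrow> complex"
  assumes "\<delta> > 0" and B: "\<And>s. 0 < s \<Longrightarrow> s < \<delta> \<Longrightarrow> (\<lambda>n. of_real s ^ n * B n) sums 0"
  shows "B n = 0"
proof (induction n rule: less_induct)
  case (less n)
  have Bs: "(\<lambda>m. B (m + n) * of_real s ^ m) sums 0" if s: "0 < s" "s < \<delta>" for s
  proof -
    have "(\<lambda>m. of_real s ^ (m + n) * B (m + n)) sums (0 - (\<Sum>i<n. of_real s ^ i * B i))"
      by (rule sums_split_initial_segment[OF B[OF s]])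
    hence "(\<lambda>m. inverse (of_real s ^ n) * (of_real s ^ (m + n) * B (m + n))) sums (inverse (of_real s ^ n) * 0)"
      using less.IH by (intro sums_mult) simp
    thus ?thesis using s(1) by (simp add: power_add mult_ac)
  qed
  define f where "f x = (\<Sum>m. B (m + n) * x ^ m)" for x
  have "(f \<longlongrightarrow> B (0 + n)) (at 0)"
  proof (rule powser_limit_0[of "\<delta> / 2"])
    fix x :: complex assume x: "norm x < \<delta> / 2"
    have "summable (\<lambda>m. B (m + n) * of_real (\<delta> / 2) ^ m)"
      using sums_summable[OF Bs[of "\<delta> / 2"]] assms(1) by simp
    hence "summable (\<lambda>m. B (m + n) * x ^ m)" by (rule powser_inside) (use x assms(1) in simp)
    thus "(\<lambda>m. B (m + n) * x ^ m) sums f x" unfolding f_def by (rule summable_sums)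
  qed (use assms(1) in simp)
  moreover have "filterlim (of_real :: real \<Rightarrow> complex) (at 0) (at_right 0)"
    unfolding filterlim_at using eventually_at_right_less[of 0]
    by (auto intro!: tendsto_eq_intros elim!: eventually_mono)
  ultimately have "((\<lambda>s. f (of_real s)) \<longlongrightarrow> B (0 + n)) (at_right 0)"
    by (rule filterlim_compose)
  moreover have "eventually (\<lambda>s. f (of_real s) = 0) (at_right 0)"
    using eventually_at_right_less[of 0] eventually_at_right_real[OF assms(1)]
    by eventually_elim (use Bs in \<open>auto simp: f_def sums_iff\<close>)
  hence "((\<lambda>s. f (of_real s)) \<longlongrightarrow> 0) (at_right 0)" by (rule tendsto_eventually)
  ultimately have "B (0 + n) = 0" by (intro tendsto_unique[of "at_right (0::real)"]) auto
  thus ?case by simp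
qed

text \<open>The arguments are restricted to positive, pairwise distinct reals because those are the
  ones shown to be generic in \<open>generic_positive\<close>. One variable at a time is split off
  and treated by the single-variable lemma.\<close>

lemma multi_powser_eq_0_imp_coeff_0:
  fixes a :: "('a \<Rightarrow> nat) \<Rightarrow> complex"
  assumes "finite I" "\<epsilon> > 0"
    and "\<And>t::'a \<Rightarrow> real. (\<And>i. i \<in> I \<Longrightarrow> 0 < t i \<and> t i < \<epsilon>) \<Longrightarrow> inj_on t I \<Longrightarrow>
      ((\<lambda>k. a k * (\<Prod>i\<in>I. of_real (t i) ^ k i)) has_sum 0) (fun_box I (\<lambda>_. UNIV) (\<lambda>_. 0))"
    and "k \<in> fun_box I (\<lambda>_. UNIV) (\<lambda>_. 0)"
  shows "a k = 0"
  using assms(1,3,4)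
proof (induction I arbitrary: a k rule: finite_induct)
  case empty
  have "fun_box {} (\<lambda>_. UNIV) (\<lambda>_. 0) = {k}" using empty.prems(2) by (auto simp: fun_box_def)
  thus ?case using empty.prems(1)[of "\<lambda>_. 0"] by (simp add: has_sum_finite_iff)
next
  case (insert x I)
  let ?F = "\<lambda>I. fun_box I (\<lambda>_. UNIV) (\<lambda>_. 0) :: ('a \<Rightarrow> nat) set"
  have "a (k'(x := n)) = 0" if k': "k' \<in> ?F I" for k' n
  proof (rule insert.IH[OF _ k'])
    fix t :: "'a \<Rightarrow> real"
    assume t: "\<And>i. i \<in> I \<Longrightarrow> 0 < t i \<and> t i < \<epsilon>" and inj: "inj_on t I"
    \<comment> \<open>Keeping the new variable below all the others preserves the distinctness that
      the hypothesis demands.\<close>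
    define \<delta> where "\<delta> = Min (insert \<epsilon> (t ` I))"
    have \<delta>: "\<delta> > 0" "\<delta> \<le> \<epsilon>" "\<And>i. i \<in> I \<Longrightarrow> \<delta> \<le> t i"
      using insert.hyps(1) assms(2) t by (auto simp: \<delta>_def)
    define g where "g n k = a (k(x := n)) * (\<Prod>i\<in>I. of_real (t i) ^ k i)" for n k
    have hs: "((\<lambda>(n, k). of_real s ^ n * g n k) has_sum 0) (UNIV \<times> ?F I)" if s: "0 < s" "s < \<delta>" for s :: real
    proof -
      have 1: "((\<lambda>k. a k * (\<Prod>i\<in>insert x I. of_real ((t(x := s)) i) ^ k i)) has_sum 0) (?F (insert x I))"
      proof (rule insert.prems(1))
        show "0 < (t(x := s)) i \<and> (t(x := s)) i < \<epsilon>" if "i \<in> insert x I" for i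
          using that t s \<delta> by (cases "i = x") auto
        have "s \<notin> t ` I" using \<delta>(3) s by fastforce
        thus "inj_on (t(x := s)) (insert x I)"
          using inj insert.hyps by (auto simp: inj_on_def)
      qed
      have p: "(\<Prod>i\<in>insert x I. of_real ((t(x := s)) i) ^ (k(x := n)) i) = of_real s ^ n * (\<Prod>i\<in>I. of_real (t i) ^ k i :: complex)" for k n
      proof -
        have "(\<Prod>i\<in>I. of_real ((t(x := s)) i) ^ (k(x := n)) i) = (\<Prod>i\<in>I. of_real (t i) ^ k i :: complex)"
          using insert.hyps by (intro prod.cong) auto
        thus ?thesis using insert.hyps by simp
      qed
      have "((\<lambda>p. a (case p of (n, k) \<Rightarrow> k(x := n)) * (\<Prod>i\<in>insert x I. of_real ((t(x := s)) i) ^ (case p of (n, k) \<Rightarrow> k(x := n)) i)) has_sum 0) (UNIV \<times> ?F I)"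
        using 1 by (subst has_sum_reindex_bij_betw[OF fun_box_insert[OF insert.hyps(2), of "\<lambda>_. UNIV" "\<lambda>_. 0"]])
      also have "(\<lambda>p. a (case p of (n, k) \<Rightarrow> k(x := n)) * (\<Prod>i\<in>insert x I. of_real ((t(x := s)) i) ^ (case p of (n, k) \<Rightarrow> k(x := n)) i))
         = (\<lambda>(n, k). of_real s ^ n * g n k)"
      proof (rule ext)
        fix p :: "nat \<times> ('a \<Rightarrow> nat)"
        show "a (case p of (n, k) \<Rightarrow> k(x := n)) * (\<Prod>i\<in>insert x I. of_real ((t(x := s)) i) ^ (case p of (n, k) \<Rightarrow> k(x := n)) i)
           = (case p of (n, k) \<Rightarrow> of_real s ^ n * g n k)"
          by (cases p) (simp only: split p g_def mult_ac)
      qed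
      finally show ?thesis .
    qed
    \<comment> \<open>A slice of a summable double family is summable; dividing by a nonzero power
      of \<open>\<delta> / 2\<close> frees it from the split variable.\<close>
    have gs: "g n summable_on ?F I" for n
    proof -
      have "(\<lambda>(n, k). of_real (\<delta> / 2) ^ n * g n k) summable_on (UNIV \<times> ?F I)"
        using hs[of "\<delta> / 2"] \<delta>(1) by (intro has_sum_imp_summable) auto
      hence "(\<lambda>k. of_real (\<delta> / 2) ^ n * g n k) summable_on ?F I"
        by (rule summable_on_SigmaD1) simp
      hence "(\<lambda>k. inverse (of_real (\<delta> / 2) ^ n) * (of_real (\<delta> / 2) ^ n * g n k)) summable_on ?F I"
        by (rule summable_on_cmult_right)
      moreover have "inverse (of_real (\<delta> / 2) ^ n) * (of_real (\<delta> / 2) ^ n * g n k) = g n k" for k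
        unfolding mult.assoc[symmetric] using \<delta>(1) by (subst left_inverse) simp_all
      ultimately show ?thesis by (simp only:)
    qed
    have "infsum (g n) (?F I) = 0"
    proof (rule powser_eq_0_imp_coeff_0[OF \<delta>(1), where B = "\<lambda>m. infsum (g m) (?F I)"])
      fix s :: real assume s: "0 < s" "s < \<delta>"
      show "(\<lambda>n. of_real s ^ n * infsum (g n) (?F I)) sums 0"
      proof (rule has_sum_imp_sums, rule has_sum_Sigma'[OF hs[OF s]])
        show "((\<lambda>k. case (n, k) of (n, k) \<Rightarrow> of_real s ^ n * g n k) has_sum of_real s ^ n * infsum (g n) (?F I)) (?F I)" for n
          unfolding split by (intro has_sum_cmult_right has_sum_infsum gs)
      qed
    qed
    thus "((\<lambda>k. a (k(x := n)) * (\<Prod>i\<in>I. of_real (t i) ^ k i)) has_sum 0) (?F I)"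
      using has_sum_infsum[OF gs[of n]] by (simp only: g_def[abs_def])
  qed
  from this[of "k(x := 0)" "k x"] show ?case using insert by (auto simp: fun_box_def)
qed

section \<open>Linear algebra with root vectors\<close>

definition perp :: "nat \<Rightarrow> (nat \<Rightarrow> real) set \<Rightarrow> (nat \<Rightarrow> real) set" where
  "perp r S = {m \<in> Vsp r. \<forall>b\<in>S. ipr r b m = 0}"

lemma ipr_diff_scale_left: "ipr r (\<lambda>k. x k - c * y k) m = ipr r x m - c * ipr r y m"
  by (simp add: ipr_def algebra_simps sum_subtractf sum_distrib_left)

lemma ipr_diff_scale_right: "ipr r x (\<lambda>k. m k - c * n k) = ipr r x m - c * ipr r x n"
  by (simp add: ipr_def algebra_simps sum_subtractf sum_distrib_left)

lemma ipr_sum_left: "ipr r (\<lambda>k. \<Sum>b\<in>S. c b * b k) m = (\<Sum>b\<in>S. c b * ipr r b m)"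
  unfolding ipr_def sum_distrib_left sum_distrib_right by (subst sum.swap) (simp add: mult_ac)

lemma Vsp_diff_scale: "x \<in> Vsp r \<Longrightarrow> y \<in> Vsp r \<Longrightarrow> (\<lambda>k. x k - c * y k) \<in> Vsp r"
  by (simp add: Vsp_def)

lemma ipr_ev_left: "i < r \<Longrightarrow> ipr r (ev i) m = m i"
  by (simp add: ipr_def ev_def if_distrib[of "\<lambda>x. x * _"] cong: if_cong)

lemma ipr_self_eq_0: "x \<in> Vsp r \<Longrightarrow> ipr r x x = 0 \<Longrightarrow> x = (\<lambda>_. 0)"
  by (auto simp: ipr_def Vsp_def sum_nonneg_eq_0_iff fun_eq_iff) (metis lessThan_iff not_le)

lemma lin_hull_mono: "finite T \<Longrightarrow> S \<subseteq> T \<Longrightarrow> x \<in> lin_hull r S \<Longrightarrow> x \<in> lin_hull r T"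
proof -
  assume T: "finite T" "S \<subseteq> T" and "x \<in> lin_hull r S"
  then obtain c where c: "x = (\<lambda>k. \<Sum>b\<in>S. c b * b k)" by (auto simp: lin_hull_def)
  have "x = (\<lambda>k. \<Sum>b\<in>T. (if b \<in> S then c b else 0) * b k)"
    unfolding c using T by (intro ext sum.mono_neutral_cong_left) auto
  thus ?thesis unfolding lin_hull_def by (auto intro!: exI[of _ "\<lambda>b. if b \<in> S then c b else 0"])
qed

lemma lin_hull_perp: "x \<in> lin_hull r S \<Longrightarrow> m \<in> perp r S \<Longrightarrow> ipr r x m = 0"
  by (auto simp: lin_hull_def perp_def ipr_sum_left)

text \<open>Duality replaces dimension counting: a point outside a span is detected by a vector
  orthogonal to that span. For a new generator \<open>b\<close> outside the old span, a vector
  \<open>n\<close> with pairing 1 against \<open>b\<close> corrects both the point and its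
  separating vector.\<close>

lemma separating_vector:
  assumes "finite S" "S \<subseteq> Vsp r" "x \<in> Vsp r" "x \<notin> lin_hull r S"
  shows "\<exists>m\<in>perp r S. ipr r x m = 1"
  using assms
proof (induction S arbitrary: x rule: finite_induct)
  case empty
  have "x \<noteq> (\<lambda>_. 0)" using empty by (auto simp: lin_hull_def)
  hence "ipr r x x \<noteq> 0" using ipr_self_eq_0 empty by blast
  hence "ipr r x (\<lambda>k. 0 - (- 1 / ipr r x x) * x k) = 1"
    unfolding ipr_diff_scale_right by (simp add: ipr_def)
  thus ?case using empty by (intro bexI[of _ "\<lambda>k. 0 - (- 1 / ipr r x x) * x k"]) (auto simp: perp_def Vsp_def)
next
  case (insert b S)
  have S: "S \<subseteq> Vsp r" "b \<in> Vsp r" using insert by auto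
  have xS: "x \<notin> lin_hull r S" using insert lin_hull_mono[of "insert b S" S x r] by auto
  show ?case
  proof (cases "b \<in> lin_hull r S")
    case True
    obtain m where m: "m \<in> perp r S" "ipr r x m = 1" using insert.IH[OF S(1) insert.prems(2) xS] by blast
    hence "m \<in> perp r (insert b S)" using lin_hull_perp[OF True m(1)] by (simp add: perp_def)
    thus ?thesis using m by blast
  next
    case False
    obtain n where n: "n \<in> perp r S" "ipr r b n = 1" using insert.IH[OF S False] by blast
    define c where "c = ipr r x n"
    define y where "y = (\<lambda>k. x k - c * b k)"
    have "y \<notin> lin_hull r S"
    proof
      assume "y \<in> lin_hull r S"
      then obtain d where d: "y = (\<lambda>k. \<Sum>b\<in>S. d b * b k)" by (auto simp: lin_hull_def)
      have "x = (\<lambda>k. \<Sum>b'\<in>insert b S. (d(b := c)) b' * b' k)"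
      proof
        fix k
        have "(\<Sum>b'\<in>S. (d(b := c)) b' * b' k) = (\<Sum>b'\<in>S. d b' * b' k)"
          using insert.hyps by (intro sum.cong) auto
        thus "x k = (\<Sum>b'\<in>insert b S. (d(b := c)) b' * b' k)"
          using insert.hyps fun_cong[OF d, of k] by (simp add: y_def)
      qed
      hence "x \<in> lin_hull r (insert b S)" unfolding lin_hull_def by blast
      thus False using insert.prems by blast
    qed
    moreover have "y \<in> Vsp r" unfolding y_def using S insert.prems by (intro Vsp_diff_scale)
    ultimately obtain m where m: "m \<in> perp r S" "ipr r y m = 1" using insert.IH[OF S(1)] by blast
    define w where "w = (\<lambda>k. m k - ipr r b m * n k)"
    have "w \<in> perp r (insert b S)"
      using m n by (auto simp: perp_def w_def ipr_diff_scale_right Vsp_diff_scale)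
    moreover have "ipr r x w = 1"
      using m(2) unfolding w_def y_def ipr_diff_scale_right ipr_diff_scale_left c_def by (simp add: mult.commute)
    ultimately show ?thesis by blast
  qed
qed

lemma lin_hull_iff:
  assumes "finite S" "S \<subseteq> Vsp r" "x \<in> Vsp r"
  shows "x \<in> lin_hull r S \<longleftrightarrow> (\<forall>m\<in>perp r S. ipr r x m = 0)"
  using separating_vector[OF assms] lin_hull_perp by fastforce

text \<open>Linear independence expressed by dual vectors, the form in which it is both produced and
  consumed below.\<close>

definition indep :: "nat \<Rightarrow> (nat \<Rightarrow> real) set \<Rightarrow> bool" where
  "indep r V \<longleftrightarrow> (\<forall>b\<in>V. \<exists>m\<in>perp r (V - {b}). ipr r b m = 1)"

text \<open>Turns coefficients into test vectors: independence by pairing a relation with dual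
  vectors, spanning because a nonspanning set has a nonzero orthogonal vector.\<close>

lemma is_basis_iff:
  "is_basis r V \<longleftrightarrow> finite V \<and> V \<subseteq> Vsp r \<and> indep r V \<and> perp r V = {\<lambda>_. 0}"
proof (cases "finite V \<and> V \<subseteq> Vsp r")
  case True
  hence fin: "finite V" and V: "V \<subseteq> Vsp r" by auto
  have A: "(\<forall>c. (\<forall>k<r. (\<Sum>\<beta>\<in>V. c \<beta> * \<beta> k) = 0) \<longrightarrow> (\<forall>\<beta>\<in>V. c \<beta> = 0)) \<longleftrightarrow> indep r V"
  proof
    assume L: "\<forall>c. (\<forall>k<r. (\<Sum>\<beta>\<in>V. c \<beta> * \<beta> k) = 0) \<longrightarrow> (\<forall>\<beta>\<in>V. c \<beta> = 0)"
    show "indep r V" unfolding indep_def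
    proof
      fix b assume b: "b \<in> V"
      have "b \<notin> lin_hull r (V - {b})"
      proof
        assume "b \<in> lin_hull r (V - {b})"
        then obtain c where c: "b = (\<lambda>k. \<Sum>\<beta>\<in>V - {b}. c \<beta> * \<beta> k)" by (auto simp: lin_hull_def)
        have "(\<Sum>\<beta>\<in>V. (c(b := -1)) \<beta> * \<beta> k) = 0" for k
        proof -
          have "(\<Sum>\<beta>\<in>V. (c(b := -1)) \<beta> * \<beta> k) = - b k + (\<Sum>\<beta>\<in>V - {b}. (c(b := -1)) \<beta> * \<beta> k)"
            using fin b by (subst sum.remove[of V b]) auto
          also have "(\<Sum>\<beta>\<in>V - {b}. (c(b := -1)) \<beta> * \<beta> k) = (\<Sum>\<beta>\<in>V - {b}. c \<beta> * \<beta> k)"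
            by (intro sum.cong) auto
          also have "\<dots> = b k" using fun_cong[OF c, of k] by simp
          finally show ?thesis by simp
        qed
        hence "(c(b := -1)) b = 0" using L b by blast
        thus False by simp
      qed
      thus "\<exists>m\<in>perp r (V - {b}). ipr r b m = 1"
        using separating_vector[of "V - {b}" r b] fin V b by blast
    qed
  next
    assume R: "indep r V"
    show "\<forall>c. (\<forall>k<r. (\<Sum>\<beta>\<in>V. c \<beta> * \<beta> k) = 0) \<longrightarrow> (\<forall>\<beta>\<in>V. c \<beta> = 0)"
    proof (intro allI impI ballI)
      fix c b assume c: "\<forall>k<r. (\<Sum>\<beta>\<in>V. c \<beta> * \<beta> k) = 0" and b: "b \<in> V"
      obtain m where m: "m \<in> perp r (V - {b})" "ipr r b m = 1" using R b by (auto simp: indep_def)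
      have "0 = ipr r (\<lambda>k. \<Sum>\<beta>\<in>V. c \<beta> * \<beta> k) m" using c by (simp add: ipr_def)
      also have "\<dots> = (\<Sum>\<beta>\<in>V. c \<beta> * ipr r \<beta> m)" by (rule ipr_sum_left)
      also have "\<dots> = c b * ipr r b m + (\<Sum>\<beta>\<in>V - {b}. c \<beta> * ipr r \<beta> m)"
        using fin b by (subst sum.remove[of V b]) auto
      also have "(\<Sum>\<beta>\<in>V - {b}. c \<beta> * ipr r \<beta> m) = 0"
        using m(1) by (intro sum.neutral) (auto simp: perp_def)
      finally show "c b = 0" using m(2) by simp
    qed
  qed
  have B: "Vsp r \<subseteq> lin_hull r V \<longleftrightarrow> perp r V = {\<lambda>_. 0}"
  proof
    assume L: "Vsp r \<subseteq> lin_hull r V"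
    have "m = (\<lambda>_. 0)" if m: "m \<in> perp r V" for m
      using lin_hull_perp[OF _ m, of m] L m ipr_self_eq_0[of m r] by (auto simp: perp_def)
    moreover have "(\<lambda>_. 0) \<in> perp r V" by (simp add: perp_def Vsp_def ipr_def)
    ultimately show "perp r V = {\<lambda>_. 0}" by blast
  next
    assume R: "perp r V = {\<lambda>_. 0}"
    show "Vsp r \<subseteq> lin_hull r V"
      using lin_hull_iff[OF fin V] by (auto simp: R ipr_def)
  qed
  show ?thesis unfolding is_basis_def A B using True by simp
qed (auto simp: is_basis_def)

text \<open>The separating vector of the new element serves as its dual vector and corrects the old
  ones, on which it does not act.\<close>

lemma indep_insert:
  assumes "finite F" "F \<subseteq> Vsp r" "x \<in> Vsp r" "x \<notin> lin_hull r F" "indep r F"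
  shows "indep r (insert x F)"
  unfolding indep_def
proof
  fix b assume b: "b \<in> insert x F"
  obtain n where n: "n \<in> perp r F" "ipr r x n = 1" using separating_vector[OF assms(1-4)] by blast
  show "\<exists>m\<in>perp r (insert x F - {b}). ipr r b m = 1"
  proof (cases "b = x")
    case True
    thus ?thesis using n by (auto simp: perp_def)
  next
    case False
    hence "b \<in> F" using b by simp
    then obtain m where m: "m \<in> perp r (F - {b})" "ipr r b m = 1" using assms(5) by (auto simp: indep_def)
    have "ipr r b n = 0" using n \<open>b \<in> F\<close> by (auto simp: perp_def)
    hence "ipr r b (\<lambda>k. m k - ipr r x m * n k) = 1" by (simp add: ipr_diff_scale_right m)
    moreover have "(\<lambda>k. m k - ipr r x m * n k) \<in> perp r (insert x F - {b})"
      using m n by (auto simp: perp_def ipr_diff_scale_right Vsp_diff_scale)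
    ultimately show ?thesis by blast
  qed
qed

section \<open>Long and short roots with their coroots\<close>

definition lr :: "nat \<Rightarrow> nat \<Rightarrow> real" where "lr i = (\<lambda>k. 2 * ev i k)"

definition short_roots :: "nat \<Rightarrow> (nat \<Rightarrow> real) set" where
  "short_roots r = {(\<lambda>k. ev a k + s * ev c k) | a c s. a < c \<and> c < r \<and> (s = 1 \<or> s = - 1)}"

lemma inj_lr: "inj lr"
proof (rule injI)
  fix i j assume "lr i = lr j"
  hence "lr i i = lr j i" by simp
  thus "i = j" by (simp add: lr_def ev_def split: if_splits)
qed

lemma long_posroots_eq: "long_posroots_C r = lr ` {..<r}"
  by (auto simp: long_posroots_C_def lr_def)

lemma posroots_eq: "posroots_C r = short_roots r \<union> lr ` {..<r}"
proof -
  have "short_roots r = {(\<lambda>k. ev i k - ev j k) | i j. i < j \<and> j < r} \<union> {(\<lambda>k. ev i k + ev j k) | i j. i < j \<and> j < r}"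
    unfolding short_roots_def
  proof (intro subset_antisym subsetI)
    fix x assume "x \<in> {(\<lambda>k. ev a k + s * ev c k) | a c s. a < c \<and> c < r \<and> (s = 1 \<or> s = - 1)}"
    then obtain a c and s :: real where "x = (\<lambda>k. ev a k + s * ev c k)" "a < c" "c < r" "s = 1 \<or> s = - 1" by auto
    thus "x \<in> {(\<lambda>k. ev i k - ev j k) | i j. i < j \<and> j < r} \<union> {(\<lambda>k. ev i k + ev j k) | i j. i < j \<and> j < r}"
      by auto
  next
    fix x assume "x \<in> {(\<lambda>k. ev i k - ev j k) | i j. i < j \<and> j < r} \<union> {(\<lambda>k. ev i k + ev j k) | i j. i < j \<and> j < r}"
    thus "x \<in> {(\<lambda>k. ev a k + s * ev c k) | a c s. a < c \<and> c < r \<and> (s = 1 \<or> s = - 1)}"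
    proof
      assume "x \<in> {(\<lambda>k. ev i k - ev j k) | i j. i < j \<and> j < r}"
      then obtain i j where "x = (\<lambda>k. ev i k + (- 1) * ev j k)" "i < j" "j < r" by auto
      thus ?thesis by blast
    next
      assume "x \<in> {(\<lambda>k. ev i k + ev j k) | i j. i < j \<and> j < r}"
      then obtain i j where "x = (\<lambda>k. ev i k + 1 * ev j k)" "i < j" "j < r" by auto
      thus ?thesis by blast
    qed
  qed
  thus ?thesis by (auto simp: posroots_C_def lr_def)
qed

lemma short_roots_cases:
  assumes "x \<in> short_roots r"
  obtains a c s where "x = (\<lambda>k. ev a k + s * ev c k)" "a < c" "c < r" "s = 1 \<or> s = - 1"
  using assms unfolding short_roots_def by blast

lemma lr_notin_short: "lr i \<notin> short_roots r"
proof
  assume "lr i \<in> short_roots r"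
  then obtain a c s where x: "lr i = (\<lambda>k. ev a k + s * ev c k)" "a < c" "s = 1 \<or> s = - 1"
    by (rule short_roots_cases)
  have "lr i a = 1" "lr i c = s" unfolding x(1) using x(2) by (auto simp: ev_def)
  thus False using x by (auto simp: lr_def ev_def split: if_splits)
qed

lemma short_roots_eq: "posroots_C r - long_posroots_C r = short_roots r"
  using lr_notin_short by (auto simp: posroots_eq long_posroots_eq)

lemma short_roots_Vsp: "short_roots r \<subseteq> Vsp r"
  by (auto simp: short_roots_def Vsp_def ev_def)

lemma lr_Vsp: "i < r \<Longrightarrow> lr i \<in> Vsp r"
  by (auto simp: lr_def Vsp_def ev_def)

lemma ipr_lr: "i < r \<Longrightarrow> ipr r (lr i) m = 2 * m i"
  using ipr_ev_left[of i r m] by (simp add: ipr_def lr_def mult.assoc flip: sum_distrib_left)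

lemma ipr_short: "a < r \<Longrightarrow> c < r \<Longrightarrow> ipr r (\<lambda>k. ev a k + s * ev c k) m = m a + s * m c"
  using ipr_ev_left[of a r m] ipr_ev_left[of c r m]
  by (simp add: ipr_def algebra_simps sum.distrib flip: sum_distrib_left)

lemma coroot_lr: "i < r \<Longrightarrow> coroot r (lr i) = ev i"
proof -
  assume i: "i < r"
  have "ipr r (lr i) (lr i) = 4" unfolding ipr_lr[OF i] by (simp add: lr_def ev_def)
  thus ?thesis by (simp add: coroot_def lr_def)
qed

lemma coroot_short:
  assumes "x \<in> short_roots r" shows "coroot r x = x"
proof -
  obtain a c s where x: "x = (\<lambda>k. ev a k + s * ev c k)" "a < c" "c < r" "s = 1 \<or> s = - 1"
    using assms by (rule short_roots_cases)
  have "ipr r x x = x a + s * x c" unfolding x(1) by (rule ipr_short) (use x in auto)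
  also have "\<dots> = 2" using x by (auto simp: ev_def)
  finally show ?thesis by (simp add: coroot_def)
qed

section \<open>Flats of the short roots\<close>

text \<open>The condition in \<open>bases_A\<close> involves a basis only through its part in
  \<open>set nus\<close>; this is that condition for the part alone. For members of \<open>B\<close>
  it yields independence, for the other roots it excludes broken circuits.\<close>

definition nbc :: "nat \<Rightarrow> (nat \<Rightarrow> real) list \<Rightarrow> (nat \<Rightarrow> real) set \<Rightarrow> bool" where
  "nbc r nus B \<longleftrightarrow> B \<subseteq> set nus \<and> (\<forall>j<length nus. nus ! j \<notin> lin_hull r (B \<inter> set (take j nus)))"

text \<open>\<open>B\<close> is built up in the order of the list, so every new element lies outside
  the span of those already present.\<close>

lemma nbc_induct [consumes 1, case_names empty insert]:
  assumes "nbc r nus B" "P {}"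
    and ins: "\<And>F x. F \<subseteq> set nus \<Longrightarrow> x \<in> set nus \<Longrightarrow> x \<notin> lin_hull r F \<Longrightarrow> P F \<Longrightarrow> P (insert x F)"
  shows "P B"
proof -
  have "P (B \<inter> set (take j nus))" if "j \<le> length nus" for j
    using that
  proof (induction j)
    case (Suc j)
    have t: "set (take (Suc j) nus) = insert (nus ! j) (set (take j nus))"
      using Suc.prems by (simp add: take_Suc_conv_app_nth)
    show ?case
    proof (cases "nus ! j \<in> B")
      case True
      have "P (insert (nus ! j) (B \<inter> set (take j nus)))"
      proof (rule ins)
        show "nus ! j \<notin> lin_hull r (B \<inter> set (take j nus))" using assms(1) Suc.prems by (simp add: nbc_def)
      qed (use Suc set_take_subset[of j nus] in auto)
      thus ?thesis using True by (simp add: t)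
    next
      case False
      hence "B \<inter> set (take (Suc j) nus) = B \<inter> set (take j nus)" by (auto simp: t)
      thus ?thesis using Suc by simp
    qed
  qed (simp add: assms(2))
  from this[of "length nus"] show ?thesis using assms(1) by (simp add: nbc_def Int_absorb2)
qed

text \<open>A signed partition encodes the solution space of the equations x i = e i * x (p i): the index
  i is tied to its representative p i with sign e i, and e i = 0 forces the coordinate to vanish.\<close>

definition reps :: "nat \<Rightarrow> (nat \<Rightarrow> nat) \<Rightarrow> (nat \<Rightarrow> real) \<Rightarrow> nat set" where
  "reps r p e = {i. i < r \<and> p i = i \<and> e i = 1}"

definition signed_partition :: "nat \<Rightarrow> (nat \<Rightarrow> nat) \<Rightarrow> (nat \<Rightarrow> real) \<Rightarrow> bool" where
  "signed_partition r p e \<longleftrightarrow> (\<forall>i<r. e i = 0 \<or> (e i = 1 \<or> e i = - 1) \<and> p i \<in> reps r p e)"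

text \<open>The representatives are the free coordinates of the flat; the cardinality condition is
  rank plus nullity for independent \<open>B\<close> and later balances the signs.\<close>

definition represents :: "nat \<Rightarrow> (nat \<Rightarrow> nat) \<Rightarrow> (nat \<Rightarrow> real) \<Rightarrow> (nat \<Rightarrow> real) set \<Rightarrow> bool" where
  "represents r p e B \<longleftrightarrow> signed_partition r p e \<and> perp r B = {m \<in> Vsp r. \<forall>i<r. m i = e i * m (p i)}
     \<and> card B + card (reps r p e) = r"

lemma finite_reps: "finite (reps r p e)"
  by (rule finite_subset[of _ "{..<r}"]) (auto simp: reps_def)

text \<open>Adding the equation that a representative vanishes sends its whole block to the zero
  coordinates.\<close>

lemma signed_partition_kill:
  assumes sp: "signed_partition r p e" and q: "q \<in> reps r p e"
  defines "e' \<equiv> \<lambda>i. if p i = q then 0 else e i"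
  shows "signed_partition r p e'" "reps r p e' = reps r p e - {q}"
    "(\<forall>i<r. m i = e' i * m (p i)) \<longleftrightarrow> (\<forall>i<r. m i = e i * m (p i)) \<and> m q = 0"
proof -
  have q': "q < r" "p q = q" "e q = 1" using q by (auto simp: reps_def)
  show R: "reps r p e' = reps r p e - {q}" by (auto simp: reps_def e'_def)
  show "signed_partition r p e'"
    using sp unfolding signed_partition_def R by (auto simp: e'_def)
  show "(\<forall>i<r. m i = e' i * m (p i)) \<longleftrightarrow> (\<forall>i<r. m i = e i * m (p i)) \<and> m q = 0"
  proof
    assume L: "\<forall>i<r. m i = e' i * m (p i)"
    have mq: "m q = 0" using L[rule_format, OF q'(1)] q' by (simp add: e'_def)
    have "m i = e i * m (p i)" if "i < r" for i
      using L[rule_format, OF that] mq by (cases "p i = q") (auto simp: e'_def)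
    thus "(\<forall>i<r. m i = e i * m (p i)) \<and> m q = 0" using mq by blast
  next
    assume R: "(\<forall>i<r. m i = e i * m (p i)) \<and> m q = 0"
    show "\<forall>i<r. m i = e' i * m (p i)"
    proof (intro allI impI)
      fix i assume "i < r"
      hence "m i = e i * m (p i)" using R by blast
      thus "m i = e' i * m (p i)" using conjunct2[OF R] by (cases "p i = q") (auto simp: e'_def)
    qed
  qed
qed

text \<open>Adding an equation between two representatives attaches one block to the other with
  relative sign \<open>s\<close>.\<close>

lemma signed_partition_merge:
  assumes sp: "signed_partition r p e" and q: "q \<in> reps r p e" "q' \<in> reps r p e" "q \<noteq> q'" and s: "s = 1 \<or> s = - 1"
  defines "e' \<equiv> \<lambda>i. if p i = q then e i * s else e i"
  defines "p' \<equiv> \<lambda>i. if p i = q then q' else p i"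
  shows "signed_partition r p' e'" "reps r p' e' = reps r p e - {q}"
    "(\<forall>i<r. m i = e' i * m (p' i)) \<longleftrightarrow> (\<forall>i<r. m i = e i * m (p i)) \<and> m q = s * m q'"
proof -
  have q': "q < r" "p q = q" "e q = 1" "q' < r" "p q' = q'" "e q' = 1" using q by (auto simp: reps_def)
  show R: "reps r p' e' = reps r p e - {q}"
    using q q' by (auto simp: reps_def e'_def p'_def split: if_splits)
  show "signed_partition r p' e'"
    using sp s q unfolding signed_partition_def R by (auto simp: e'_def p'_def)
  show "(\<forall>i<r. m i = e' i * m (p' i)) \<longleftrightarrow> (\<forall>i<r. m i = e i * m (p i)) \<and> m q = s * m q'"
  proof
    assume L: "\<forall>i<r. m i = e' i * m (p' i)"
    have mq: "m q = s * m q'" using L[rule_format, OF q'(1)] q' by (simp add: e'_def p'_def)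
    have "m i = e i * m (p i)" if "i < r" for i
      using L[rule_format, OF that] mq by (cases "p i = q") (auto simp: e'_def p'_def)
    thus "(\<forall>i<r. m i = e i * m (p i)) \<and> m q = s * m q'" using mq by blast
  next
    assume R: "(\<forall>i<r. m i = e i * m (p i)) \<and> m q = s * m q'"
    show "\<forall>i<r. m i = e' i * m (p' i)"
    proof (intro allI impI)
      fix i assume "i < r"
      hence "m i = e i * m (p i)" using R by blast
      thus "m i = e' i * m (p' i)" using conjunct2[OF R] by (cases "p i = q") (auto simp: e'_def p'_def)
    qed
  qed
qed

lemma perp_insert: "perp r (insert x B) = {m \<in> perp r B. ipr r x m = 0}"
  by (auto simp: perp_def)

text \<open>On the flat, the root becomes a linear form in at most two representatives with
  coefficients 1 or -1, or twice such a coefficient on one of them. Its kernel is obtained by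
  killing or merging one block.\<close>

lemma represents_insert:
  assumes rep: "represents r p e F" and F: "finite F" "F \<subseteq> Vsp r"
    and x: "x \<in> short_roots r" "x \<notin> lin_hull r F"
  shows "\<exists>p' e'. represents r p' e' (insert x F)"
proof -
  obtain a c s where xe: "x = (\<lambda>k. ev a k + s * ev c k)" and ac: "a < c" "c < r" and s: "s = 1 \<or> s = - 1"
    using x(1) by (rule short_roots_cases)
  have ar: "a < r" using ac by simp
  have sp: "signed_partition r p e" and pF: "perp r F = {m \<in> Vsp r. \<forall>i<r. m i = e i * m (p i)}"
    and cF: "card F + card (reps r p e) = r" using rep by (auto simp: represents_def)
  have xV: "x \<in> Vsp r" using x(1) short_roots_Vsp by blast
  have ix: "ipr r x m = m a + s * m c" for m unfolding xe by (rule ipr_short[OF ar ac(2)])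
  have xm: "ipr r x m = e a * m (p a) + s * e c * m (p c)" if "m \<in> perp r F" for m
  proof -
    have "m a = e a * m (p a)" "m c = e c * m (p c)" using that ar ac(2) unfolding pF by blast+
    thus ?thesis unfolding ix by (simp only: mult.assoc)
  qed
  \<comment> \<open>A root outside the span does not vanish identically on the flat. This rules out
    the degenerate cases below and shows that \<open>x\<close> is new.\<close>
  obtain m0 where m0: "m0 \<in> perp r F" "ipr r x m0 \<noteq> 0"
    using x(2) lin_hull_iff[OF F xV] by blast
  have xF: "x \<notin> F" using m0 by (auto simp: perp_def)
  \<comment> \<open>Common end of all cases: one root is gained and exactly one representative is
    lost.\<close>
  have card: "represents r p' e' (insert x F)"
    if "signed_partition r p' e'" "reps r p' e' = reps r p e - {q}" "q \<in> reps r p e"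
      "\<And>m. m \<in> Vsp r \<Longrightarrow> (\<forall>i<r. m i = e' i * m (p' i)) \<longleftrightarrow> (\<forall>i<r. m i = e i * m (p i)) \<and> ipr r x m = 0" for p' e' q
  proof -
    have "card (reps r p e) = Suc (card (reps r p' e'))"
      using that(3) finite_reps[of r p e] unfolding that(2) by (metis card_Suc_Diff1)
    moreover have "perp r (insert x F) = {m \<in> Vsp r. \<forall>i<r. m i = e' i * m (p' i)}"
      unfolding perp_insert pF using that(4) by blast
    ultimately show ?thesis using that(1) cF xF F(1) unfolding represents_def by simp
  qed
  have kill: ?thesis if q: "q \<in> reps r p e" and eq: "\<And>m. m \<in> perp r F \<Longrightarrow> ipr r x m = 0 \<longleftrightarrow> m q = 0" for q
  proof -
    note k = signed_partition_kill[OF sp q]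
    have "represents r p (\<lambda>i. if p i = q then 0 else e i) (insert x F)"
      by (rule card[OF k(1,2) q]) (use eq k(3) pF in blast)
    thus ?thesis by blast
  qed
  have ea: "e a = 0 \<or> (e a = 1 \<or> e a = - 1) \<and> p a \<in> reps r p e"
   and ec: "e c = 0 \<or> (e c = 1 \<or> e c = - 1) \<and> p c \<in> reps r p e"
    using sp ar ac(2) by (auto simp: signed_partition_def)
  consider "e a = 0" "e c = 0" | "e a \<noteq> 0" "e c = 0" | "e a = 0" "e c \<noteq> 0" | "e a \<noteq> 0" "e c \<noteq> 0" "p a = p c" | "e a \<noteq> 0" "e c \<noteq> 0" "p a \<noteq> p c" by blast
  thus ?thesis
  proof cases
    case 1
    thus ?thesis using xm[OF m0(1)] m0(2) by simp
  next
    case 2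
    thus ?thesis using kill[of "p a"] ea xm by auto
  next
    case 3
    thus ?thesis using kill[of "p c"] ec xm s by auto
  next
    case 4
    have xm': "ipr r x m = (e a + s * e c) * m (p a)" if "m \<in> perp r F" for m
      using xm[OF that] 4 by (simp add: algebra_simps)
    hence "e a + s * e c \<noteq> 0" using m0 by auto
    thus ?thesis using kill[of "p a"] ea 4 xm' by auto
  next
    case 5
    \<comment> \<open>The equation \<open>e a * m (p a) + s * e c * m (p c) = 0\<close> solved for
      \<open>m (p a)\<close>, using that \<open>e a\<close> is its own inverse.\<close>
    define s' where "s' = - s * e a * e c"
    have s': "s' = 1 \<or> s' = - 1" using s ea ec 5 by (auto simp: s'_def)
    have pa: "p a \<in> reps r p e" and pc: "p c \<in> reps r p e" using ea ec 5 by auto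
    have "ipr r x m = 0 \<longleftrightarrow> m (p a) = s' * m (p c)" if "m \<in> perp r F" for m
      using xm[OF that] 5 ea ec s by (auto simp: s'_def)
    hence eq: "\<And>m. m \<in> perp r F \<Longrightarrow> ipr r x m = 0 \<longleftrightarrow> m (p a) = s' * m (p c)" .
    note k = signed_partition_merge[OF sp pa pc 5(3) s']
    have "represents r (\<lambda>i. if p i = p a then p c else p i) (\<lambda>i. if p i = p a then e i * s' else e i) (insert x F)"
      by (rule card[OF k(1,2) pa]) (use eq k(3) pF in blast)
    thus ?thesis by blast
  qed
qed

lemma nbc_represents:
  assumes "nbc r nus B" "set nus = short_roots r"
  shows "(\<exists>p e. represents r p e B) \<and> indep r B \<and> finite B \<and> B \<subseteq> short_roots r"
  using assms(1)
proof (induction rule: nbc_induct)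
  case empty
  have "reps r id (\<lambda>_. 1) = {..<r}" by (auto simp: reps_def)
  hence "represents r id (\<lambda>_. 1) {}" by (auto simp: represents_def signed_partition_def perp_def)
  thus ?case by (auto simp: indep_def)
next
  case (insert F x)
  have F: "finite F" "F \<subseteq> Vsp r" "x \<in> short_roots r" "x \<in> Vsp r"
    using insert short_roots_Vsp[of r] assms(2) by auto
  obtain p e where "represents r p e F" using insert by blast
  from represents_insert[OF this F(1-3) insert(3)] indep_insert[OF F(1,2,4) insert(3)] insert F
  show ?case by simp
qed

section \<open>Blocks of a flat and completion to a basis by long roots\<close>

definition blk :: "nat \<Rightarrow> (nat \<Rightarrow> nat) \<Rightarrow> (nat \<Rightarrow> real) \<Rightarrow> nat \<Rightarrow> nat set" where
  "blk r p e \<rho> = {i. i < r \<and> e i \<noteq> 0 \<and> p i = \<rho>}"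

text \<open>Signed indicators of the blocks of the representatives; they lie in the flat and provide
  the dual vectors of the long roots.\<close>

definition blk_vec :: "nat \<Rightarrow> (nat \<Rightarrow> nat) \<Rightarrow> (nat \<Rightarrow> real) \<Rightarrow> nat \<Rightarrow> nat \<Rightarrow> real" where
  "blk_vec r p e \<rho> i = (if i \<in> blk r p e \<rho> then e i else 0)"

lemma blk_rep:
  assumes "\<rho> \<in> reps r p e" shows "\<rho> \<in> blk r p e \<rho>" "blk_vec r p e \<rho> \<rho> = 1"
  using assms by (auto simp: reps_def blk_def blk_vec_def)

lemma blk_rep_mem:
  assumes "signed_partition r p e" "i < r" "e i \<noteq> 0"
  shows "p i \<in> reps r p e" "i \<in> blk r p e (p i)" "e i * e i = 1"
  using assms by (auto simp: signed_partition_def blk_def)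

lemma blk_vec_perp:
  assumes "represents r p e B" "\<rho> \<in> reps r p e"
  shows "blk_vec r p e \<rho> \<in> perp r B"
proof -
  have sp: "signed_partition r p e" and pB: "perp r B = {m \<in> Vsp r. \<forall>i<r. m i = e i * m (p i)}"
    using assms by (auto simp: represents_def)
  have "blk_vec r p e \<rho> i = e i * blk_vec r p e \<rho> (p i)" if i: "i < r" for i
  proof (cases "e i = 0")
    case False
    hence "p i \<in> reps r p e" using blk_rep_mem[OF sp i] by simp
    thus ?thesis using False i by (auto simp: blk_vec_def blk_def reps_def)
  qed (simp add: blk_vec_def blk_def)
  thus ?thesis unfolding pB by (auto simp: Vsp_def blk_vec_def blk_def)
qed

lemma represents_perp:
  "represents r p e B \<Longrightarrow> m \<in> perp r B \<Longrightarrow> i < r \<Longrightarrow> m i = e i * m (p i)"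
  unfolding represents_def by blast

text \<open>A block without selected index leaves its signed indicator orthogonal to everything. Two
  selected indices in one block have proportional coordinates on the flat, and an index outside all
  blocks has coordinate 0 there; either contradicts independence.\<close>

lemma basis_imp_transversal:
  assumes rep: "represents r p e B" and B: "B \<subseteq> short_roots r" and I: "I \<subseteq> {..<r}"
    and bas: "is_basis r (B \<union> lr ` I)"
  shows "\<exists>g\<in>PiE (reps r p e) (blk r p e). I = g ` reps r p e"
proof -
  let ?V = "B \<union> lr ` I"
  have sp: "signed_partition r p e" using rep by (auto simp: represents_def)
  have fin: "finite ?V" and VV: "?V \<subseteq> Vsp r" and ind: "indep r ?V" and pV: "perp r ?V = {\<lambda>_. 0}"
    using bas by (auto simp: is_basis_iff)
  have ex: "\<exists>i. i \<in> I \<inter> blk r p e \<rho>" if \<rho>: "\<rho> \<in> reps r p e" for \<rho>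
  proof (rule ccontr)
    assume "\<nexists>i. i \<in> I \<inter> blk r p e \<rho>"
    hence "blk_vec r p e \<rho> \<in> perp r ?V"
      using blk_vec_perp[OF rep \<rho>] I ipr_lr[of _ r "blk_vec r p e \<rho>"] by (auto simp: perp_def blk_vec_def subset_iff)
    hence "blk_vec r p e \<rho> \<rho> = 0" unfolding pV by simp
    thus False using blk_rep[OF \<rho>] by simp
  qed
  \<comment> \<open>The dual vector of \<open>lr i\<close> read as a point of the flat of
    \<open>B\<close> that vanishes at every other selected index.\<close>
  have dual: "\<exists>m\<in>perp r B. m i \<noteq> 0 \<and> (\<forall>i'\<in>I. i' \<noteq> i \<longrightarrow> m i' = 0)" if i: "i \<in> I" for i
  proof -
    obtain m where m: "m \<in> perp r (?V - {lr i})" "ipr r (lr i) m = 1" using ind i by (auto simp: indep_def)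
    have "B \<subseteq> ?V - {lr i}" using B lr_notin_short by auto
    hence "m \<in> perp r B" using m(1) by (auto simp: perp_def)
    moreover have "m i \<noteq> 0" using m(2) ipr_lr[of i r m] i I by auto
    moreover have "m i' = 0" if "i' \<in> I" "i' \<noteq> i" for i'
    proof -
      have "lr i' \<in> ?V - {lr i}" using that inj_lr by (auto dest: injD)
      hence "ipr r (lr i') m = 0" using m(1) by (simp only: perp_def mem_Collect_eq)
      thus ?thesis using ipr_lr[of i' r m] that I by auto
    qed
    ultimately show ?thesis by blast
  qed
  have nz: "e i \<noteq> 0" if i: "i \<in> I" for i
  proof -
    obtain m where m: "m \<in> perp r B" "m i \<noteq> 0" using dual[OF i] by blast
    have "m i = e i * m (p i)" using represents_perp[OF rep m(1)] i I by auto
    thus ?thesis using m(2) by auto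
  qed
  have uniq: "i = i'" if i: "i \<in> I" "i' \<in> I" "p i = p i'" for i i'
  proof (rule ccontr)
    assume ne: "i \<noteq> i'"
    obtain m where m: "m \<in> perp r B" "m i \<noteq> 0" "m i' = 0" using dual[OF i(1)] i(2) not_sym[OF ne] by blast
    have "m i = e i * m (p i)" "m i' = e i' * m (p i')"
      using represents_perp[OF rep m(1)] i I by auto
    thus False using m i(3) nz[OF i(2)] by simp
  qed
  define g where "g = restrict (\<lambda>\<rho>. SOME i. i \<in> I \<inter> blk r p e \<rho>) (reps r p e)"
  have g: "g \<rho> \<in> I \<inter> blk r p e \<rho>" if "\<rho> \<in> reps r p e" for \<rho>
    using someI_ex[OF ex[OF that]] that by (simp add: g_def)
  have "i \<in> g ` reps r p e" if i: "i \<in> I" for i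
  proof -
    have pi: "p i \<in> reps r p e" using blk_rep_mem(1)[OF sp _ nz[OF i]] i I by auto
    have "g (p i) = i" using uniq[of "g (p i)" i] g[OF pi] i by (auto simp: blk_def)
    thus ?thesis using pi by (metis imageI)
  qed
  hence "I = g ` reps r p e" using g by auto
  moreover have "g \<in> PiE (reps r p e) (blk r p e)" using g by (auto simp: g_def PiE_def)
  ultimately show ?thesis by blast
qed

lemma transversal_dual:
  assumes sp: "signed_partition r p e" and g: "g \<in> PiE (reps r p e) (blk r p e)" and \<rho>: "\<rho> \<in> reps r p e" "\<rho>' \<in> reps r p e"
  shows "e (g \<rho>) * blk_vec r p e \<rho> (g \<rho>') = (if \<rho>' = \<rho> then 1 else 0)"
proof -
  have "g \<rho>' \<in> blk r p e \<rho>'" "g \<rho> \<in> blk r p e \<rho>" using g \<rho> by auto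
  thus ?thesis using blk_rep_mem(3)[OF sp, of "g \<rho>"] by (auto simp: blk_vec_def blk_def)
qed

lemma transversal_inj:
  assumes "g \<in> PiE (reps r p e) (blk r p e)" shows "inj_on g (reps r p e)" "\<rho> \<in> reps r p e \<Longrightarrow> p (g \<rho>) = \<rho>" "\<rho> \<in> reps r p e \<Longrightarrow> g \<rho> < r"
proof -
  show 1: "p (g \<rho>) = \<rho>" "g \<rho> < r" if "\<rho> \<in> reps r p e" for \<rho> using assms that by (auto simp: blk_def)
  show "inj_on g (reps r p e)" by (rule inj_on_inverseI[where g = p]) (rule 1)
qed

text \<open>Dual vectors are exhibited: a rescaled block indicator for each long root, and for
  \<open>b\<close> in \<open>B\<close> its dual vector inside \<open>B\<close>, corrected along the
  flat to vanish at the chosen indices.\<close>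

lemma transversal_imp_basis:
  assumes rep: "represents r p e B" and B: "finite B" "B \<subseteq> short_roots r" "indep r B"
    and g: "g \<in> PiE (reps r p e) (blk r p e)"
  shows "is_basis r (B \<union> lr ` g ` reps r p e)"
proof -
  let ?R = "reps r p e"
  let ?V = "B \<union> lr ` g ` ?R"
  have sp: "signed_partition r p e" using rep by (auto simp: represents_def)
  note gi = transversal_inj[OF g]
  have V: "?V \<subseteq> Vsp r" using B(2) short_roots_Vsp[of r] lr_Vsp[of _ r] gi(3) by auto
  have m0: "m = (\<lambda>_. 0)" if m: "m \<in> perp r ?V" for m
  proof
    fix i
    have mB: "m \<in> perp r B" using m by (auto simp: perp_def)
    have "m \<rho> = 0" if \<rho>: "\<rho> \<in> ?R" for \<rho>
    proof -
      have "ipr r (lr (g \<rho>)) m = 0" using m \<rho> by (auto simp: perp_def)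
      hence "m (g \<rho>) = 0" using ipr_lr[OF gi(3)[OF \<rho>]] by simp
      moreover have "m (g \<rho>) = e (g \<rho>) * m \<rho>"
        using represents_perp[OF rep mB gi(3)[OF \<rho>]] gi(2)[OF \<rho>] by simp
      moreover have "e (g \<rho>) \<noteq> 0" using g \<rho> by (auto simp: blk_def)
      ultimately show ?thesis by simp
    qed
    moreover have "m i = e i * m (p i)" if "i < r" using represents_perp[OF rep mB that] .
    moreover have "m i = 0" if "\<not> i < r" using mB that by (auto simp: perp_def Vsp_def)
    ultimately show "m i = 0" using blk_rep_mem(1)[OF sp, of i] by (cases "i < r"; cases "e i = 0") auto
  qed
  have "perp r ?V = {\<lambda>_. 0}"
  proof
    show "{\<lambda>_. 0} \<subseteq> perp r ?V" by (auto simp: perp_def Vsp_def ipr_def)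
  qed (use m0 in blast)
  moreover have "indep r ?V"
    unfolding indep_def
  proof
    fix b assume "b \<in> ?V"
    thus "\<exists>m\<in>perp r (?V - {b}). ipr r b m = 1"
    proof
      assume b: "b \<in> B"
      then obtain m where m: "m \<in> perp r (B - {b})" "ipr r b m = 1" using B(3) by (auto simp: indep_def)
      \<comment> \<open>The point of the flat that agrees with \<open>m\<close> at all chosen
        indices; subtracting it does not change the pairings with \<open>B\<close>.\<close>
      define w where "w k = (\<Sum>\<rho>\<in>?R. (m (g \<rho>) * e (g \<rho>)) * blk_vec r p e \<rho> k)" for k
      have wB: "w \<in> perp r B"
      proof -
        have "ipr r x w = 0" if "x \<in> B" for x
        proof -
          have "ipr r x w = (\<Sum>\<rho>\<in>?R. (m (g \<rho>) * e (g \<rho>)) * ipr r x (blk_vec r p e \<rho>))"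
            unfolding ipr_def w_def sum_distrib_left by (subst sum.swap) (simp add: mult_ac)
          also have "\<dots> = 0" using blk_vec_perp[OF rep] that by (intro sum.neutral) (auto simp: perp_def)
          finally show ?thesis .
        qed
        moreover have "w \<in> Vsp r" by (auto simp: Vsp_def w_def blk_vec_def blk_def intro!: sum.neutral)
        ultimately show ?thesis by (simp add: perp_def)
      qed
      have wg: "w (g \<rho>) = m (g \<rho>)" if \<rho>: "\<rho> \<in> ?R" for \<rho>
      proof -
        have "w (g \<rho>) = (\<Sum>\<rho>'\<in>?R. if \<rho> = \<rho>' then m (g \<rho>') else 0)"
          unfolding w_def mult.assoc using transversal_dual[OF sp g _ \<rho>] by (intro sum.cong refl) simp
        thus ?thesis using \<rho> finite_reps[of r p e] by simp
      qed
      have "(\<lambda>k. m k - 1 * w k) \<in> perp r (?V - {b})"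
        unfolding perp_def
      proof (intro CollectI conjI ballI)
        show "(\<lambda>k. m k - 1 * w k) \<in> Vsp r" using m wB by (intro Vsp_diff_scale) (auto simp: perp_def)
        fix x assume "x \<in> ?V - {b}"
        hence "x \<in> B - {b} \<or> x \<in> lr ` g ` ?R" by auto
        thus "ipr r x (\<lambda>k. m k - 1 * w k) = 0"
        proof
          assume "x \<in> B - {b}"
          thus ?thesis unfolding ipr_diff_scale_right using m wB by (simp add: perp_def)
        next
          assume "x \<in> lr ` g ` ?R"
          then obtain \<rho> where \<rho>: "\<rho> \<in> ?R" "x = lr (g \<rho>)" by auto
          show ?thesis unfolding \<rho>(2) ipr_lr[OF gi(3)[OF \<rho>(1)]] using wg[OF \<rho>(1)] by simp
        qed
      qed
      moreover have "ipr r b (\<lambda>k. m k - 1 * w k) = 1"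
        unfolding ipr_diff_scale_right using m wB b by (simp add: perp_def)
      ultimately show ?thesis by blast
    next
      assume "b \<in> lr ` g ` ?R"
      then obtain \<rho> where \<rho>: "\<rho> \<in> ?R" "b = lr (g \<rho>)" by auto
      \<comment> \<open>The factor 1/2 compensates that pairing with \<open>lr i\<close> doubles
        coordinate \<open>i\<close>. The subtraction form matches
        \<open>ipr_diff_scale_right\<close>.\<close>
      let ?m = "\<lambda>k. 0 - (- e (g \<rho>) / 2) * blk_vec r p e \<rho> k"
      have mV: "?m \<in> Vsp r" by (auto simp: Vsp_def blk_vec_def blk_def)
      have z: "ipr r x (\<lambda>k. 0) = 0" for x by (simp add: ipr_def)
      have "ipr r x ?m = 0" if "x \<in> ?V - {b}" for x
      proof -
        have "x \<in> B \<or> (\<exists>\<rho>'\<in>?R. \<rho>' \<noteq> \<rho> \<and> x = lr (g \<rho>'))" using that \<rho> by auto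
        thus ?thesis
        proof
          assume "x \<in> B"
          thus ?thesis unfolding ipr_diff_scale_right z using blk_vec_perp[OF rep \<rho>(1)] by (simp add: perp_def)
        next
          assume "\<exists>\<rho>'\<in>?R. \<rho>' \<noteq> \<rho> \<and> x = lr (g \<rho>')"
          then obtain \<rho>' where \<rho>': "\<rho>' \<in> ?R" "\<rho>' \<noteq> \<rho>" "x = lr (g \<rho>')" by auto
          show ?thesis unfolding \<rho>'(3) ipr_lr[OF gi(3)[OF \<rho>'(1)]]
            using transversal_dual[OF sp g \<rho>(1) \<rho>'(1)] \<rho>'(2) by simp
        qed
      qed
      moreover have "ipr r b ?m = 1"
        unfolding \<rho>(2) ipr_lr[OF gi(3)[OF \<rho>(1)]] using transversal_dual[OF sp g \<rho>(1) \<rho>(1)] by simp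
      ultimately show ?thesis using mV by (auto simp: perp_def)
    qed
  qed
  ultimately show ?thesis using V B(1) finite_reps[of r p e] by (auto simp: is_basis_iff)
qed

section \<open>Coroot lattice and dual bases\<close>

lemma ipr_scale_right: "ipr r x (\<lambda>k. c * m k) = c * ipr r x m"
  by (simp add: ipr_def sum_distrib_left mult_ac)

lemma coroot_scaled:
  assumes "b \<in> posroots_C r"
  shows "ipr r b b \<noteq> 0" "coroot r b k \<in> \<int>"
proof -
  have "ipr r b b \<noteq> 0 \<and> coroot r b k \<in> \<int>"
    using assms unfolding posroots_eq
  proof
    assume b: "b \<in> short_roots r"
    then obtain a c s where x: "b = (\<lambda>k. ev a k + s * ev c k)" "a < c" "c < r" "s = 1 \<or> s = - 1"
      by (rule short_roots_cases)
    have "ipr r b b = b a + s * b c" unfolding x(1) by (rule ipr_short) (use x in auto)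
    also have "\<dots> = 2" using x by (auto simp: ev_def)
    finally have "ipr r b b \<noteq> 0" by simp
    moreover have "b k \<in> \<int>" using x by (auto simp: ev_def)
    ultimately show ?thesis unfolding coroot_short[OF b] by simp
  next
    assume "b \<in> lr ` {..<r}"
    then obtain i where i: "i < r" "b = lr i" by auto
    show ?thesis unfolding i(2) coroot_lr[OF i(1)] ipr_lr[OF i(1)] by (auto simp: lr_def ev_def)
  qed
  thus "ipr r b b \<noteq> 0" "coroot r b k \<in> \<int>" by auto
qed

lemma coroot_perp:
  assumes "b \<in> posroots_C r" shows "ipr r (coroot r b) m = 0 \<longleftrightarrow> ipr r b m = 0"
proof -
  have "ipr r (coroot r b) m = 2 / ipr r b b * ipr r b m"
    unfolding ipr_def coroot_def sum_distrib_left by (simp add: mult_ac)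
  thus ?thesis using coroot_scaled(1)[OF assms] by simp
qed

lemma simple_root_cases:
  assumes "i < r"
  shows "coroot r (simple_root_C r i) = (if Suc i < r then (\<lambda>k. ev i k - ev (Suc i) k) else ev i)"
proof (cases "Suc i < r")
  case True
  have "(\<lambda>k. ev i k + (- 1) * ev (Suc i) k) \<in> short_roots r" unfolding short_roots_def using True by blast
  from coroot_short[OF this] show ?thesis using True by (simp add: simple_root_C_def)
next
  case False
  thus ?thesis using coroot_lr[OF assms] by (simp add: simple_root_C_def lr_def)
qed

lemma coroot_simple_root_at:
  "i < r \<Longrightarrow> coroot r (simple_root_C r i) k = (if k = i then 1 else 0) - (if k = Suc i \<and> k < r then 1 else 0)"
  by (simp add: simple_root_cases ev_def)

text \<open>The coroot lattice of type C is Z^r: the simple coroots are differences of neighbouring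
  unit vectors together with the last unit vector.\<close>

lemma Qv_eq: "Qv r = {x \<in> Vsp r. \<forall>k. x k \<in> \<int>}"
proof (intro subset_antisym subsetI)
  fix x assume "x \<in> Qv r"
  then obtain c :: "nat \<Rightarrow> int" where c: "x = (\<lambda>k. \<Sum>i<r. of_int (c i) * coroot r (simple_root_C r i) k)"
    by (auto simp: Qv_def)
  have "x k \<in> \<int>" for k
    unfolding c by (intro Ints_sum Ints_mult Ints_of_int) (auto simp: coroot_simple_root_at)
  moreover have "x \<in> Vsp r"
    unfolding c by (auto simp: Vsp_def coroot_simple_root_at intro!: sum.neutral)
  ultimately show "x \<in> {x \<in> Vsp r. \<forall>k. x k \<in> \<int>}" by auto
next
  fix x assume x: "x \<in> {x \<in> Vsp r. \<forall>k. x k \<in> \<int>}"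
  \<comment> \<open>The coefficients in the simple coroots are the partial sums of the coordinates,
    since the expansion telescopes.\<close>
  define c where "c i = \<lfloor>\<Sum>k\<le>i. x k\<rfloor>" for i
  have c: "real_of_int (c i) = (\<Sum>k\<le>i. x k)" for i
  proof -
    have "(\<Sum>k\<le>i. x k) \<in> \<int>" using x by (intro Ints_sum) auto
    then obtain n where "(\<Sum>k\<le>i. x k) = of_int n" by (rule Ints_cases)
    thus ?thesis by (simp add: c_def)
  qed
  have "x k = (\<Sum>i<r. of_int (c i) * coroot r (simple_root_C r i) k)" for k
  proof (cases "k < r")
    case False
    hence "(\<Sum>i<r. of_int (c i) * coroot r (simple_root_C r i) k) = 0"
      by (intro sum.neutral) (auto simp: coroot_simple_root_at)
    thus ?thesis using x False by (simp add: Vsp_def)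
  next
    case True
    have "(\<Sum>i<r. of_int (c i) * coroot r (simple_root_C r i) k)
       = (\<Sum>i<r. (if i = k then of_int (c i) else 0) - (if k = Suc i then of_int (c i) else 0))"
      using True by (intro sum.cong refl) (auto simp: coroot_simple_root_at)
    also have "\<dots> = of_int (c k) - (\<Sum>i<r. if k = Suc i then of_int (c i) else 0)"
      unfolding sum_subtractf using True by simp
    also have "(\<Sum>i<r. if k = Suc i then of_int (c i) else 0) = (if k = 0 then 0 else real_of_int (c (k - 1)))"
    proof (cases k)
      case (Suc j)
      thus ?thesis using True by simp
    qed simp
    also have "of_int (c k) - (if k = 0 then 0 else real_of_int (c (k - 1))) = x k"
      unfolding c by (cases k) auto
    finally show ?thesis by simp
  qed
  thus "x \<in> Qv r" unfolding Qv_def by (intro CollectI exI[of _ c]) (rule ext)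
qed

lemma lat_diff: "x \<in> lat r V \<Longrightarrow> y \<in> lat r V \<Longrightarrow> (\<lambda>k. x k - y k) \<in> lat r V"
proof -
  assume "x \<in> lat r V" "y \<in> lat r V"
  then obtain c d :: "(nat \<Rightarrow> real) \<Rightarrow> int" where
    "x = (\<lambda>k. \<Sum>\<beta>\<in>V. of_int (c \<beta>) * coroot r \<beta> k)" "y = (\<lambda>k. \<Sum>\<beta>\<in>V. of_int (d \<beta>) * coroot r \<beta> k)"
    by (auto simp: lat_def)
  hence "(\<lambda>k. x k - y k) = (\<lambda>k. \<Sum>\<beta>\<in>V. of_int (c \<beta> - d \<beta>) * coroot r \<beta> k)"
    by (simp add: algebra_simps sum_subtractf)
  thus ?thesis unfolding lat_def by (intro CollectI exI[of _ "\<lambda>\<beta>. c \<beta> - d \<beta>"])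
qed

lemma zero_in_lat: "(\<lambda>_. 0) \<in> lat r V"
  unfolding lat_def by (intro CollectI exI[of _ "\<lambda>_. 0"]) simp

lemma qrel_quotient:
  assumes "C \<in> Qv r // qrel r V" shows "(SOME q. q \<in> C) \<in> Qv r"
proof -
  obtain x where x: "x \<in> Qv r" "C = qrel r V `` {x}" using assms by (auto simp: quotient_def)
  have "x \<in> C" using x by (simp add: qrel_def zero_in_lat)
  hence "(SOME q. q \<in> C) \<in> C" by (rule someI[where P = "\<lambda>q. q \<in> C"])
  thus ?thesis using x(2) by (auto simp: qrel_def)
qed

text \<open>Subtracting integral parts of the coordinates moves every point of the coroot lattice into a
  bounded box, so the sublattice spanned by a basis of coroots has finite index.\<close>
lemma finite_Qv_quotient:
  assumes V: "V \<in> bases_C r"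
  shows "finite (Qv r // qrel r V)" "Qv r // qrel r V \<noteq> {}"
proof -
  have VP: "V \<subseteq> posroots_C r" and fin: "finite V" and span: "Vsp r \<subseteq> lin_hull r V"
    using V by (auto simp: bases_C_def is_basis_def)
  define M where "M = (\<Sum>\<beta>\<in>V. \<Sum>k<r. \<bar>coroot r \<beta> k\<bar>)"
  define Box where "Box = {y. \<forall>k. (k \<in> {..<r} \<longrightarrow> y k \<in> of_int ` {-\<lceil>M\<rceil>..\<lceil>M\<rceil>}) \<and> (k \<notin> {..<r} \<longrightarrow> y k = (0::real))}"
  have finBox: "finite Box" unfolding Box_def by (rule finite_set_of_finite_funs) auto
  have "Qv r // qrel r V \<subseteq> (\<lambda>y. qrel r V `` {y}) ` Box"
  proof
    fix C assume "C \<in> Qv r // qrel r V"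
    then obtain x where x: "x \<in> Qv r" "C = qrel r V `` {x}" by (auto simp: quotient_def)
    have xV: "x \<in> Vsp r" and xI: "\<And>k. x k \<in> \<int>" using x(1) by (auto simp: Qv_eq)
    obtain c where c: "x = (\<lambda>k. \<Sum>\<beta>\<in>V. c \<beta> * \<beta> k)" using span xV by (auto simp: lin_hull_def)
    define d where "d \<beta> = c \<beta> * ipr r \<beta> \<beta> / 2" for \<beta>
    have xd: "x k = (\<Sum>\<beta>\<in>V. d \<beta> * coroot r \<beta> k)" for k
      unfolding c using coroot_scaled(1) VP by (intro sum.cong refl) (auto simp: d_def coroot_def subset_iff)
    define y where "y k = x k - (\<Sum>\<beta>\<in>V. of_int \<lfloor>d \<beta>\<rfloor> * coroot r \<beta> k)" for k
    have yf: "y k = (\<Sum>\<beta>\<in>V. frac (d \<beta>) * coroot r \<beta> k)" for k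
      unfolding y_def xd by (simp add: frac_def algebra_simps sum_subtractf)
    have latxy: "(\<lambda>k. x k - y k) \<in> lat r V"
      unfolding lat_def y_def by (intro CollectI exI[of _ "\<lambda>\<beta>. \<lfloor>d \<beta>\<rfloor>"]) simp
    have cV: "coroot r \<beta> k = 0" if "\<beta> \<in> V" "k \<ge> r" for \<beta> k
    proof -
      have "\<beta> \<in> Vsp r" using that VP V by (auto simp: bases_C_def is_basis_def)
      thus ?thesis using that by (simp add: coroot_def Vsp_def)
    qed
    have yI: "y k \<in> \<int>" for k
      unfolding y_def using xI coroot_scaled(2) VP by (intro Ints_diff Ints_sum Ints_mult Ints_of_int) auto
    have y0: "y k = 0" if "k \<ge> r" for k
      unfolding yf using cV that by (intro sum.neutral) auto
    have yM: "\<bar>y k\<bar> \<le> M" if "k < r" for k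
    proof -
      have "\<bar>y k\<bar> \<le> (\<Sum>\<beta>\<in>V. \<bar>frac (d \<beta>) * coroot r \<beta> k\<bar>)" unfolding yf by (rule sum_abs)
      also have "\<dots> \<le> M" unfolding M_def
      proof (rule sum_mono)
        fix \<beta>
        have "\<bar>frac (d \<beta>) * coroot r \<beta> k\<bar> \<le> 1 * \<bar>coroot r \<beta> k\<bar>"
          unfolding abs_mult by (rule mult_right_mono) (auto simp: frac_ge_0 less_imp_le[OF frac_lt_1])
        also have "\<dots> \<le> (\<Sum>k<r. \<bar>coroot r \<beta> k\<bar>)"
          using member_le_sum[of k "{..<r}" "\<lambda>k. \<bar>coroot r \<beta> k\<bar>"] that by simp
        finally show "\<bar>frac (d \<beta>) * coroot r \<beta> k\<bar> \<le> (\<Sum>k<r. \<bar>coroot r \<beta> k\<bar>)" .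
      qed
      finally show ?thesis .
    qed
    have "y \<in> Box"
      unfolding Box_def
    proof (intro CollectI allI conjI impI)
      fix k assume k: "k \<in> {..<r}"
      obtain z where z: "y k = of_int z" using yI[of k] by (auto elim: Ints_cases)
      have zM: "real_of_int z \<le> M" "- M \<le> real_of_int z" using yM[of k] k z by auto
      have "z \<in> {-\<lceil>M\<rceil>..\<lceil>M\<rceil>}" using zM by simp linarith
      thus "y k \<in> of_int ` {-\<lceil>M\<rceil>..\<lceil>M\<rceil>}" using z by blast
    qed (use y0 in auto)
    moreover have "C = qrel r V `` {y}"
    proof -
      have yQ: "y \<in> Qv r" using yI y0 by (auto simp: Qv_eq Vsp_def)
      have "(\<lambda>k. x k - z k) \<in> lat r V \<longleftrightarrow> (\<lambda>k. y k - z k) \<in> lat r V" for z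
      proof
        assume "(\<lambda>k. x k - z k) \<in> lat r V"
        from lat_diff[OF this latxy] show "(\<lambda>k. y k - z k) \<in> lat r V" by simp
      next
        assume "(\<lambda>k. y k - z k) \<in> lat r V"
        from lat_diff[OF latxy lat_diff[OF zero_in_lat this]] show "(\<lambda>k. x k - z k) \<in> lat r V" by simp
      qed
      thus ?thesis unfolding x(2) qrel_def using x(1) yQ by auto
    qed
    ultimately show "C \<in> (\<lambda>y. qrel r V `` {y}) ` Box" by blast
  qed
  thus "finite (Qv r // qrel r V)" using finBox by (rule finite_surj[rotated])
  have "(\<lambda>_. 0) \<in> Qv r" by (auto simp: Qv_eq Vsp_def)
  thus "Qv r // qrel r V \<noteq> {}" by (auto simp: quotient_def)
qed

text \<open>The dual vectors to long roots have coordinates 0, 1 and -1, up to sign independent of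
  the chosen transversal. Uniqueness holds because nothing nonzero is orthogonal to a basis.\<close>

lemma mu_transversal:
  assumes rep: "represents r p e B" and B: "finite B" "B \<subseteq> short_roots r" "indep r B"
    and g: "g \<in> PiE (reps r p e) (blk r p e)" and \<rho>: "\<rho> \<in> reps r p e"
  shows "mu r (B \<union> lr ` g ` reps r p e) (lr (g \<rho>)) = (\<lambda>k. e (g \<rho>) * blk_vec r p e \<rho> k)"
proof -
  let ?V = "B \<union> lr ` g ` reps r p e" and ?m = "\<lambda>k. e (g \<rho>) * blk_vec r p e \<rho> k"
  note gi = transversal_inj[OF g]
  have sp: "signed_partition r p e" using rep by (auto simp: represents_def)
  have VP: "?V \<subseteq> posroots_C r" using B(2) gi(3) by (auto simp: posroots_eq)
  have pV: "perp r ?V = {\<lambda>_. 0}"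
    using transversal_imp_basis[OF rep B g] by (simp add: is_basis_iff)
  have mV: "?m \<in> Vsp r" by (auto simp: Vsp_def blk_vec_def blk_def)
  have dual: "ipr r (coroot r b) ?m = (if b = lr (g \<rho>) then 1 else 0)" if "b \<in> ?V" for b
    using that
  proof
    assume b: "b \<in> B"
    have "ipr r b (blk_vec r p e \<rho>) = 0" using blk_vec_perp[OF rep \<rho>] b by (auto simp: perp_def)
    hence "ipr r b ?m = 0" by (simp add: ipr_scale_right)
    moreover have "b \<noteq> lr (g \<rho>)" using b B(2) lr_notin_short by auto
    ultimately show ?thesis using coroot_short[of b r] b B(2) by auto
  next
    assume "b \<in> lr ` g ` reps r p e"
    then obtain \<rho>' where \<rho>': "\<rho>' \<in> reps r p e" "b = lr (g \<rho>')" by auto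
    have "b = lr (g \<rho>) \<longleftrightarrow> \<rho>' = \<rho>"
      using \<rho>' \<rho> gi(1) inj_lr by (auto simp: inj_on_def dest: injD)
    thus ?thesis unfolding \<rho>'(2) coroot_lr[OF gi(3)[OF \<rho>'(1)]] ipr_ev_left[OF gi(3)[OF \<rho>'(1)]]
      using transversal_dual[OF sp g \<rho> \<rho>'(1)] by simp
  qed
  show ?thesis unfolding mu_def
  proof (rule the_equality)
    show "?m \<in> Vsp r \<and> (\<forall>\<beta>'\<in>?V. ipr r (coroot r \<beta>') ?m = (if \<beta>' = lr (g \<rho>) then 1 else 0))"
      using mV dual by blast
  next
    fix m assume m: "m \<in> Vsp r \<and> (\<forall>\<beta>'\<in>?V. ipr r (coroot r \<beta>') m = (if \<beta>' = lr (g \<rho>) then 1 else 0))"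
    have "(\<lambda>k. m k - 1 * ?m k) \<in> perp r ?V"
      unfolding perp_def
    proof (intro CollectI conjI ballI Vsp_diff_scale)
      show "m \<in> Vsp r" using m by blast
      fix b assume b: "b \<in> ?V"
      have "ipr r (coroot r b) (\<lambda>k. m k - 1 * ?m k) = 0"
        unfolding ipr_diff_scale_right dual[OF b] using m b by simp
      thus "ipr r b (\<lambda>k. m k - 1 * ?m k) = 0" using coroot_perp[OF subsetD[OF VP b]] by blast
    qed (rule mV)
    hence "(\<lambda>k. m k - 1 * ?m k) = (\<lambda>_. 0)" unfolding pV by simp
    thus "m = ?m" by (simp add: fun_eq_iff)
  qed
qed

section \<open>The generating function\<close>

text \<open>The blocks need not cover all indices: those with zero coordinate on the flat belong to
  none, and their factors have to be 1.\<close>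

lemma prod_UN_disjoint_cover:
  fixes f :: "'a \<Rightarrow> 'b::comm_monoid_mult"
  assumes "finite R" "\<And>x. x \<in> R \<Longrightarrow> finite (A x)" "\<And>x y. x \<in> R \<Longrightarrow> y \<in> R \<Longrightarrow> x \<noteq> y \<Longrightarrow> A x \<inter> A y = {}"
    "finite J" "(\<Union>x\<in>R. A x) \<subseteq> J" "\<And>j. j \<in> J - (\<Union>x\<in>R. A x) \<Longrightarrow> f j = 1"
  shows "prod f J = (\<Prod>x\<in>R. prod f (A x))"
proof -
  have "prod f J = prod f (\<Union>x\<in>R. A x)"
    using assms(4-6) by (intro prod.mono_neutral_right) auto
  also have "\<dots> = (\<Prod>x\<in>R. prod f (A x))"
    by (rule prod.UNION_disjoint) (use assms in auto)
  finally show ?thesis .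
qed

text \<open>Never 0, and -1 at 0, in line with the case distinction of \<open>brk\<close>.\<close>

definition sgn_unit :: "real \<Rightarrow> real" where "sgn_unit x = (if x > 0 then 1 else - 1)"

text \<open>A flat has several signed partitions, since any index of a block may represent it;
  \<open>P\<close> and \<open>E\<close> fix one choice per set \<open>B\<close> so that sums over
  \<open>B\<close> can refer to it.\<close>

locale type_C_data =
  fixes r :: nat and \<phi> :: "nat \<Rightarrow> real" and nus :: "(nat \<Rightarrow> real) list"
    and P :: "(nat \<Rightarrow> real) set \<Rightarrow> nat \<Rightarrow> nat" and E :: "(nat \<Rightarrow> real) set \<Rightarrow> nat \<Rightarrow> real"
  assumes nus: "set nus = short_roots r"
    and phi: "\<And>V \<beta>. V \<in> bases_C r \<Longrightarrow> \<beta> \<in> V \<Longrightarrow> ipr r \<phi> (mu r V \<beta>) \<noteq> 0"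
    and rep: "\<And>B. nbc r nus B \<Longrightarrow> represents r (P B) (E B) B"
begin

abbreviation "R B \<equiv> reps r (P B) (E B)"
abbreviation "bl B \<equiv> blk r (P B) (E B)"
abbreviation "bvec B \<equiv> blk_vec r (P B) (E B)"
abbreviation "NB \<equiv> {B. nbc r nus B}"
abbreviation "base B g \<equiv> B \<union> lr ` g ` R B"

text \<open>The sign of the pairing of \<open>\<phi>\<close> with the vector dual to
  \<open>lr i\<close> in any basis over \<open>B\<close> that selects \<open>i\<close>. That it
  depends on \<open>i\<close> alone, not on the transversal, lets the sum over transversals factor
  into blocks.\<close>

definition \<sigma> :: "(nat \<Rightarrow> real) set \<Rightarrow> nat \<Rightarrow> real" where
  "\<sigma> B i = sgn_unit (ipr r \<phi> (bvec B (P B i))) * E B i"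

text \<open>At lattice points \<^const>\<open>brk\<close> is 0 or 1 according to the sign of the pairing with phi. Moving that sign
  into the variable turns both branches into the same function u / (exp u - 1).\<close>

definition U :: "(nat \<Rightarrow> real) set \<Rightarrow> ((nat \<Rightarrow> real) \<Rightarrow> complex) \<Rightarrow> nat \<Rightarrow> complex" where
  "U B t i = of_real (\<sigma> B i) * t (lr i)"

lemma nbcD:
  assumes "nbc r nus B"
  shows "indep r B" "finite B" "B \<subseteq> short_roots r" "signed_partition r (P B) (E B)"
  using nbc_represents[OF assms nus] rep[OF assms] by (auto simp: represents_def)

lemma base_in_bases_C:
  assumes B: "nbc r nus B" and g: "g \<in> PiE (R B) (bl B)"
  shows "base B g \<in> bases_C r"
  using transversal_imp_basis[OF rep[OF B] nbcD(2,3,1)[OF B] g] nbcD(3)[OF B] transversal_inj(3)[OF g]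
  by (auto simp: bases_C_def posroots_eq)

lemma base_Int:
  assumes "nbc r nus B" shows "base B g \<inter> set nus = B" "base B g - set nus = lr ` g ` R B"
  using nbcD(3)[OF assms] lr_notin_short by (auto simp: nus)

text \<open>A basis splits into its short and its long part. The admissibility condition sees only
  the short part, and the long part is then an arbitrary transversal of the blocks.\<close>

lemma bij_bases_A:
  "bij_betw (\<lambda>(B, g). base B g) (SIGMA B:NB. PiE (R B) (bl B)) (bases_A r nus)"
  unfolding bij_betw_def
proof
  show "inj_on (\<lambda>(B, g). base B g) (SIGMA B:NB. PiE (R B) (bl B))"
  proof (rule inj_onI, clarify)
    fix B g B' g'
    assume B: "nbc r nus B" "nbc r nus B'" and g: "g \<in> PiE (R B) (bl B)" and g': "g' \<in> PiE (R B') (bl B')"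
      and eq: "base B g = base B' g'"
    have BB: "B = B'" using base_Int(1)[OF B(1), of g] base_Int(1)[OF B(2), of g'] eq by simp
    have "base B g - set nus = base B' g' - set nus" unfolding eq ..
    hence "lr ` g ` R B = lr ` g' ` R B" unfolding base_Int(2)[OF B(1)] base_Int(2)[OF B(2)] unfolding BB .
    hence I: "g ` R B = g' ` R B" unfolding inj_image_eq_iff[OF inj_lr] .
    have "g \<rho> = g' \<rho>" if \<rho>: "\<rho> \<in> R B" for \<rho>
    proof -
      obtain \<rho>' where \<rho>': "\<rho>' \<in> R B" "g \<rho> = g' \<rho>'" using I \<rho> by (metis imageE imageI)
      have "\<rho> = \<rho>'" using transversal_inj(2)[OF g \<rho>] transversal_inj(2)[OF g'[folded BB] \<rho>'(1)] \<rho>'(2) by simp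
      thus ?thesis using \<rho>' by simp
    qed
    hence "g = g'" using g g' BB by (intro PiE_ext[of g "R B" "bl B"]) auto
    thus "B = B' \<and> g = g'" using BB by simp
  qed
  have t: "X \<inter> set (take j nus) = (X \<inter> set nus) \<inter> set (take j nus)" for X j
    using set_take_subset[of j nus] by auto
  show "(\<lambda>(B, g). base B g) ` (SIGMA B:NB. PiE (R B) (bl B)) = bases_A r nus"
  proof (intro subset_antisym subsetI)
    fix V assume "V \<in> (\<lambda>(B, g). base B g) ` (SIGMA B:NB. PiE (R B) (bl B))"
    then obtain B g where B: "nbc r nus B" and g: "g \<in> PiE (R B) (bl B)" and V: "V = base B g" by auto
    show "V \<in> bases_A r nus"
      using base_in_bases_C[OF B g] B unfolding bases_A_def V
      by (subst t) (simp add: base_Int(1)[OF B] nbc_def)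
  next
    fix V assume V: "V \<in> bases_A r nus"
    define B where "B = V \<inter> set nus"
    define I where "I = {i. i < r \<and> lr i \<in> V}"
    have VC: "V \<subseteq> posroots_C r" "is_basis r V" using V by (auto simp: bases_A_def bases_C_def)
    have VBI: "V = B \<union> lr ` I" using VC(1) by (auto simp: B_def I_def nus posroots_eq)
    have B: "nbc r nus B" using V t[of V] unfolding bases_A_def nbc_def B_def by auto
    have "I \<subseteq> {..<r}" by (auto simp: I_def)
    from basis_imp_transversal[OF rep[OF B] nbcD(3)[OF B] this] VC(2)[unfolded VBI]
    obtain g where g: "g \<in> PiE (R B) (bl B)" and I: "I = g ` R B" by blast
    show "V \<in> (\<lambda>(B, g). base B g) ` (SIGMA B:NB. PiE (R B) (bl B))"
    proof (rule image_eqI)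
      show "(B, g) \<in> (SIGMA B:NB. PiE (R B) (bl B))" using B g by blast
      show "V = (case (B, g) of (B, g) \<Rightarrow> base B g)" unfolding split using VBI I by (simp only:)
    qed
  qed
qed

text \<open>Within one block the sign coming from \<open>\<phi>\<close> is common, so it squares
  away in products.\<close>

lemma sigma_unit:
  assumes "nbc r nus B" "i < r" "E B i \<noteq> 0"
  shows "\<sigma> B i = 1 \<or> \<sigma> B i = - 1" "P B i = P B j \<Longrightarrow> j < r \<Longrightarrow> E B j \<noteq> 0 \<Longrightarrow> \<sigma> B i * \<sigma> B j = E B i * E B j"
proof -
  have e: "E B k = 1 \<or> E B k = - 1" if "k < r" "E B k \<noteq> 0" for k
    using nbcD(4)[OF assms(1)] that by (auto simp: signed_partition_def)
  show "\<sigma> B i = 1 \<or> \<sigma> B i = - 1" using e[OF assms(2,3)] by (auto simp: \<sigma>_def sgn_unit_def)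
  show "P B i = P B j \<Longrightarrow> j < r \<Longrightarrow> E B j \<noteq> 0 \<Longrightarrow> \<sigma> B i * \<sigma> B j = E B i * E B j"
    by (simp add: \<sigma>_def sgn_unit_def)
qed

lemma exp_flip: "- x / (exp (- x) - 1) = x * exp x / (exp x - 1)" for x :: complex
proof -
  have "exp (- x) - 1 = (1 - exp x) / exp x" by (simp add: exp_minus field_simps)
  hence "- x / (exp (- x) - 1) = - (x * exp x) / (1 - exp x)" by simp
  also have "\<dots> = x * exp x / (exp x - 1)" by (metis minus_diff_eq minus_divide_divide)
  finally show ?thesis .
qed

text \<open>Lattice points and dual vectors both have integer coordinates, so both fractional parts
  vanish. In particular the factor does not depend on the class \<open>q\<close>; when
  \<open>brk\<close> is 1, \<open>exp_flip\<close> absorbs the extra exponential into a sign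
  change.\<close>

lemma brk_factor:
  assumes B: "nbc r nus B" and g: "g \<in> PiE (R B) (bl B)" and \<rho>: "\<rho> \<in> R B" and q: "q \<in> Qv r"
  shows "t (lr (g \<rho>)) * exp (t (lr (g \<rho>)) * of_real (brk r \<phi> (base B g) (lr (g \<rho>)) (\<lambda>k. 0 + q k))) / (exp (t (lr (g \<rho>))) - 1)
    = U B t (g \<rho>) / (exp (U B t (g \<rho>)) - 1)"
proof -
  have gb: "g \<rho> \<in> bl B \<rho>" using g \<rho> by auto
  have gp: "g \<rho> < r" "P B (g \<rho>) = \<rho>" "E B (g \<rho>) \<noteq> 0" using gb by (auto simp: blk_def)
  have e: "E B (g \<rho>) = 1 \<or> E B (g \<rho>) = - 1"
    using nbcD(4)[OF B] gp by (auto simp: signed_partition_def)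
  have mu: "mu r (base B g) (lr (g \<rho>)) = (\<lambda>k. E B (g \<rho>) * bvec B \<rho> k)"
    by (rule mu_transversal[OF rep[OF B] nbcD(2,3,1)[OF B] g \<rho>])
  have ph: "ipr r \<phi> (mu r (base B g) (lr (g \<rho>))) = E B (g \<rho>) * ipr r \<phi> (bvec B \<rho>)"
    unfolding mu by (rule ipr_scale_right)
  have ne: "ipr r \<phi> (mu r (base B g) (lr (g \<rho>))) \<noteq> 0"
    using phi[OF base_in_bases_C[OF B g], of "lr (g \<rho>)"] \<rho> by auto
  have "E B k \<in> \<int>" if "k < r" for k
    using nbcD(4)[OF B] that by (auto simp: signed_partition_def)
  hence int: "ipr r q (mu r (base B g) (lr (g \<rho>))) \<in> \<int>"
    unfolding mu ipr_def using q gp e by (intro Ints_sum Ints_mult) (auto simp: blk_vec_def Qv_eq)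
  hence fr: "frac (ipr r q (mu r (base B g) (lr (g \<rho>)))) = 0" "frac (- ipr r q (mu r (base B g) (lr (g \<rho>)))) = 0"
    by (auto simp: frac_eq_0_iff)
  have sg: "\<sigma> B (g \<rho>) = (if ipr r \<phi> (mu r (base B g) (lr (g \<rho>))) > 0 then 1 else - 1)"
    using e ne unfolding \<sigma>_def gp(2) sgn_unit_def ph by (auto simp: not_less)
  show ?thesis
  proof (cases "ipr r \<phi> (mu r (base B g) (lr (g \<rho>))) > 0")
    case True
    thus ?thesis by (simp add: brk_def fr U_def sg)
  next
    case False
    hence "U B t (g \<rho>) = - t (lr (g \<rho>))" by (simp add: U_def sg)
    thus ?thesis using False exp_flip[of "t (lr (g \<rho>))"] by (simp add: brk_def fr)
  qed
qed

text \<open>The coroot of \<open>lr j\<close> reads off coordinate \<open>j\<close>, and of the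
  block indicators only the one of the block of \<open>j\<close> is nonzero there.\<close>

lemma pairing_sum:
  assumes B: "nbc r nus B" and g: "g \<in> PiE (R B) (bl B)" and j: "j < r"
  shows "(\<Sum>\<beta>\<in>lr ` g ` R B. t \<beta> * of_real (ipr r (coroot r (lr j)) (mu r (base B g) \<beta>)))
    = (if E B j = 0 then 0 else t (lr (g (P B j))) * of_real (E B (g (P B j)) * E B j))"
proof -
  note gi = transversal_inj[OF g]
  have inj: "inj_on (\<lambda>\<rho>. lr (g \<rho>)) (R B)"
    using gi(1) inj_lr by (auto simp: inj_on_def dest: injD)
  have "(\<Sum>\<beta>\<in>lr ` g ` R B. t \<beta> * of_real (ipr r (coroot r (lr j)) (mu r (base B g) \<beta>)))
     = (\<Sum>\<rho>\<in>R B. t (lr (g \<rho>)) * of_real (ipr r (coroot r (lr j)) (mu r (base B g) (lr (g \<rho>)))))"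
    unfolding image_image by (subst sum.reindex[OF inj]) simp
  also have "\<dots> = (\<Sum>\<rho>\<in>R B. t (lr (g \<rho>)) * of_real (E B (g \<rho>) * bvec B \<rho> j))"
  proof (rule sum.cong[OF refl])
    fix \<rho> assume \<rho>: "\<rho> \<in> R B"
    have "ipr r (coroot r (lr j)) (mu r (base B g) (lr (g \<rho>))) = E B (g \<rho>) * bvec B \<rho> j"
      unfolding coroot_lr[OF j] ipr_ev_left[OF j] mu_transversal[OF rep[OF B] nbcD(2,3,1)[OF B] g \<rho>] ..
    thus "t (lr (g \<rho>)) * of_real (ipr r (coroot r (lr j)) (mu r (base B g) (lr (g \<rho>)))) = t (lr (g \<rho>)) * of_real (E B (g \<rho>) * bvec B \<rho> j)"
      by (simp only:)
  qed
  also have "\<dots> = (if E B j = 0 then 0 else t (lr (g (P B j))) * of_real (E B (g (P B j)) * E B j))"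
  proof (cases "E B j = 0")
    case True
    thus ?thesis by (auto intro!: sum.neutral simp: blk_vec_def blk_def)
  next
    case False
    have pj: "P B j \<in> R B" using blk_rep_mem(1)[OF nbcD(4)[OF B] j False] .
    have "(\<Sum>\<rho>\<in>R B. t (lr (g \<rho>)) * of_real (E B (g \<rho>) * bvec B \<rho> j))
       = (\<Sum>\<rho>\<in>R B. if P B j = \<rho> then t (lr (g \<rho>)) * of_real (E B (g \<rho>) * E B j) else 0)"
      using j False by (intro sum.cong refl) (auto simp: blk_vec_def blk_def)
    thus ?thesis using pj False finite_reps by (simp add: sum.delta)
  qed
  finally show ?thesis .
qed

definition genF_term :: "(nat \<Rightarrow> real) set \<Rightarrow> ((nat \<Rightarrow> real) \<Rightarrow> complex) \<Rightarrow> (nat \<Rightarrow> nat) \<Rightarrow> complex" where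
  "genF_term B t g = (\<Prod>\<rho>\<in>R B. (\<Prod>j\<in>bl B \<rho> - {g \<rho>}. U B t j / (U B t j - U B t (g \<rho>))) * (U B t (g \<rho>) / (exp (U B t (g \<rho>)) - 1)))"

lemma posroots_minus_base:
  assumes B: "nbc r nus B" and g: "g \<in> PiE (R B) (bl B)"
  shows "posroots_C r - (base B g \<union> set nus) = lr ` ({..<r} - g ` R B)"
  using nbcD(3)[OF B] lr_notin_short inj_lr by (auto simp: posroots_eq nus dest: injD)

text \<open>All classes of the quotient give the same product, so averaging returns it. The
  remaining long roots give the interpolation weights of the blocks.\<close>

lemma genF_summand:
  assumes B: "nbc r nus B" and g: "g \<in> PiE (R B) (bl B)" and t0: "\<And>i. i < r \<Longrightarrow> t (lr i) \<noteq> 0"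
  shows "(\<Prod>\<gamma>\<in>posroots_C r - (base B g \<union> set nus).
          t \<gamma> / (t \<gamma> - (\<Sum>\<beta>\<in>base B g - set nus. t \<beta> * of_real (ipr r (coroot r \<gamma>) (mu r (base B g) \<beta>))))) *
       (1 / of_nat (card (Qv r // qrel r (base B g)))) *
       (\<Sum>C\<in>Qv r // qrel r (base B g).
          (\<Prod>\<beta>\<in>base B g - set nus.
             t \<beta> * exp (t \<beta> * of_real (brk r \<phi> (base B g) \<beta> (\<lambda>k. 0 + (SOME q. q \<in> C) k)))
               / (exp (t \<beta>) - 1))) = genF_term B t g"
proof -
  note gi = transversal_inj[OF g]
  have inj: "inj_on (\<lambda>\<rho>. lr (g \<rho>)) (R B)"
    using gi(1) inj_lr by (auto simp: inj_on_def dest: injD)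
  have pr: "(\<Prod>\<beta>\<in>lr ` g ` R B. F \<beta>) = (\<Prod>\<rho>\<in>R B. F (lr (g \<rho>)))" for F :: "(nat \<Rightarrow> real) \<Rightarrow> complex"
    unfolding image_image by (subst prod.reindex[OF inj]) simp
  have 1: "(\<Prod>\<beta>\<in>lr ` g ` R B. t \<beta> * exp (t \<beta> * of_real (brk r \<phi> (base B g) \<beta> (\<lambda>k. 0 + (SOME q. q \<in> C) k))) / (exp (t \<beta>) - 1))
     = (\<Prod>\<rho>\<in>R B. U B t (g \<rho>) / (exp (U B t (g \<rho>)) - 1))" if C: "C \<in> Qv r // qrel r (base B g)" for C
    unfolding pr by (rule prod.cong[OF refl brk_factor[OF B g _ qrel_quotient[OF C]]])
  have 2: "(\<Prod>\<gamma>\<in>lr ` ({..<r} - g ` R B). t \<gamma> / (t \<gamma> - (\<Sum>\<beta>\<in>lr ` g ` R B. t \<beta> * of_real (ipr r (coroot r \<gamma>) (mu r (base B g) \<beta>)))))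
     = (\<Prod>j\<in>{..<r} - g ` R B. t (lr j) / (t (lr j) - (if E B j = 0 then 0 else t (lr (g (P B j))) * of_real (E B (g (P B j)) * E B j))))"
    by (subst prod.reindex[OF inj_on_subset[OF inj_lr]]) (simp_all add: o_def pairing_sum[OF B g])
  \<comment> \<open>An index outside all blocks has the factor t/(t - 0) = 1, which is where the
    nonvanishing of the variables enters.\<close>
  also have "\<dots> = (\<Prod>\<rho>\<in>R B. \<Prod>j\<in>bl B \<rho> - {g \<rho>}. t (lr j) / (t (lr j) - (if E B j = 0 then 0 else t (lr (g (P B j))) * of_real (E B (g (P B j)) * E B j))))"
  proof (rule prod_UN_disjoint_cover)
    show "(\<Union>\<rho>\<in>R B. bl B \<rho> - {g \<rho>}) \<subseteq> {..<r} - g ` R B"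
      using gi(2) by (auto simp: blk_def)
    fix j assume j: "j \<in> {..<r} - g ` R B - (\<Union>\<rho>\<in>R B. bl B \<rho> - {g \<rho>})"
    have "E B j = 0"
    proof (rule ccontr)
      assume e: "E B j \<noteq> 0"
      have "P B j \<in> R B" "j \<in> bl B (P B j)" using blk_rep_mem(1,2)[OF nbcD(4)[OF B] _ e] j by auto
      thus False using j by auto
    qed
    thus "t (lr j) / (t (lr j) - (if E B j = 0 then 0 else t (lr (g (P B j))) * of_real (E B (g (P B j)) * E B j))) = 1"
      using t0[of j] j by simp
  qed (auto simp: finite_reps blk_def)
  also have "\<dots> = (\<Prod>\<rho>\<in>R B. \<Prod>j\<in>bl B \<rho> - {g \<rho>}. U B t j / (U B t j - U B t (g \<rho>)))"
  proof (intro prod.cong refl)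
    fix \<rho> j assume \<rho>: "\<rho> \<in> R B" and j: "j \<in> bl B \<rho> - {g \<rho>}"
    have j': "j < r" "E B j \<noteq> 0" "P B j = \<rho>" using j by (auto simp: blk_def)
    have gb: "g \<rho> < r" "E B (g \<rho>) \<noteq> 0" "P B (g \<rho>) = \<rho>" using g \<rho> by (auto simp: blk_def)
    have ss: "\<sigma> B j * \<sigma> B (g \<rho>) = E B (g \<rho>) * E B j"
      using sigma_unit(2)[OF B j'(1,2), of "g \<rho>"] gb j' by (simp add: mult.commute)
    have s: "\<sigma> B j = 1 \<or> \<sigma> B j = - 1" by (rule sigma_unit(1)[OF B j'(1,2)])
    \<comment> \<open>Consequently \<open>\<sigma> B j\<close> factors out of the denominator and
      cancels against the same sign in the numerator.\<close>
    have "\<sigma> B (g \<rho>) = \<sigma> B j * (E B (g \<rho>) * E B j)" using s unfolding ss[symmetric] by auto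
    hence "U B t j - U B t (g \<rho>) = of_real (\<sigma> B j) * (t (lr j) - t (lr (g \<rho>)) * of_real (E B (g \<rho>) * E B j))"
      unfolding U_def by (simp add: algebra_simps)
    moreover have "of_real (\<sigma> B j) \<noteq> (0 :: complex)" using s by auto
    ultimately show "t (lr j) / (t (lr j) - (if E B j = 0 then 0 else t (lr (g (P B j))) * of_real (E B (g (P B j)) * E B j)))
       = U B t j / (U B t j - U B t (g \<rho>))"
      using j' by (simp add: U_def)
  qed
  finally have 3: "(\<Prod>\<gamma>\<in>lr ` ({..<r} - g ` R B). t \<gamma> / (t \<gamma> - (\<Sum>\<beta>\<in>lr ` g ` R B. t \<beta> * of_real (ipr r (coroot r \<gamma>) (mu r (base B g) \<beta>)))))
    = (\<Prod>\<rho>\<in>R B. \<Prod>j\<in>bl B \<rho> - {g \<rho>}. U B t j / (U B t j - U B t (g \<rho>)))" .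
  have card: "of_nat (card (Qv r // qrel r (base B g))) \<noteq> (0 :: complex)"
    using finite_Qv_quotient[OF base_in_bases_C[OF B g]] by simp
  have 4: "(\<Sum>C\<in>Qv r // qrel r (base B g).
          (\<Prod>\<beta>\<in>lr ` g ` R B. t \<beta> * exp (t \<beta> * of_real (brk r \<phi> (base B g) \<beta> (\<lambda>k. 0 + (SOME q. q \<in> C) k))) / (exp (t \<beta>) - 1)))
     = of_nat (card (Qv r // qrel r (base B g))) * (\<Prod>\<rho>\<in>R B. U B t (g \<rho>) / (exp (U B t (g \<rho>)) - 1))"
    by (subst sum.cong[OF refl 1]) (auto simp only: sum_constant)
  show ?thesis
    unfolding posroots_minus_base[OF B g] base_Int(2)[OF B] 3 4 genF_term_def prod.distrib
    using card by simp
qed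

text \<open>For fixed \<open>B\<close> a transversal picks one node per block independently, so the
  sum over transversals of a product is the product of the interpolation sums.\<close>

lemma genF_eq:
  assumes t0: "\<And>i. i < r \<Longrightarrow> t (lr i) \<noteq> 0"
  shows "genF r \<phi> nus t (\<lambda>_. 0)
    = (\<Sum>B\<in>NB. (- 1) ^ card (set nus - B) * (\<Prod>\<rho>\<in>R B. interp (bl B \<rho>) (U B t) (\<lambda>x. x / (exp x - 1))))"
proof -
  have finNB: "finite NB" by (rule finite_subset[of _ "Pow (set nus)"]) (auto simp: nbc_def)
  have finbl: "finite (bl B \<rho>)" for B \<rho> by (simp add: blk_def)
  have "genF r \<phi> nus t (\<lambda>_. 0) = (\<Sum>(B, g)\<in>(SIGMA B:NB. PiE (R B) (bl B)). (- 1) ^ card (set nus - B) * genF_term B t g)"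
    unfolding genF_def
  proof (subst sum.reindex_bij_betw[OF bij_bases_A, symmetric], rule sum.cong[OF refl], clarify)
    fix B g assume B: "nbc r nus B" and g: "g \<in> PiE (R B) (bl B)"
    have "set nus - base B g = set nus - B" using lr_notin_short by (auto simp: nus)
    thus "(-1) ^ card (set nus - base B g) *
       (\<Prod>\<gamma>\<in>posroots_C r - (base B g \<union> set nus).
          t \<gamma> / (t \<gamma> - (\<Sum>\<beta>\<in>base B g - set nus. t \<beta> * of_real (ipr r (coroot r \<gamma>) (mu r (base B g) \<beta>))))) *
       (1 / of_nat (card (Qv r // qrel r (base B g)))) *
       (\<Sum>C\<in>Qv r // qrel r (base B g).
          (\<Prod>\<beta>\<in>base B g - set nus.
             t \<beta> * exp (t \<beta> * of_real (brk r \<phi> (base B g) \<beta> (\<lambda>k. 0 + (SOME q. q \<in> C) k)))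
               / (exp (t \<beta>) - 1))) = (- 1) ^ card (set nus - B) * genF_term B t g"
      using genF_summand[OF B g, of t, OF t0] by (simp only: mult.assoc)
  qed
  also have "\<dots> = (\<Sum>B\<in>NB. \<Sum>g\<in>PiE (R B) (bl B). (- 1) ^ card (set nus - B) * genF_term B t g)"
    by (subst sum.Sigma) (auto simp: finNB finite_reps finbl intro!: finite_PiE)
  also have "\<dots> = (\<Sum>B\<in>NB. (- 1) ^ card (set nus - B) * (\<Prod>\<rho>\<in>R B. interp (bl B \<rho>) (U B t) (\<lambda>x. x / (exp x - 1))))"
    unfolding sum_distrib_left[symmetric] genF_term_def interp_def
    by (subst prod_sum_PiE) (auto simp: finite_reps finbl)
  finally show ?thesis .
qed

end

section \<open>Power series expansion of the generating function\<close>

lemma fun_boxD: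
  assumes "k \<in> fun_box I B z"
  shows "i \<in> I \<Longrightarrow> k i \<in> B i" "i \<notin> I \<Longrightarrow> k i = z i"
  using assms by (auto simp: fun_box_def)

lemma blk_coeff_cong: "(\<And>i. i \<in> b \<Longrightarrow> k i = k' i) \<Longrightarrow> blk_coeff b k = blk_coeff b k'"
  by (simp add: blk_coeff_def cong: sum.cong)

text \<open>One exponent vector per block amounts to a single exponent vector on \<open>J\<close>,
  because the blocks partition \<open>J\<close>; the map \<open>?h\<close> glues them.\<close>

lemma prod_blocks_has_sum:
  fixes u :: "'a \<Rightarrow> complex" and q :: "'a \<Rightarrow> 'c"
  assumes J: "finite J" and u: "\<And>i. i \<in> J \<Longrightarrow> u i \<noteq> 0 \<and> norm (u i) < 1"
    and inj: "\<And>\<rho>. \<rho> \<in> q ` J \<Longrightarrow> inj_on u {i\<in>J. q i = \<rho>}"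
  shows "((\<lambda>k. (\<Prod>\<rho>\<in>q ` J. blk_coeff {i\<in>J. q i = \<rho>} k) * (\<Prod>i\<in>J. u i ^ k i)) has_sum
    (\<Prod>\<rho>\<in>q ` J. interp {i\<in>J. q i = \<rho>} u (\<lambda>x. x / (exp x - 1)))) (fun_box J (\<lambda>_. UNIV) (\<lambda>_. 0))"
proof -
  let ?A = "\<lambda>\<rho>. {i\<in>J. q i = \<rho>}"
  let ?f = "\<lambda>\<rho> \<kappa>. blk_coeff (?A \<rho>) \<kappa> * (\<Prod>i\<in>?A \<rho>. u i ^ \<kappa> i)"
  let ?F = "\<lambda>k. (\<Prod>\<rho>\<in>q ` J. blk_coeff (?A \<rho>) k) * (\<Prod>i\<in>J. u i ^ k i)"
  let ?S = "fun_box (q ` J) (\<lambda>\<rho>. fun_box (?A \<rho>) (\<lambda>_. UNIV) (\<lambda>_. 0)) (\<lambda>_ _. 0) :: ('c \<Rightarrow> 'a \<Rightarrow> nat) set"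
  let ?h = "\<lambda>K i. if i \<in> J then K (q i) i else (0::nat)"
  have "((\<lambda>K. \<Prod>\<rho>\<in>q ` J. ?f \<rho> (K \<rho>)) has_sum (\<Prod>\<rho>\<in>q ` J. interp (?A \<rho>) u (\<lambda>x. x / (exp x - 1)))) ?S"
  proof (rule conjunct1[OF has_sum_prod_fun_box])
    fix \<rho> assume \<rho>: "\<rho> \<in> q ` J"
    have "?A \<rho> \<noteq> {}" using \<rho> by auto
    from interp_bernoulli_has_sum[OF _ this inj[OF \<rho>]] J u
    show "(?f \<rho> has_sum interp (?A \<rho>) u (\<lambda>x. x / (exp x - 1))) (fun_box (?A \<rho>) (\<lambda>_. UNIV) (\<lambda>_. 0))"
      "(\<lambda>\<kappa>. norm (?f \<rho> \<kappa>)) summable_on fun_box (?A \<rho>) (\<lambda>_. UNIV) (\<lambda>_. 0)" by auto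
  qed (use J in simp)
  also have "(\<lambda>K. \<Prod>\<rho>\<in>q ` J. ?f \<rho> (K \<rho>)) = (\<lambda>K. ?F (?h K))"
  proof
    fix K :: "'c \<Rightarrow> 'a \<Rightarrow> nat"
    have "(\<Prod>i\<in>J. u i ^ ?h K i) = (\<Prod>\<rho>\<in>q ` J. \<Prod>i\<in>?A \<rho>. u i ^ ?h K i)"
      by (rule prod_UN_disjoint_cover) (use J in auto)
    also have "\<dots> = (\<Prod>\<rho>\<in>q ` J. \<Prod>i\<in>?A \<rho>. u i ^ K \<rho> i)"
      by (intro prod.cong refl) auto
    finally have 1: "(\<Prod>i\<in>J. u i ^ ?h K i) = (\<Prod>\<rho>\<in>q ` J. \<Prod>i\<in>?A \<rho>. u i ^ K \<rho> i)" .
    have 2: "(\<Prod>\<rho>\<in>q ` J. blk_coeff (?A \<rho>) (?h K)) = (\<Prod>\<rho>\<in>q ` J. blk_coeff (?A \<rho>) (K \<rho>))"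
      by (intro prod.cong refl blk_coeff_cong) auto
    show "(\<Prod>\<rho>\<in>q ` J. ?f \<rho> (K \<rho>)) = ?F (?h K)" unfolding 1 2 prod.distrib ..
  qed
  finally have hs: "((\<lambda>K. ?F (?h K)) has_sum (\<Prod>\<rho>\<in>q ` J. interp (?A \<rho>) u (\<lambda>x. x / (exp x - 1)))) ?S" .
  have bij: "bij_betw ?h ?S (fun_box J (\<lambda>_. UNIV) (\<lambda>_. 0))"
  proof (rule bij_betw_byWitness[where f' = "\<lambda>k \<rho> i. if i \<in> ?A \<rho> then k i else 0"])
    show "\<forall>K\<in>?S. (\<lambda>\<rho> i. if i \<in> ?A \<rho> then ?h K i else 0) = K"
    proof (intro ballI ext)
      fix K \<rho> i assume K: "K \<in> ?S"
      have "K \<rho> i = 0" if "i \<notin> ?A \<rho>"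
      proof (cases "\<rho> \<in> q ` J")
        case True
        hence "K \<rho> \<in> fun_box (?A \<rho>) (\<lambda>_. UNIV) (\<lambda>_. 0)" by (rule fun_boxD(1)[OF K])
        thus ?thesis using that by (simp add: fun_box_def)
      next
        case False
        hence "K \<rho> = (\<lambda>_. 0)" by (rule fun_boxD(2)[OF K])
        thus ?thesis by simp
      qed
      thus "(if i \<in> ?A \<rho> then ?h K i else 0) = K \<rho> i" by auto
    qed
  qed (auto simp: fun_box_def fun_eq_iff)
  show ?thesis using hs unfolding has_sum_reindex_bij_betw[OF bij, where f = ?F] .
qed

lemma genF_genericD:
  assumes "genF_generic r nus t" "V \<in> bases_A r nus"
  shows "\<gamma> \<in> posroots_C r - (V \<union> set nus) \<Longrightarrow>
      t \<gamma> - (\<Sum>\<beta>\<in>V - set nus. t \<beta> * of_real (ipr r (coroot r \<gamma>) (mu r V \<beta>))) \<noteq> 0"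
    and "\<beta> \<in> V - set nus \<Longrightarrow> exp (t \<beta>) \<noteq> 1"
proof -
  note h = bspec[OF assms(1)[unfolded genF_generic_def] assms(2)]
  show "\<gamma> \<in> posroots_C r - (V \<union> set nus) \<Longrightarrow>
      t \<gamma> - (\<Sum>\<beta>\<in>V - set nus. t \<beta> * of_real (ipr r (coroot r \<gamma>) (mu r V \<beta>))) \<noteq> 0"
    by (rule bspec[OF conjunct1[OF h]])
  show "\<beta> \<in> V - set nus \<Longrightarrow> exp (t \<beta>) \<noteq> 1" by (rule bspec[OF conjunct2[OF h]])
qed

lemma has_sum_complex_diff:
  fixes f g :: "'a \<Rightarrow> complex"
  assumes "(f has_sum a) A" "(g has_sum b) A"
  shows "((\<lambda>x. f x - g x) has_sum (a - b)) A"
  using has_sum_add[OF assms(1) has_sum_cmult_right[OF assms(2), of "- 1"]] by simp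

lemma has_sum_finite_sum:
  fixes f :: "'i \<Rightarrow> 'a \<Rightarrow> complex"
  assumes "finite I" "\<And>i. i \<in> I \<Longrightarrow> (f i has_sum s i) A"
  shows "((\<lambda>x. \<Sum>i\<in>I. f i x) has_sum (\<Sum>i\<in>I. s i)) A"
  using assms by (induction I rule: finite_induct) (auto intro!: has_sum_add)

context type_C_data
begin

definition J :: "(nat \<Rightarrow> real) set \<Rightarrow> nat set" where "J B = {i. i < r \<and> E B i \<noteq> 0}"

lemma finite_NB: "finite NB"
  by (rule finite_subset[of _ "Pow (set nus)"]) (auto simp: nbc_def)

lemma bl_eq: "bl B \<rho> = {i\<in>J B. P B i = \<rho>}"
  by (auto simp: blk_def J_def)

lemma R_eq: "nbc r nus B \<Longrightarrow> R B = P B ` J B"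
proof (intro subset_antisym subsetI)
  assume B: "nbc r nus B"
  show "\<rho> \<in> P B ` J B" if "\<rho> \<in> R B" for \<rho> using that by (force simp: reps_def J_def)
  show "\<rho> \<in> R B" if "\<rho> \<in> P B ` J B" for \<rho>
    using that blk_rep_mem(1)[OF nbcD(4)[OF B]] by (auto simp: J_def)
qed

text \<open>Variables outside the blocks do not occur in the product, so monomials containing them
  get coefficient 0.\<close>

definition blocks_coeff :: "(nat \<Rightarrow> real) set \<Rightarrow> (nat \<Rightarrow> nat) \<Rightarrow> complex" where
  "blocks_coeff B k = (if \<forall>i<r. E B i = 0 \<longrightarrow> k i = 0
     then (\<Prod>\<rho>\<in>R B. blk_coeff (bl B \<rho>) k) * (\<Prod>i\<in>J B. of_real (\<sigma> B i) ^ k i) else 0)"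

definition genF_coeff :: "(nat \<Rightarrow> nat) \<Rightarrow> complex" where
  "genF_coeff k = (\<Sum>B\<in>NB. (- 1) ^ card (set nus - B) * blocks_coeff B k)"

lemma blocks_has_sum:
  assumes B: "nbc r nus B" and t: "\<And>i. i < r \<Longrightarrow> t (lr i) \<noteq> 0 \<and> norm (t (lr i)) < 1"
    and inj: "\<And>\<rho>. \<rho> \<in> R B \<Longrightarrow> inj_on (U B t) (bl B \<rho>)"
  shows "((\<lambda>k. blocks_coeff B k * (\<Prod>i<r. t (lr i) ^ k i)) has_sum
    (\<Prod>\<rho>\<in>R B. interp (bl B \<rho>) (U B t) (\<lambda>x. x / (exp x - 1)))) (fun_box {..<r} (\<lambda>_. UNIV) (\<lambda>_. 0))"
proof -
  have JJ: "finite (J B)" "J B \<subseteq> {..<r}" by (auto simp: J_def)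
  have "((\<lambda>k. (\<Prod>\<rho>\<in>R B. blk_coeff (bl B \<rho>) k) * (\<Prod>i\<in>J B. U B t i ^ k i)) has_sum
    (\<Prod>\<rho>\<in>R B. interp (bl B \<rho>) (U B t) (\<lambda>x. x / (exp x - 1)))) (fun_box (J B) (\<lambda>_. UNIV) (\<lambda>_. 0))"
    unfolding R_eq[OF B] bl_eq
  proof (rule prod_blocks_has_sum)
    show "U B t i \<noteq> 0 \<and> norm (U B t i) < 1" if "i \<in> J B" for i
      using that t sigma_unit(1)[OF B, of i] by (auto simp: U_def J_def norm_mult)
  qed (use inj JJ in \<open>auto simp: R_eq[OF B] bl_eq\<close>)
  also have "?this \<longleftrightarrow> ?thesis"
  proof (rule has_sum_cong_neutral)
    fix k :: "nat \<Rightarrow> nat" assume k: "k \<in> fun_box {..<r} (\<lambda>_. UNIV) (\<lambda>_. 0) - fun_box (J B) (\<lambda>_. UNIV) (\<lambda>_. 0)"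
    then obtain i where "i \<notin> J B" "k i \<noteq> 0" by (auto simp: fun_box_def)
    hence "\<not> (\<forall>i<r. E B i = 0 \<longrightarrow> k i = 0)" using k by (auto simp: fun_box_def J_def)
    hence "blocks_coeff B k = 0" unfolding blocks_coeff_def by (simp only: if_False)
    thus "blocks_coeff B k * (\<Prod>i<r. t (lr i) ^ k i) = 0" by simp
  next
    fix k :: "nat \<Rightarrow> nat" assume k: "k \<in> fun_box (J B) (\<lambda>_. UNIV) (\<lambda>_. 0) \<inter> fun_box {..<r} (\<lambda>_. UNIV) (\<lambda>_. 0)"
    have "(\<Prod>i<r. t (lr i) ^ k i) = (\<Prod>i\<in>J B. t (lr i) ^ k i)"
      using k JJ by (intro prod.mono_neutral_right) (auto simp: fun_box_def)
    moreover have "\<forall>i<r. E B i = 0 \<longrightarrow> k i = 0" using k by (auto simp: fun_box_def J_def)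
    ultimately show "(\<Prod>\<rho>\<in>R B. blk_coeff (bl B \<rho>) k) * (\<Prod>i\<in>J B. U B t i ^ k i)
      = blocks_coeff B k * (\<Prod>i<r. t (lr i) ^ k i)"
      by (simp add: blocks_coeff_def U_def power_mult_distrib prod.distrib)
  qed (use JJ in \<open>auto simp: fun_box_def\<close>)
  finally show ?thesis .
qed

lemma nbc_empty: "nbc r nus {}"
proof -
  have "x \<notin> lin_hull r {}" if x: "x \<in> short_roots r" for x
  proof -
    obtain a c s where x: "x = (\<lambda>k. ev a k + s * ev c k)" "a < c" using x by (rule short_roots_cases)
    hence "x a = 1" by (simp add: ev_def)
    thus ?thesis by (auto simp: lin_hull_def)
  qed
  thus ?thesis using nus nth_mem by (force simp: nbc_def)
qed

text \<open>The long roots alone form an admissible basis, the one over \<open>B = {}\<close>, so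
  genericity forbids \<open>exp (t (lr i)) = 1\<close> for each of them.\<close>

lemma generic_nonzero:
  assumes gen: "genF_generic r nus t" and i: "i < r"
  shows "t (lr i) \<noteq> 0"
proof -
  have "card (R {}) = r" using rep[OF nbc_empty] by (simp add: represents_def)
  hence R: "R {} = {..<r}" by (intro card_subset_eq) (auto simp: reps_def)
  have g: "restrict id (R {}) \<in> PiE (R {}) (bl {})" using blk_rep(1) by auto
  have "base {} (restrict id (R {})) \<in> bases_A r nus"
    using bij_betw_apply[OF bij_bases_A, of "({}, restrict id (R {}))"] nbc_empty g by simp
  note gd = genF_genericD(2)[OF gen this]
  have "lr i \<in> base {} (restrict id (R {})) - set nus"
    using i lr_notin_short by (auto simp: R nus)
  hence "exp (t (lr i)) \<noteq> 1" by (rule gd)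
  thus ?thesis by auto
qed

text \<open>If two nodes of a block coincided, the denominator attached to \<open>lr j\<close> in a
  basis selecting \<open>i\<close> would vanish.\<close>

lemma generic_inj:
  assumes gen: "genF_generic r nus t" and B: "nbc r nus B" and \<rho>: "\<rho> \<in> R B"
  shows "inj_on (U B t) (bl B \<rho>)"
proof (rule inj_onI, rule ccontr)
  fix i j assume i: "i \<in> bl B \<rho>" and j: "j \<in> bl B \<rho>" and eq: "U B t i = U B t j" and ne: "i \<noteq> j"
  \<comment> \<open>The transversal that picks \<open>i\<close> in its own block and the
    representative in every other one.\<close>
  define g where "g = (restrict id (R B))(\<rho> := i)"
  have g: "g \<in> PiE (R B) (bl B)" using blk_rep(1) i \<rho> by (auto simp: g_def)
  have i': "i < r" "E B i \<noteq> 0" "P B i = \<rho>" and j': "j < r" "E B j \<noteq> 0" "P B j = \<rho>" using i j by (auto simp: blk_def)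
  have jg: "j \<notin> g ` R B"
  proof
    assume "j \<in> g ` R B"
    then obtain \<rho>' where "\<rho>' \<in> R B" "j = g \<rho>'" by auto
    hence "\<rho>' = \<rho>" using transversal_inj(2)[OF g] j' by metis
    thus False using \<open>j = g \<rho>'\<close> ne by (simp add: g_def)
  qed
  have V: "base B g \<in> bases_A r nus"
    using bij_betw_apply[OF bij_bases_A, of "(B, g)"] B g by simp
  have "lr j \<in> posroots_C r - (base B g \<union> set nus)"
    unfolding posroots_minus_base[OF B g] using jg j' by blast
  hence "t (lr j) - (\<Sum>\<beta>\<in>base B g - set nus. t \<beta> * of_real (ipr r (coroot r (lr j)) (mu r (base B g) \<beta>))) \<noteq> 0"
    by (rule genF_genericD(1)[OF gen V])
  hence "t (lr j) - t (lr i) * of_real (E B i * E B j) \<noteq> 0"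
    unfolding base_Int(2)[OF B] pairing_sum[OF B g j'(1)] using j' by (simp add: g_def)
  moreover have "E B i * E B j = \<sigma> B i * \<sigma> B j" using sigma_unit(2)[OF B i'(1,2), of j] i' j' by simp
  moreover have "t (lr j) = t (lr i) * of_real (\<sigma> B i * \<sigma> B j)"
  proof -
    have "\<sigma> B j * \<sigma> B j = 1" using sigma_unit(1)[OF B j'(1,2)] by auto
    hence "t (lr j) = of_real (\<sigma> B j) * U B t j" unfolding U_def mult.assoc[symmetric] of_real_mult[symmetric] by simp
    also have "\<dots> = of_real (\<sigma> B j) * U B t i" unfolding eq ..
    also have "\<dots> = t (lr i) * of_real (\<sigma> B i * \<sigma> B j)" by (simp add: U_def)
    finally show ?thesis .
  qed
  ultimately show False by simp
qed

lemma genF_has_sum: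
  assumes gen: "genF_generic r nus t" and t: "\<And>i. i < r \<Longrightarrow> norm (t (lr i)) < 1"
  shows "((\<lambda>k. genF_coeff k * (\<Prod>i<r. t (lr i) ^ k i)) has_sum genF r \<phi> nus t (\<lambda>_. 0)) (fun_box {..<r} (\<lambda>_. UNIV) (\<lambda>_. 0))"
proof -
  have "((\<lambda>k. \<Sum>B\<in>NB. (- 1) ^ card (set nus - B) * (blocks_coeff B k * (\<Prod>i<r. t (lr i) ^ k i))) has_sum
    (\<Sum>B\<in>NB. (- 1) ^ card (set nus - B) * (\<Prod>\<rho>\<in>R B. interp (bl B \<rho>) (U B t) (\<lambda>x. x / (exp x - 1)))))
      (fun_box {..<r} (\<lambda>_. UNIV) (\<lambda>_. 0))"
    by (intro has_sum_finite_sum finite_NB has_sum_cmult_right blocks_has_sum)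
       (use generic_nonzero[OF gen] generic_inj[OF gen] t in auto)
  moreover have "genF r \<phi> nus t (\<lambda>_. 0)
    = (\<Sum>B\<in>NB. (- 1) ^ card (set nus - B) * (\<Prod>\<rho>\<in>R B. interp (bl B \<rho>) (U B t) (\<lambda>x. x / (exp x - 1))))"
    by (rule genF_eq) (rule generic_nonzero[OF gen])
  ultimately show ?thesis unfolding genF_coeff_def sum_distrib_right by (simp only: mult.assoc)
qed

text \<open>Every denominator has the form t_j, t_j - t_i or t_j + t_i with \<open>i\<close>
  different from \<open>j\<close>. This supplies enough generic points for uniqueness of the
  coefficients.\<close>

lemma generic_positive:
  assumes t: "\<And>i. i < r \<Longrightarrow> 0 < t (lr i)" and inj: "inj_on t (lr ` {..<r})"
  shows "genF_generic r nus (\<lambda>\<alpha>. complex_of_real (t \<alpha>))"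
  unfolding genF_generic_def
proof (intro ballI conjI)
  fix V assume "V \<in> bases_A r nus"
  hence "V \<in> (\<lambda>(B, g). base B g) ` (SIGMA B:NB. PiE (R B) (bl B))"
    unfolding bij_betw_imp_surj_on[OF bij_bases_A] .
  then obtain B g where B: "nbc r nus B" and g: "g \<in> PiE (R B) (bl B)" and V: "V = base B g" by auto
  show "exp (complex_of_real (t \<beta>)) \<noteq> 1" if b: "\<beta> \<in> V - set nus" for \<beta>
  proof -
    obtain \<rho> where \<rho>: "\<rho> \<in> R B" "\<beta> = lr (g \<rho>)" using b unfolding V base_Int(2)[OF B] by auto
    have "0 < t \<beta>" using t transversal_inj(3)[OF g \<rho>(1)] \<rho>(2) by simp
    hence "exp (t \<beta>) \<noteq> 1" by simp
    thus ?thesis by (metis exp_of_real of_real_eq_1_iff)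
  qed
  show "complex_of_real (t \<gamma>) - (\<Sum>\<beta>\<in>V - set nus. complex_of_real (t \<beta>) * of_real (ipr r (coroot r \<gamma>) (mu r V \<beta>))) \<noteq> 0"
    if \<gamma>: "\<gamma> \<in> posroots_C r - (V \<union> set nus)" for \<gamma>
  proof -
    obtain j where j: "j < r" "j \<notin> g ` R B" "\<gamma> = lr j"
      using \<gamma> unfolding V posroots_minus_base[OF B g] by auto
    show ?thesis
      unfolding V base_Int(2)[OF B] j(3) pairing_sum[OF B g j(1)]
    proof (cases "E B j = 0")
      case True
      thus "complex_of_real (t (lr j)) - (if E B j = 0 then 0 else complex_of_real (t (lr (g (P B j)))) * complex_of_real (E B (g (P B j)) * E B j)) \<noteq> 0"
        using t[OF j(1)] by simp
    next
      case False
      have sp: "signed_partition r (P B) (E B)" by (rule nbcD(4)[OF B])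
      have pj: "P B j \<in> R B" by (rule blk_rep_mem(1)[OF sp j(1) False])
      define i where "i = g (P B j)"
      have "i \<in> g ` R B" "i \<in> bl B (P B j)" unfolding i_def by (rule imageI[OF pj]) (rule PiE_mem[OF g pj])
      hence i: "i < r" "E B i \<noteq> 0" "i \<noteq> j" using j by (auto simp: blk_def)
      have ee: "E B i * E B j = 1 \<or> E B i * E B j = - 1"
      proof -
        have "E B i = 1 \<or> E B i = - 1" "E B j = 1 \<or> E B j = - 1"
          using sp i(1,2) j(1) False unfolding signed_partition_def by blast+
        thus ?thesis by auto
      qed
      have "t (lr i) \<noteq> t (lr j)" using inj i j inj_lr by (auto simp: inj_on_def dest: injD)
      hence "t (lr j) - t (lr i) * (E B i * E B j) \<noteq> 0" using ee t[OF i(1)] t[OF j(1)] by auto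
      hence "complex_of_real (t (lr j) - t (lr i) * (E B i * E B j)) \<noteq> 0" by (simp only: of_real_eq_0_iff not_False_eq_True)
      thus "complex_of_real (t (lr j)) - (if E B j = 0 then 0 else complex_of_real (t (lr (g (P B j)))) * complex_of_real (E B (g (P B j)) * E B j)) \<noteq> 0"
        using False by (simp add: i_def)
    qed
  qed
qed

text \<open>Evaluates the definite description: the expansion of \<open>genF\<close> shows that the
  candidate qualifies, and comparing two candidates at positive, pairwise distinct arguments shows
  uniqueness.\<close>

lemma coefP_eq:
  assumes k: "\<And>\<alpha>. \<alpha> \<notin> lr ` {..<r} \<Longrightarrow> k \<alpha> = 0"
  shows "coefP r \<phi> nus (\<lambda>_. 0) k = genF_coeff (\<lambda>i. if i < r then k (lr i) else 0) * (\<Prod>i<r. of_nat (fact (k (lr i))))"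
proof -
  define D where "D = lr ` {..<r}"
  have D: "posroots_C r - set nus = D" using lr_notin_short by (auto simp: posroots_eq nus D_def)
  have finD: "finite D" by (simp add: D_def)
  let ?S = "{k. \<forall>\<alpha>. \<alpha> \<notin> D \<longrightarrow> k \<alpha> = (0::nat)}"
  have S: "?S = fun_box D (\<lambda>_. UNIV) (\<lambda>_. 0)" by (auto simp: fun_box_def)
  let ?pull = "\<lambda>k i. if i < r then k (lr i) else (0::nat)"
  have lrD: "lr i \<in> D \<longleftrightarrow> i < r" for i using inj_lr by (auto simp: D_def dest: injD)
  have bij: "bij_betw ?pull ?S (fun_box {..<r} (\<lambda>_. UNIV) (\<lambda>_. 0))"
  proof (rule bij_betw_byWitness[where f' = "\<lambda>k \<alpha>. if \<alpha> \<in> D then k (inv lr \<alpha>) else 0"])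
    show "\<forall>k\<in>?S. (\<lambda>\<alpha>. if \<alpha> \<in> D then ?pull k (inv lr \<alpha>) else 0) = k"
      using inj_lr by (auto simp: D_def fun_eq_iff)
    show "\<forall>k\<in>fun_box {..<r} (\<lambda>_. UNIV) (\<lambda>_. 0). ?pull (\<lambda>\<alpha>. if \<alpha> \<in> D then k (inv lr \<alpha>) else 0) = k"
      using inj_lr by (auto simp: lrD fun_eq_iff fun_box_def)
  qed (auto simp: fun_box_def)
  define c0 where "c0 k = (if \<forall>\<alpha>. \<alpha> \<notin> D \<longrightarrow> k \<alpha> = 0 then genF_coeff (?pull k) * (\<Prod>i<r. of_nat (fact (k (lr i)))) else 0)" for k
  have prodD: "(\<Prod>\<alpha>\<in>D. F \<alpha>) = (\<Prod>i<r. F (lr i))" for F :: "(nat \<Rightarrow> real) \<Rightarrow> complex"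
    unfolding D_def by (subst prod.reindex[OF inj_on_subset[OF inj_lr]]) simp_all
  have c0: "((\<lambda>k. c0 k * (\<Prod>\<alpha>\<in>D. t \<alpha> ^ k \<alpha> / of_nat (fact (k \<alpha>)))) has_sum genF r \<phi> nus t (\<lambda>_. 0)) ?S"
    if gen: "genF_generic r nus t" and t: "\<forall>\<alpha>\<in>D. norm (t \<alpha>) < 1" for t
  proof -
    have "((\<lambda>k. genF_coeff (?pull k) * (\<Prod>i<r. t (lr i) ^ ?pull k i)) has_sum genF r \<phi> nus t (\<lambda>_. 0)) ?S"
      using genF_has_sum[OF gen] t by (subst has_sum_reindex_bij_betw[OF bij]) (auto simp: D_def)
    also have "?this \<longleftrightarrow> ?thesis"
    proof (rule has_sum_cong)
      fix k assume k: "k \<in> ?S"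
      have "(\<Prod>\<alpha>\<in>D. t \<alpha> ^ k \<alpha> / of_nat (fact (k \<alpha>))) = (\<Prod>i<r. t (lr i) ^ k (lr i)) / (\<Prod>i<r. of_nat (fact (k (lr i))))"
        unfolding prodD prod_dividef ..
      moreover have "(\<Prod>i<r. of_nat (fact (k (lr i)))) \<noteq> (0 :: complex)" by simp
      moreover have "(\<Prod>i<r. t (lr i) ^ ?pull k i) = (\<Prod>i<r. t (lr i) ^ k (lr i))" by (intro prod.cong) auto
      moreover have "c0 k = genF_coeff (?pull k) * (\<Prod>i<r. of_nat (fact (k (lr i))))" using k by (simp add: c0_def)
      ultimately show "genF_coeff (?pull k) * (\<Prod>i<r. t (lr i) ^ ?pull k i) = c0 k * (\<Prod>\<alpha>\<in>D. t \<alpha> ^ k \<alpha> / of_nat (fact (k \<alpha>)))"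
        by simp
    qed
    finally show ?thesis .
  qed
  have "coefP r \<phi> nus (\<lambda>_. 0) = c0"
    unfolding coefP_def D
  proof (rule the_equality)
    show "(\<forall>k. (\<exists>\<alpha>. \<alpha> \<notin> D \<and> k \<alpha> \<noteq> 0) \<longrightarrow> c0 k = 0) \<and>
       (\<exists>\<epsilon>>0. \<forall>t. genF_generic r nus t \<and> (\<forall>\<alpha>\<in>D. norm (t \<alpha>) < \<epsilon>) \<longrightarrow>
          ((\<lambda>k. c0 k * (\<Prod>\<alpha>\<in>D. t \<alpha> ^ k \<alpha> / of_nat (fact (k \<alpha>)))) has_sum genF r \<phi> nus t (\<lambda>_. 0)) ?S)"
      using c0 by (intro conjI exI[of _ 1]) (auto simp: c0_def)
  next
    fix c :: "((nat \<Rightarrow> real) \<Rightarrow> nat) \<Rightarrow> complex"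
    assume c: "(\<forall>k. (\<exists>\<alpha>. \<alpha> \<notin> D \<and> k \<alpha> \<noteq> 0) \<longrightarrow> c k = 0) \<and>
       (\<exists>\<epsilon>>0. \<forall>t. genF_generic r nus t \<and> (\<forall>\<alpha>\<in>D. norm (t \<alpha>) < \<epsilon>) \<longrightarrow>
          ((\<lambda>k. c k * (\<Prod>\<alpha>\<in>D. t \<alpha> ^ k \<alpha> / of_nat (fact (k \<alpha>)))) has_sum genF r \<phi> nus t (\<lambda>_. 0)) ?S)"
    then obtain \<epsilon> :: real where \<epsilon>: "\<epsilon> > 0" and ce: "\<And>t. genF_generic r nus t \<Longrightarrow> (\<forall>\<alpha>\<in>D. norm (t \<alpha>) < \<epsilon>) \<Longrightarrow>
          ((\<lambda>k. c k * (\<Prod>\<alpha>\<in>D. t \<alpha> ^ k \<alpha> / of_nat (fact (k \<alpha>)))) has_sum genF r \<phi> nus t (\<lambda>_. 0)) ?S" by blast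
    define a where "a k = (c k - c0 k) / (\<Prod>\<alpha>\<in>D. of_nat (fact (k \<alpha>)))" for k :: "(nat \<Rightarrow> real) \<Rightarrow> nat"
    have a0: "a k = 0" if "k \<in> ?S" for k
    \<comment> \<open>The competitor is only known below \<open>\<epsilon>\<close>, the candidate
      \<open>c0\<close> below 1; both expansions are available below the minimum.\<close>
    proof (rule multi_powser_eq_0_imp_coeff_0[OF finD, of "min \<epsilon> 1"])
      show "min \<epsilon> 1 > 0" using \<epsilon> by simp
      show "k \<in> fun_box D (\<lambda>_. UNIV) (\<lambda>_. 0)" using that S by simp
      fix t :: "(nat \<Rightarrow> real) \<Rightarrow> real"
      assume t: "\<And>\<alpha>. \<alpha> \<in> D \<Longrightarrow> 0 < t \<alpha> \<and> t \<alpha> < min \<epsilon> 1" and inj: "inj_on t D"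
      have gen: "genF_generic r nus (\<lambda>\<alpha>. complex_of_real (t \<alpha>))"
        by (rule generic_positive) (use t inj lrD in \<open>auto simp: D_def\<close>)
      have "((\<lambda>k. c k * (\<Prod>\<alpha>\<in>D. of_real (t \<alpha>) ^ k \<alpha> / of_nat (fact (k \<alpha>))) - c0 k * (\<Prod>\<alpha>\<in>D. of_real (t \<alpha>) ^ k \<alpha> / of_nat (fact (k \<alpha>))))
         has_sum (genF r \<phi> nus (\<lambda>\<alpha>. complex_of_real (t \<alpha>)) (\<lambda>_. 0) - genF r \<phi> nus (\<lambda>\<alpha>. complex_of_real (t \<alpha>)) (\<lambda>_. 0))) ?S"
        by (rule has_sum_complex_diff[OF ce[OF gen] c0[OF gen]]) (use t in force)+
      thus "((\<lambda>k. a k * (\<Prod>\<alpha>\<in>D. complex_of_real (t \<alpha>) ^ k \<alpha>)) has_sum 0) (fun_box D (\<lambda>_. UNIV) (\<lambda>_. 0))"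
        unfolding S[symmetric] a_def prod_dividef by (simp add: diff_divide_distrib left_diff_distrib)
    qed
    show "c = c0"
    proof
      fix k
      show "c k = c0 k"
      proof (cases "k \<in> ?S")
        case True
        have "(\<Prod>\<alpha>\<in>D. of_nat (fact (k \<alpha>))) \<noteq> (0 :: complex)" using finD by simp
        thus ?thesis using a0[OF True] by (simp add: a_def)
      next
        case False
        hence "\<exists>\<alpha>. \<alpha> \<notin> D \<and> k \<alpha> \<noteq> 0" by auto
        thus ?thesis using c by (auto simp: c0_def)
      qed
    qed
  qed
  thus ?thesis using k by (simp add: c0_def D_def)
qed

end

section \<open>Summation over regular lattice points\<close>

lemma has_sum_nonzero_int:
  fixes f :: "int \<Rightarrow> 'a :: {topological_comm_monoid_add, t2_space}"
  assumes even: "\<And>n. f (- n) = f n" and hs: "((\<lambda>k. f (int (Suc k))) has_sum s) UNIV"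
  shows "(f has_sum (s + s)) (UNIV - {0})"
proof -
  have b1: "bij_betw (\<lambda>k. int (Suc k)) UNIV {0<..}"
    by (rule bij_betw_byWitness[where f' = "\<lambda>n. nat n - 1"]) auto
  have b2: "bij_betw (\<lambda>k. - int (Suc k)) UNIV {..<0}"
    by (rule bij_betw_byWitness[where f' = "\<lambda>n. nat (- n) - 1"]) auto
  have 1: "(f has_sum s) {0<..}" using hs unfolding has_sum_reindex_bij_betw[OF b1, where f = f] .
  have "((\<lambda>k. f (- int (Suc k))) has_sum s) UNIV" unfolding even by (rule hs)
  hence 2: "(f has_sum s) {..<0}" unfolding has_sum_reindex_bij_betw[OF b2, where f = f] .
  have "(f has_sum (s + s)) ({0<..} \<union> {..<0})" by (rule has_sum_Un_disjoint[OF 1 2]) auto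
  moreover have "{0<..} \<union> {..<0} = UNIV - {0::int}" by auto
  ultimately show ?thesis by simp
qed

lemma zetaz_int_has_sum:
  assumes "even m" "2 \<le> m"
  shows "((\<lambda>n::int. 1 / of_int n ^ m :: complex) has_sum (2 * zetaz m)) (UNIV - {0})"
    and "(\<lambda>n::int. norm (1 / of_int n ^ m :: complex)) summable_on (UNIV - {0})"
proof -
  note sm = zetaz_abs_summable[OF assms(2)]
  have "((\<lambda>k. 1 / of_nat (Suc k) ^ m :: complex) has_sum zetaz m) UNIV"
    unfolding zetaz_def by (rule norm_summable_imp_has_sum[OF sm summable_sums[OF summable_norm_cancel[OF sm]]])
  hence h: "((\<lambda>k. 1 / of_int (int (Suc k)) ^ m :: complex) has_sum zetaz m) UNIV" by (simp only: of_int_of_nat_eq)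
  have ev: "1 / of_int (- n) ^ m = (1 / of_int n ^ m :: complex)" for n :: int
    using assms(1) by simp
  show "((\<lambda>n::int. 1 / of_int n ^ m :: complex) has_sum (2 * zetaz m)) (UNIV - {0})"
    unfolding mult_2 by (rule has_sum_nonzero_int[OF ev h])
  have "((\<lambda>k. norm (1 / of_nat (Suc k) ^ m :: complex)) has_sum (\<Sum>k. norm (1 / of_nat (Suc k) ^ m :: complex))) UNIV"
    by (rule norm_summable_imp_has_sum[OF _ summable_sums[OF sm]]) (use sm in \<open>simp only: real_norm_def abs_norm_cancel\<close>)
  hence h2: "((\<lambda>k. norm (1 / of_int (int (Suc k)) ^ m :: complex)) has_sum (\<Sum>k. norm (1 / of_nat (Suc k) ^ m :: complex))) UNIV"
    by (simp only: of_int_of_nat_eq)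
  have ev2: "norm (1 / of_int (- n) ^ m :: complex) = norm (1 / of_int n ^ m :: complex)" for n :: int
    unfolding ev ..
  show "(\<lambda>n::int. norm (1 / of_int n ^ m :: complex)) summable_on (UNIV - {0})"
    by (rule has_sum_imp_summable[OF has_sum_nonzero_int[OF ev2 h2]])
qed

section \<open>Lattice points off the coordinate hyperplanes\<close>

definition ivec :: "(nat \<Rightarrow> int) \<Rightarrow> nat \<Rightarrow> real" where "ivec l = (\<lambda>i. of_int (l i))"

definition nz_lattice :: "nat \<Rightarrow> (nat \<Rightarrow> int) set" where
  "nz_lattice r = fun_box {..<r} (\<lambda>_. UNIV - {0}) (\<lambda>_. 0)"

definition lwt :: "nat \<Rightarrow> (nat \<Rightarrow> nat) \<Rightarrow> (nat \<Rightarrow> int) \<Rightarrow> complex" where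
  "lwt r k l = (\<Prod>i<r. 1 / of_int (l i) ^ k i)"

definition regular :: "nat \<Rightarrow> (nat \<Rightarrow> int) \<Rightarrow> bool" where
  "regular r l \<longleftrightarrow> inj_on (\<lambda>i. \<bar>l i\<bar>) {..<r}"

lemma ivec_Vsp: "l \<in> nz_lattice r \<Longrightarrow> ivec l \<in> Vsp r"
  by (auto simp: nz_lattice_def fun_box_def ivec_def Vsp_def)

lemma regular_iff: "regular r l \<longleftrightarrow> (\<forall>x\<in>short_roots r. ipr r x (ivec l) \<noteq> 0)"
proof
  assume reg: "regular r l"
  show "\<forall>x\<in>short_roots r. ipr r x (ivec l) \<noteq> 0"
  proof
    fix x assume "x \<in> short_roots r"
    then obtain a c s where x: "x = (\<lambda>k. ev a k + s * ev c k)" "a < c" "c < r" "s = 1 \<or> s = - 1"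
      by (rule short_roots_cases)
    have "ipr r x (ivec l) = of_int (l a) + s * of_int (l c)"
      unfolding x(1) ivec_def by (rule ipr_short) (use x in auto)
    moreover have "\<bar>l a\<bar> \<noteq> \<bar>l c\<bar>" using reg x by (auto simp: regular_def inj_on_def)
    hence "l a \<noteq> l c" "l a \<noteq> - l c" by auto
    hence "real_of_int (l a) \<noteq> of_int (l c)" "real_of_int (l a) \<noteq> - of_int (l c)" by (simp, linarith)
    ultimately show "ipr r x (ivec l) \<noteq> 0" using x(4) by auto
  qed
next
  assume L: "\<forall>x\<in>short_roots r. ipr r x (ivec l) \<noteq> 0"
  have ne: "\<bar>l a\<bar> \<noteq> \<bar>l c\<bar>" if ac: "a < c" "c < r" for a c
  proof
    assume eq: "\<bar>l a\<bar> = \<bar>l c\<bar>"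
    define s :: real where "s = (if l a = l c then - 1 else 1)"
    have "(\<lambda>k. ev a k + s * ev c k) \<in> short_roots r" unfolding short_roots_def using ac by (force simp: s_def)
    moreover have "ipr r (\<lambda>k. ev a k + s * ev c k) (ivec l) = of_int (l a) + s * of_int (l c)"
      unfolding ivec_def by (rule ipr_short) (use ac in auto)
    moreover have "real_of_int (l a) + s * of_int (l c) = 0"
      using eq by (auto simp: s_def abs_eq_iff)
    ultimately show False using L by metis
  qed
  show "regular r l" unfolding regular_def
  proof (rule inj_onI, rule ccontr)
    fix a c assume "a \<in> {..<r}" "c \<in> {..<r}" "\<bar>l a\<bar> = \<bar>l c\<bar>" "a \<noteq> c"
    thus False using ne[of a c] ne[of c a] by (cases "a < c") auto
  qed
qed

text \<open>The short positive roots come in pairs e_a + e_c, e_a - e_c. Hence the sign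
  \<open>(- 1) ^ card (set nus - B)\<close> of the generating function equals
  \<open>(- 1) ^ card B\<close>.\<close>

lemma even_card_short_roots: "even (card (short_roots r))"
proof -
  define X where "X = {(a, c). a < c \<and> c < r}"
  define F :: "(nat \<times> nat) \<times> real \<Rightarrow> nat \<Rightarrow> real" where "F = (\<lambda>((a, c), s) k. ev a k + s * ev c k)"
  have "bij_betw F (X \<times> {1, - 1}) (short_roots r)"
    unfolding bij_betw_def
  proof
    show "inj_on F (X \<times> {1, - 1})"
    proof (rule inj_onI)
      fix p q assume p: "p \<in> X \<times> {1, - 1}" and q: "q \<in> X \<times> {1, - 1}" and eq: "F p = F q"
      obtain a c s a' c' s' where pq: "p = ((a, c), s)" "q = ((a', c'), s')" by (metis surj_pair)
      have X: "(a, c) \<in> X" "(a', c') \<in> X" and s: "s \<in> {1, - 1}" "s' \<in> {1, - 1}" using p q pq by auto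
      have v: "ev a k + s * ev c k = ev a' k + s' * ev c' k" for k using fun_cong[OF eq, of k] by (simp add: pq F_def)
      have "a = a' \<and> c = c'"
        using v[of a] v[of c] v[of a'] v[of c'] X s by (auto simp: X_def ev_def split: if_splits)
      thus "p = q" using v[of c] X by (auto simp: X_def ev_def pq)
    qed
    show "F ` (X \<times> {1, - 1}) = short_roots r"
    proof (intro subset_antisym subsetI)
      fix x assume "x \<in> F ` (X \<times> {1, - 1})"
      then obtain a c s where "(a, c) \<in> X" "s = 1 \<or> s = - 1" "x = F ((a, c), s)" by auto
      thus "x \<in> short_roots r" unfolding short_roots_def X_def F_def by fastforce
    next
      fix x assume "x \<in> short_roots r"
      then obtain a c s where "x = (\<lambda>k. ev a k + s * ev c k)" "a < c" "c < r" "s = 1 \<or> s = - 1"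
        by (rule short_roots_cases)
      thus "x \<in> F ` (X \<times> {1, - 1})" by (intro image_eqI[of _ _ "((a, c), s)"]) (auto simp: F_def X_def)
    qed
  qed
  hence "card (short_roots r) = card (X \<times> {1, - 1::real})" by (rule bij_betw_same_card[symmetric])
  thus ?thesis by (simp add: card_cartesian_product)
qed

context type_C_data
begin

text \<open>If some short root is orthogonal to l, toggling the last one of them in the enumeration keeps B
  free of broken circuits: every later root lies outside the orthogonal complement of l.\<close>

lemma signed_sum_nbc:
  assumes dist: "distinct nus" and l: "l \<in> Vsp r"
  shows "(\<Sum>B\<in>NB. if l \<in> perp r B then (- 1) ^ card B else 0 :: complex)
    = (if \<forall>x\<in>short_roots r. ipr r x l \<noteq> 0 then 1 else 0)"
proof -
  define S where "S = {B\<in>NB. l \<in> perp r B}"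
  have S: "B \<in> S \<longleftrightarrow> nbc r nus B \<and> (\<forall>x\<in>B. ipr r x l = 0)" for B
    using l by (auto simp: S_def perp_def)
  have finS: "finite S" using finite_NB by (simp add: S_def)
  have eq: "(\<Sum>B\<in>NB. if l \<in> perp r B then (- 1) ^ card B else 0 :: complex) = (\<Sum>B\<in>S. (- 1) ^ card B)"
    unfolding S_def using finite_NB by (subst sum.inter_filter) auto
  show ?thesis
  proof (cases "\<forall>x\<in>short_roots r. ipr r x l \<noteq> 0")
    case True
    have "B = {}" if B: "B \<in> S" for B
    proof -
      have "B \<subseteq> short_roots r" "\<forall>x\<in>B. ipr r x l = 0" using B nbcD(3) by (simp_all add: S)
      thus ?thesis using True by blast
    qed
    moreover have "{} \<in> S" using nbc_empty by (simp add: S)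
    ultimately have "S = {{}}" by blast
    thus ?thesis unfolding eq using True by simp
  next
    case False
    define M where "M = {m. m < length nus \<and> ipr r (nus ! m) l = 0}"
    have "finite M" by (simp add: M_def)
    moreover have "M \<noteq> {}" using False by (auto simp: M_def simp flip: nus) (metis in_set_conv_nth)
    ultimately have mM: "Max M \<in> M" and mmax: "\<And>j. j \<in> M \<Longrightarrow> j \<le> Max M" by auto
    define m where "m = Max M"
    define x where "x = nus ! m"
    have m: "m < length nus" "ipr r x l = 0" "\<And>j. j < length nus \<Longrightarrow> m < j \<Longrightarrow> ipr r (nus ! j) l \<noteq> 0"
      using mM mmax by (auto simp: m_def M_def x_def not_le[symmetric])
    have step: "nbc r nus (insert x B) \<longleftrightarrow> nbc r nus B" if B: "\<forall>y\<in>B. ipr r y l = 0" for B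
    proof -
      have "nus ! j \<in> lin_hull r (insert x B \<inter> set (take j nus)) \<longleftrightarrow> nus ! j \<in> lin_hull r (B \<inter> set (take j nus))"
        if j: "j < length nus" for j
      proof (cases "m < j")
        case True
        have "l \<in> perp r (insert x B \<inter> set (take j nus))" "l \<in> perp r (B \<inter> set (take j nus))"
          using B m(2) l by (auto simp: perp_def)
        thus ?thesis using lin_hull_perp m(3)[OF j True] by blast
      next
        case False
        \<comment> \<open>For positions up to \<open>m\<close> the toggled root has not yet
          occurred, because it stands at position \<open>m\<close> only.\<close>
        have "x \<notin> set (take j nus)"
        proof
          assume "x \<in> set (take j nus)"
          then obtain i where "i < j" "i < length nus" "nus ! i = x" by (auto simp: in_set_conv_nth)
          thus False using nth_eq_iff_index_eq[OF dist, of i m] m(1) False by (simp add: x_def)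
        qed
        hence "insert x B \<inter> set (take j nus) = B \<inter> set (take j nus)" by auto
        thus ?thesis by simp
      qed
      moreover have "x \<in> set nus" using m(1) by (simp add: x_def)
      ultimately show ?thesis by (auto simp: nbc_def)
    qed
    define tog where "tog B = (if x \<in> B then B - {x} else insert x B)" for B
    have togtog: "tog (tog B) = B" for B by (auto simp: tog_def)
    have togS: "tog B \<in> S" if B: "B \<in> S" for B
    proof (cases "x \<in> B")
      case True
      have "insert x (B - {x}) = B" using True by auto
      thus ?thesis using B step[of "B - {x}"] True by (auto simp: S tog_def)
    next
      case False
      thus ?thesis using B step[of B] m(2) by (auto simp: S tog_def)
    qed
    have sgn: "(- 1) ^ card (tog B) = - ((- 1 :: complex) ^ card B)" if B: "B \<in> S" for B
    proof -
      have finB: "finite B" using B nbcD(2) by (auto simp: S)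
      show ?thesis
      proof (cases "x \<in> B")
        case True
        have "card B = Suc (card (B - {x}))" using card_Suc_Diff1[OF finB True] by simp
        hence "(- 1 :: complex) ^ card B = - ((- 1) ^ card (B - {x}))" by (simp only: power_Suc) simp
        thus ?thesis using True unfolding tog_def by (simp only: if_True minus_minus)
      next
        case False
        thus ?thesis using finB by (simp add: tog_def)
      qed
    qed
    have "(\<Sum>B\<in>S. (- 1 :: complex) ^ card B) = (\<Sum>B\<in>S. (- 1) ^ card (tog B))"
      by (rule sum.reindex_bij_witness[of S tog tog]) (auto simp: togtog togS)
    also have "\<dots> = - (\<Sum>B\<in>S. (- 1) ^ card B)" by (simp add: sgn sum_negf)
    finally have "(\<Sum>B\<in>S. (- 1 :: complex) ^ card B) = 0" by simp
    thus ?thesis unfolding eq using False by simp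
  qed
qed

text \<open>A point of the flat with nonzero coordinates is given by one nonzero integer per block.
  Even exponents hide the signs inside a block, so the weight is a product of inverse powers with
  the total degree of each block.\<close>

lemma lattice_blocks_has_sum:
  assumes B: "nbc r nus B" and E: "\<And>i. i < r \<Longrightarrow> E B i \<noteq> 0" and k: "\<And>i. i < r \<Longrightarrow> even (k i) \<and> 2 \<le> k i"
  shows "(lwt r k has_sum (\<Prod>\<rho>\<in>R B. 2 * zetaz (sum k (bl B \<rho>)))) {l\<in>nz_lattice r. ivec l \<in> perp r B}"
proof -
  let ?K = "\<lambda>\<rho>. sum k (bl B \<rho>)"
  let ?S = "fun_box (R B) (\<lambda>_. UNIV - {0}) (\<lambda>_. 0) :: (nat \<Rightarrow> int) set"
  have sp: "signed_partition r (P B) (E B)" by (rule nbcD(4)[OF B])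
  have pp: "perp r B = {m \<in> Vsp r. \<forall>i<r. m i = E B i * m (P B i)}"
    using rep[OF B] by (simp add: represents_def)
  have finbl: "finite (bl B \<rho>)" for \<rho> by (simp add: blk_def)
  have pR: "P B i \<in> R B" if "i < r" for i by (rule blk_rep_mem(1)[OF sp that E[OF that]])
  have Er: "E B i = 1 \<or> E B i = - 1" if "i < r" for i
    using sp E that by (auto simp: signed_partition_def)
  have RD: "\<rho> < r" "P B \<rho> = \<rho>" "E B \<rho> = 1" if "\<rho> \<in> R B" for \<rho> using that by (auto simp: reps_def)
  define e where "e i = (if E B i = 1 then 1 else - 1 :: int)" for i
  have e: "real_of_int (e i) = E B i" "e i = 1 \<or> e i = - 1" if "i < r" for i using Er[OF that] by (auto simp: e_def)
  \<comment> \<open>Spreads the integer of each block over its indices with the signs of the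
    partition; restriction to the representatives undoes it.\<close>
  define h where "h n i = (if i < r then e i * n (P B i) else 0)" for n :: "nat \<Rightarrow> int" and i
  have K: "even (?K \<rho>) \<and> 2 \<le> ?K \<rho>" if \<rho>: "\<rho> \<in> R B" for \<rho>
  proof
    show "even (?K \<rho>)" using k by (intro dvd_sum) (auto simp: blk_def)
    have "k \<rho> \<le> ?K \<rho>" using member_le_sum[of \<rho> "bl B \<rho>" k] blk_rep(1)[OF \<rho>] finbl by simp
    thus "2 \<le> ?K \<rho>" using k[OF RD(1)[OF \<rho>]] by simp
  qed
  have "((\<lambda>n. \<Prod>\<rho>\<in>R B. 1 / of_int (n \<rho>) ^ ?K \<rho>) has_sum (\<Prod>\<rho>\<in>R B. 2 * zetaz (?K \<rho>))) ?S"
    by (rule conjunct1[OF has_sum_prod_fun_box]) (use zetaz_int_has_sum K finite_reps in auto)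
  also have "(\<lambda>n. \<Prod>\<rho>\<in>R B. 1 / of_int (n \<rho>) ^ ?K \<rho>) = (\<lambda>n. lwt r k (h n))"
  proof
    fix n :: "nat \<Rightarrow> int"
    have "lwt r k (h n) = (\<Prod>i<r. 1 / of_int (n (P B i)) ^ k i)"
      unfolding lwt_def
    proof (intro prod.cong refl)
      fix i assume "i \<in> {..<r}"
      hence i: "i < r" by simp
      have "(of_int (e i) :: complex) ^ k i = 1" using e(2)[OF i] k[OF i] by auto
      thus "1 / of_int (h n i) ^ k i = 1 / (of_int (n (P B i)) :: complex) ^ k i"
        using i by (simp add: h_def power_mult_distrib)
    qed
    also have "\<dots> = (\<Prod>\<rho>\<in>R B. \<Prod>i\<in>bl B \<rho>. 1 / of_int (n (P B i)) ^ k i)"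
      by (rule prod_UN_disjoint_cover) (use pR E finbl finite_reps in \<open>auto simp: blk_def\<close>)
    also have "\<dots> = (\<Prod>\<rho>\<in>R B. \<Prod>i\<in>bl B \<rho>. 1 / of_int (n \<rho>) ^ k i)"
      by (intro prod.cong refl) (auto simp: blk_def)
    also have "\<dots> = (\<Prod>\<rho>\<in>R B. 1 / of_int (n \<rho>) ^ ?K \<rho>)"
      by (simp add: prod_dividef power_sum)
    finally show "(\<Prod>\<rho>\<in>R B. 1 / of_int (n \<rho>) ^ ?K \<rho>) = lwt r k (h n)" ..
  qed
  finally have hs: "((\<lambda>n. lwt r k (h n)) has_sum (\<Prod>\<rho>\<in>R B. 2 * zetaz (?K \<rho>))) ?S" .
  have bij: "bij_betw h ?S {l\<in>nz_lattice r. ivec l \<in> perp r B}"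
  proof (rule bij_betw_byWitness[where f' = "\<lambda>l \<rho>. if \<rho> \<in> R B then l \<rho> else 0"])
    show "\<forall>n\<in>?S. (\<lambda>\<rho>. if \<rho> \<in> R B then h n \<rho> else 0) = n"
    proof (intro ballI ext)
      fix n \<rho> assume n: "n \<in> ?S"
      show "(if \<rho> \<in> R B then h n \<rho> else 0) = n \<rho>"
        using fun_boxD(2)[OF n, of \<rho>] RD[of \<rho>] by (auto simp: h_def e_def)
    qed
    show "\<forall>l\<in>{l\<in>nz_lattice r. ivec l \<in> perp r B}. h (\<lambda>\<rho>. if \<rho> \<in> R B then l \<rho> else 0) = l"
    proof (intro ballI ext)
      fix l i assume "l \<in> {l\<in>nz_lattice r. ivec l \<in> perp r B}"
      hence l: "l \<in> nz_lattice r" and lp: "ivec l \<in> perp r B" by auto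
      show "h (\<lambda>\<rho>. if \<rho> \<in> R B then l \<rho> else 0) i = l i"
      proof (cases "i < r")
        case True
        have "ivec l i = E B i * ivec l (P B i)" using lp True unfolding pp by blast
        hence "real_of_int (l i) = of_int (e i * l (P B i))" using e(1)[OF True] by (simp add: ivec_def)
        hence "l i = e i * l (P B i)" by (simp only: of_int_eq_iff)
        thus ?thesis using True pR[OF True] by (simp add: h_def)
      next
        case False
        thus ?thesis using fun_boxD(2)[OF l[unfolded nz_lattice_def], of i] by (simp add: h_def)
      qed
    qed
    show "h ` ?S \<subseteq> {l\<in>nz_lattice r. ivec l \<in> perp r B}"
    proof (intro image_subsetI CollectI conjI)
      fix n assume n: "n \<in> ?S"
      show l: "h n \<in> nz_lattice r"
        unfolding nz_lattice_def fun_box_def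
        using fun_boxD(1)[OF n pR] by (auto simp: h_def e_def)
      have "ivec (h n) i = E B i * ivec (h n) (P B i)" if i: "i < r" for i
        using i RD[OF pR[OF i]] e(1)[OF i] e(1)[OF RD(1)[OF pR[OF i]]] by (simp add: ivec_def h_def)
      thus "ivec (h n) \<in> perp r B" unfolding pp using ivec_Vsp[OF l] by blast
    qed
    show "(\<lambda>l \<rho>. if \<rho> \<in> R B then l \<rho> else 0) ` {l\<in>nz_lattice r. ivec l \<in> perp r B} \<subseteq> ?S"
      using RD(1) by (auto simp: nz_lattice_def fun_box_def)
  qed
  show ?thesis using hs unfolding has_sum_reindex_bij_betw[OF bij, where f = "lwt r k"] .
qed

text \<open>At even positive exponents the signs \<open>\<sigma>\<close> disappear. Each block
  contributes a sign of exponent \<open>card (bl B \<rho>) - 1\<close>; together they give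
  \<open>(- 1) ^ card B\<close>, which cancels the sign of the generating function.\<close>

lemma blocks_coeff_eq:
  assumes B: "nbc r nus B" and E: "\<And>i. i < r \<Longrightarrow> E B i \<noteq> 0" and k: "\<And>i. i < r \<Longrightarrow> even (k i) \<and> 2 \<le> k i"
  shows "(- 1) ^ card (set nus - B) * blocks_coeff B k = (\<Prod>\<rho>\<in>R B. bernc (sum k (bl B \<rho>)))"
proof -
  have sp: "signed_partition r (P B) (E B)" by (rule nbcD(4)[OF B])
  have finbl: "finite (bl B \<rho>)" for \<rho> by (simp add: blk_def)
  have JB: "J B = {..<r}" using E by (auto simp: J_def)
  have cl: "card (bl B \<rho>) \<ge> 1" "\<not> (\<forall>i\<in>bl B \<rho>. k i = 0)" "\<forall>i\<in>bl B \<rho>. 1 \<le> k i" if \<rho>: "\<rho> \<in> R B" for \<rho>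
  proof -
    have m: "\<rho> \<in> bl B \<rho>" by (rule blk_rep(1)[OF \<rho>])
    show "card (bl B \<rho>) \<ge> 1" using m finbl by (metis One_nat_def Suc_leI card_gt_0_iff empty_iff)
    have kk: "1 \<le> k i" if "i \<in> bl B \<rho>" for i using k[of i] that by (auto simp: blk_def)
    show "\<not> (\<forall>i\<in>bl B \<rho>. k i = 0)" using kk[OF m] m by (metis not_one_le_zero)
    show "\<forall>i\<in>bl B \<rho>. 1 \<le> k i" using kk by blast
  qed
  have "(\<Prod>i\<in>J B. (of_real (\<sigma> B i) :: complex) ^ k i) = 1"
    unfolding JB
  proof (rule prod.neutral, rule ballI)
    fix i assume "i \<in> {..<r}"
    hence i: "i < r" by simp
    show "(of_real (\<sigma> B i) :: complex) ^ k i = 1" using sigma_unit(1)[OF B i E[OF i]] k[OF i] by auto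
  qed
  hence "blocks_coeff B k = (\<Prod>\<rho>\<in>R B. blk_coeff (bl B \<rho>) k)" using E by (auto simp: blocks_coeff_def)
  also have "\<dots> = (\<Prod>\<rho>\<in>R B. (- 1) ^ (card (bl B \<rho>) - 1) * bernc (sum k (bl B \<rho>)))"
  proof (rule prod.cong[OF refl])
    fix \<rho> assume \<rho>: "\<rho> \<in> R B"
    show "blk_coeff (bl B \<rho>) k = (- 1) ^ (card (bl B \<rho>) - 1) * bernc (sum k (bl B \<rho>))"
      unfolding blk_coeff_def if_not_P[OF cl(2)[OF \<rho>]] if_P[OF cl(3)[OF \<rho>]] ..
  qed
  also have "\<dots> = (- 1) ^ (\<Sum>\<rho>\<in>R B. card (bl B \<rho>) - 1) * (\<Prod>\<rho>\<in>R B. bernc (sum k (bl B \<rho>)))"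
    by (simp add: prod.distrib power_sum)
  \<comment> \<open>The blocks exhaust the \<open>r\<close> indices, so the sum is \<open>r\<close>
    minus the number of blocks, and that is the rank of \<open>B\<close>.\<close>
  also have "(\<Sum>\<rho>\<in>R B. card (bl B \<rho>) - 1) = card B"
  proof -
    have "card {..<r} = card (\<Union>\<rho>\<in>R B. bl B \<rho>)"
      using blk_rep_mem[OF sp _ E] by (intro arg_cong[of _ _ card]) (auto simp: blk_def)
    also have "\<dots> = (\<Sum>\<rho>\<in>R B. card (bl B \<rho>))"
      by (rule card_UN_disjoint) (auto simp: finite_reps blk_def)
    also have "\<dots> = (\<Sum>\<rho>\<in>R B. (card (bl B \<rho>) - 1) + 1)"
      by (rule sum.cong[OF refl]) (metis cl(1) le_add_diff_inverse2)
    also have "\<dots> = (\<Sum>\<rho>\<in>R B. card (bl B \<rho>) - 1) + card (R B)" by (subst sum.distrib) simp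
    finally have "(\<Sum>\<rho>\<in>R B. card (bl B \<rho>) - 1) + card (R B) = r" by simp
    thus ?thesis using rep[OF B] by (simp add: represents_def)
  qed
  finally have bc: "blocks_coeff B k = (- 1) ^ card B * (\<Prod>\<rho>\<in>R B. bernc (sum k (bl B \<rho>)))" .
  have "card (set nus - B) + card B = card (set nus)"
  proof -
    have "B \<subseteq> set nus" using B by (simp add: nbc_def)
    thus ?thesis using nbcD(2)[OF B] card_mono[of "set nus" B] by (simp add: card_Diff_subset)
  qed
  hence "even (card (set nus - B) + card B)" using even_card_short_roots[of r] nus by simp
  hence "(- 1 :: complex) ^ (card (set nus - B) + card B) = 1" by simp
  thus ?thesis unfolding bc by (simp add: power_add mult.assoc[symmetric])
qed

text \<open>Per block, \<open>bernc K * (2 * pi * \<i>) ^ K\<close> is minus a full sum over nonzero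
  integers. The lattice sums over all flats, weighted with signs, then collapse pointwise to the
  regular points by \<open>signed_sum_nbc\<close>.\<close>

theorem genF_coeff_lattice_sum:
  assumes dist: "distinct nus" and k: "\<And>i. i < r \<Longrightarrow> even (k i) \<and> 2 \<le> k i"
  shows "(lwt r k has_sum ((- 1) ^ r * (genF_coeff k * (2 * pi * \<i>) ^ (\<Sum>i<r. k i)))) {l\<in>nz_lattice r. regular r l}"
proof -
  define S where "S B = (\<Prod>\<rho>\<in>R B. 2 * zetaz (sum k (bl B \<rho>)))" for B
  \<comment> \<open>When a coordinate is forced to vanish on the flat, both sides are 0: no point
    with nonzero coordinates lies on it, and the coefficient vanishes because the exponent there is
    positive.\<close>
  define T where "T B = (if \<forall>i<r. E B i \<noteq> 0 then S B else 0)" for B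
  have hT: "((\<lambda>l. if ivec l \<in> perp r B then lwt r k l else 0) has_sum T B) (nz_lattice r)" if B: "nbc r nus B" for B
  proof (cases "\<forall>i<r. E B i \<noteq> 0")
    case True
    have "(lwt r k has_sum T B) {l\<in>nz_lattice r. ivec l \<in> perp r B}"
      using lattice_blocks_has_sum[OF B _ k] True by (simp add: T_def S_def)
    also have "?this \<longleftrightarrow> ?thesis" by (rule has_sum_cong_neutral) auto
    finally show ?thesis .
  next
    case False
    then obtain i where i: "i < r" "E B i = 0" by auto
    have "ivec l \<notin> perp r B" if l: "l \<in> nz_lattice r" for l
    proof
      assume "ivec l \<in> perp r B"
      from represents_perp[OF rep[OF B] this i(1)] have "l i = 0" using i(2) by (simp add: ivec_def)
      moreover have "l i \<noteq> 0" using fun_boxD(1)[OF l[unfolded nz_lattice_def], of i] i(1) by auto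
      ultimately show False by simp
    qed
    hence "((\<lambda>l. if ivec l \<in> perp r B then lwt r k l else 0) has_sum 0) (nz_lattice r)"
      by (intro has_sum_0) auto
    moreover have "T B = 0" unfolding T_def by (rule if_not_P[OF False])
    ultimately show ?thesis by simp
  qed
  \<comment> \<open>Extension by zero puts all flats on the same index set; each sum converges
    separately, so the finite alternating combination may be evaluated point by point.\<close>
  have "((\<lambda>l. \<Sum>B\<in>NB. (- 1) ^ card B * (if ivec l \<in> perp r B then lwt r k l else 0)) has_sum (\<Sum>B\<in>NB. (- 1) ^ card B * T B)) (nz_lattice r)"
    by (intro has_sum_finite_sum finite_NB has_sum_cmult_right hT) simp
  also have "?this \<longleftrightarrow> (lwt r k has_sum (\<Sum>B\<in>NB. (- 1) ^ card B * T B)) {l\<in>nz_lattice r. regular r l}"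
  proof -
    have e: "(\<Sum>B\<in>NB. (- 1) ^ card B * (if ivec l \<in> perp r B then lwt r k l else 0)) = (if regular r l then lwt r k l else 0)"
      if l: "l \<in> nz_lattice r" for l
    proof -
      have "(\<Sum>B\<in>NB. (- 1) ^ card B * (if ivec l \<in> perp r B then lwt r k l else 0))
         = (\<Sum>B\<in>NB. if ivec l \<in> perp r B then (- 1) ^ card B else 0) * lwt r k l"
        unfolding sum_distrib_right by (intro sum.cong refl) auto
      thus ?thesis unfolding signed_sum_nbc[OF dist ivec_Vsp[OF l]] regular_iff by simp
    qed
    show ?thesis by (rule has_sum_cong_neutral) (auto simp: e)
  qed
  finally have hs: "(lwt r k has_sum (\<Sum>B\<in>NB. (- 1) ^ card B * T B)) {l\<in>nz_lattice r. regular r l}" .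
  have "(- 1) ^ card B * T B = (- 1) ^ r * ((- 1) ^ card (set nus - B) * blocks_coeff B k * (2 * pi * \<i>) ^ (\<Sum>i<r. k i))"
    if B: "nbc r nus B" for B
  proof (cases "\<forall>i<r. E B i \<noteq> 0")
    case True
    hence E: "\<And>i. i < r \<Longrightarrow> E B i \<noteq> 0" by blast
    have sp: "signed_partition r (P B) (E B)" by (rule nbcD(4)[OF B])
    have finbl: "finite (bl B \<rho>)" for \<rho> by (simp add: blk_def)
    have "(\<Sum>i<r. k i) = (\<Sum>i\<in>(\<Union>\<rho>\<in>R B. bl B \<rho>). k i)"
      using blk_rep_mem[OF sp _ E] by (intro sum.cong) (auto simp: blk_def)
    also have "\<dots> = (\<Sum>\<rho>\<in>R B. sum k (bl B \<rho>))"
      by (rule sum.UNION_disjoint) (auto simp: finite_reps blk_def)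
    finally have "(2 * pi * \<i>) ^ (\<Sum>i<r. k i) = (\<Prod>\<rho>\<in>R B. (2 * pi * \<i>) ^ sum k (bl B \<rho>))" by (simp add: power_sum)
    hence "(- 1) ^ card (set nus - B) * blocks_coeff B k * (2 * pi * \<i>) ^ (\<Sum>i<r. k i)
       = (\<Prod>\<rho>\<in>R B. bernc (sum k (bl B \<rho>)) * (2 * pi * \<i>) ^ sum k (bl B \<rho>))"
      using blocks_coeff_eq[OF B E k] by (simp add: prod.distrib)
    also have "\<dots> = (\<Prod>\<rho>\<in>R B. (- 1) * (2 * zetaz (sum k (bl B \<rho>))))"
    proof (rule prod.cong[OF refl])
      fix \<rho> assume \<rho>: "\<rho> \<in> R B"
      have ev: "even (sum k (bl B \<rho>))" using k by (intro dvd_sum) (auto simp: blk_def)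
      have "k \<rho> \<le> sum k (bl B \<rho>)" using member_le_sum[of \<rho> "bl B \<rho>" k] blk_rep(1)[OF \<rho>] finbl by simp
      hence "sum k (bl B \<rho>) \<noteq> 0" using k[of \<rho>] \<rho> by (auto simp: reps_def)
      from bernc_even[OF ev this]
      show "bernc (sum k (bl B \<rho>)) * (2 * pi * \<i>) ^ sum k (bl B \<rho>) = (- 1) * (2 * zetaz (sum k (bl B \<rho>)))" by simp
    qed
    also have "\<dots> = (- 1) ^ card (R B) * S B" unfolding S_def prod.distrib by simp
    finally have "(- 1) ^ r * ((- 1) ^ card (set nus - B) * blocks_coeff B k * (2 * pi * \<i>) ^ (\<Sum>i<r. k i)) = (- 1) ^ r * (- 1) ^ card (R B) * S B"
      by simp
    \<comment> \<open>The minus signs of the blocks and the global sign combine, because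
      \<open>r\<close> is the rank of \<open>B\<close> plus the number of blocks.\<close>
    also have "(- 1 :: complex) ^ r * (- 1) ^ card (R B) = (- 1) ^ card B"
    proof -
      have r: "r = card B + card (R B)" using rep[OF B] by (simp add: represents_def)
      have "(- 1 :: complex) ^ r = (- 1) ^ card B * (- 1) ^ card (R B)" by (subst r) (rule power_add)
      moreover have "(- 1 :: complex) ^ card (R B) * (- 1) ^ card (R B) = 1" by (cases "even (card (R B))") auto
      ultimately show ?thesis by (simp only: mult.assoc mult_1_right)
    qed
    finally show ?thesis using True by (simp add: T_def)
  next
    case False
    then obtain i where i: "i < r" "E B i = 0" by auto
    hence "\<not> (\<forall>i<r. E B i = 0 \<longrightarrow> k i = 0)" using k[OF i(1)] by auto
    hence "blocks_coeff B k = 0" unfolding blocks_coeff_def by (simp only: if_False)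
    moreover have "T B = 0" unfolding T_def by (rule if_not_P[OF False])
    ultimately show ?thesis by simp
  qed
  hence "(\<Sum>B\<in>NB. (- 1) ^ card B * T B) = (- 1) ^ r * (genF_coeff k * (2 * pi * \<i>) ^ (\<Sum>i<r. k i))"
    unfolding genF_coeff_def sum_distrib_left sum_distrib_right by (intro sum.cong) auto
  thus ?thesis using hs by simp
qed

end

section \<open>Compositions and multisets\<close>

definition comp_lists :: "nat \<Rightarrow> nat \<Rightarrow> nat list set" where
  "comp_lists r N = {xs. length xs = r \<and> (\<forall>x\<in>set xs. 0 < x) \<and> sum_list xs = N}"

abbreviation blow_up :: "nat list \<Rightarrow> nat list \<Rightarrow> nat list" where
  "blow_up J hs \<equiv> concat (map2 replicate J hs)"

lemma finite_comp_lists: "finite (comp_lists r N)"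
proof (rule finite_subset)
  show "comp_lists r N \<subseteq> {xs. set xs \<subseteq> {..N} \<and> length xs = r}"
    by (auto simp: comp_lists_def intro: member_le_sum_list)
qed (simp add: finite_lists_length_eq)

lemma blow_up_scale:
  "length J = length hs \<Longrightarrow> concat (map2 (\<lambda>j h. replicate j (m * h)) J hs) = map (times m) (blow_up J hs)"
  by (induction J hs rule: list_induct2) auto

lemma length_blow_up: "length J = length hs \<Longrightarrow> length (blow_up J hs) = sum_list J"
  by (induction J hs rule: list_induct2) auto

lemma set_blow_up: "length J = length hs \<Longrightarrow> \<forall>j\<in>set J. 0 < j \<Longrightarrow> set (blow_up J hs) = set hs"
  by (induction J hs rule: list_induct2) auto

text \<open>For distinct entries the block lengths are multiplicities, so they can be recovered from
  the multiset.\<close>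

lemma count_blow_up:
  "length J = length hs \<Longrightarrow> distinct hs \<Longrightarrow> map (count (mset (blow_up J hs))) hs = J"
proof (induction J hs rule: list_induct2)
  case (Cons j J h hs)
  have "count (mset (blow_up J hs)) h = 0"
    using Cons.prems Cons.hyps
    by (auto simp: count_eq_zero_iff dest!: set_zip_rightD)
  moreover have "map (count (mset (blow_up (j # J) (h # hs)))) hs = map (count (mset (blow_up J hs))) hs"
    using Cons.prems by (intro map_cong refl) (auto simp: count_eq_zero_iff)
  moreover have "count (mset (blow_up (j # J) (h # hs))) h = j + count (mset (blow_up J hs)) h" by simp
  ultimately have "map (count (mset (blow_up (j # J) (h # hs)))) (h # hs) = j # map (count (mset (blow_up J hs))) hs"
    by (simp only: list.map) simp
  thus ?case using Cons by (simp only: distinct.simps)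
qed simp

lemma blow_up_count: "distinct hs \<Longrightarrow> mset (blow_up (map (count M) hs) hs) = filter_mset (\<lambda>x. x \<in> set hs) M"
proof (induction hs)
  case (Cons h hs)
  have "filter_mset (\<lambda>x. x \<in> set (h # hs)) M = replicate_mset (count M h) h + filter_mset (\<lambda>x. x \<in> set hs) M"
    using Cons.prems by (intro multiset_eqI) auto
  thus ?case using Cons by simp
qed simp

text \<open>A pair of \<open>J\<close> and an increasing list is the same as a multiset, with
  \<open>J\<close> its multiplicities. A multiset has r!/(j_1! ...) orderings, so for symmetric
  \<open>F\<close> the weights turn the sum into an average over all compositions.\<close>

lemma sum_Pr_Ar:
  fixes F :: "nat list \<Rightarrow> complex"
  assumes r: "1 \<le> r" and d: "1 \<le> d" and inv: "\<And>xs ys. mset xs = mset ys \<Longrightarrow> F xs = F ys"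
  shows "(\<Sum>J\<in>Pr r. 1 / (\<Prod>j\<leftarrow>J. of_nat (fact j)) * (\<Sum>x\<in>Ar d N J. F x))
    = (\<Sum>xs\<in>comp_lists r N. F (map (times (2 * d)) xs)) / fact r"
proof -
  define MS where "MS = mset ` comp_lists r N"
  define h where "h M = F (map (times (2 * d)) (sorted_list_of_multiset M))" for M
  have hF: "F (map (times (2 * d)) xs) = h (mset xs)" for xs
    unfolding h_def by (rule inv) (simp add: mset_map)
  define HS where "HS J = {hs. length hs = length J \<and> sorted_wrt (<) hs \<and> (\<forall>h\<in>set hs. 0 < h) \<and> sum_list (blow_up J hs) = N}" for J
  have rec: "map (count (mset (blow_up J hs))) hs = J" "sorted_list_of_set (set_mset (mset (blow_up J hs))) = hs"
    if J: "J \<in> Pr r" and hs: "hs \<in> HS J" for J hs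
  proof -
    have l: "length J = length hs" "sorted_wrt (<) hs" "\<forall>j\<in>set J. 0 < j" using J hs by (auto simp: Pr_def HS_def)
    have dist: "distinct hs" using l(2) by (simp add: strict_sorted_iff)
    show "map (count (mset (blow_up J hs))) hs = J" by (rule count_blow_up[OF l(1) dist])
    have "set_mset (mset (blow_up J hs)) = set hs" using set_blow_up[OF l(1,3)] by simp
    thus "sorted_list_of_set (set_mset (mset (blow_up J hs))) = hs"
      using l(2) by (simp add: sorted_list_of_set.idem_if_sorted_distinct strict_sorted_iff)
  qed
  have bij: "bij_betw (\<lambda>(J, hs). mset (blow_up J hs)) (SIGMA J:Pr r. HS J) MS"
  \<comment> \<open>The inverse lists the support of the multiset in increasing order and attaches
    the multiplicities in that order.\<close>
  proof (rule bij_betw_byWitness[where f' = "\<lambda>M. (map (count M) (sorted_list_of_set (set_mset M)), sorted_list_of_set (set_mset M))"])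
    show "\<forall>p\<in>SIGMA J:Pr r. HS J. (\<lambda>M. (map (count M) (sorted_list_of_set (set_mset M)), sorted_list_of_set (set_mset M)))
        ((\<lambda>(J, hs). mset (blow_up J hs)) p) = p"
    proof
      fix p assume "p \<in> (SIGMA J:Pr r. HS J)"
      then obtain J hs where p: "p = (J, hs)" "J \<in> Pr r" "hs \<in> HS J" by auto
      show "(\<lambda>M. (map (count M) (sorted_list_of_set (set_mset M)), sorted_list_of_set (set_mset M)))
        ((\<lambda>(J, hs). mset (blow_up J hs)) p) = p"
        unfolding p(1) split rec(2)[OF p(2,3)] rec(1)[OF p(2,3)] ..
    qed
    have recon: "mset (blow_up (map (count M) (sorted_list_of_set (set_mset M))) (sorted_list_of_set (set_mset M))) = M" for M :: "nat multiset"
    proof -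
      have "filter_mset (\<lambda>x. x \<in># M) M = M" by (rule multiset_eqI) (simp add: not_in_iff)
      thus ?thesis by (subst blow_up_count) simp_all
    qed
    show "\<forall>M\<in>MS. (\<lambda>(J, hs). mset (blow_up J hs)) (map (count M) (sorted_list_of_set (set_mset M)), sorted_list_of_set (set_mset M)) = M"
      unfolding split using recon by blast
    show "(\<lambda>(J, hs). mset (blow_up J hs)) ` (SIGMA J:Pr r. HS J) \<subseteq> MS"
    proof (intro image_subsetI)
      fix p assume "p \<in> (SIGMA J:Pr r. HS J)"
      then obtain J hs where p: "p = (J, hs)" "J \<in> Pr r" "hs \<in> HS J" by auto
      have l: "length J = length hs" "\<forall>j\<in>set J. 0 < j" using p by (auto simp: Pr_def HS_def)
      have "blow_up J hs \<in> comp_lists r N"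
        using p(2,3) length_blow_up[OF l(1)] set_blow_up[OF l] unfolding comp_lists_def Pr_def HS_def by simp
      thus "(\<lambda>(J, hs). mset (blow_up J hs)) p \<in> MS" unfolding p(1) split MS_def by (rule imageI)
    qed
    show "(\<lambda>M. (map (count M) (sorted_list_of_set (set_mset M)), sorted_list_of_set (set_mset M))) ` MS \<subseteq> (SIGMA J:Pr r. HS J)"
    proof (intro image_subsetI)
      fix M assume "M \<in> MS"
      then obtain xs where xs: "xs \<in> comp_lists r N" "M = mset xs" by (auto simp: MS_def)
      let ?hs = "sorted_list_of_set (set_mset M)"
      let ?J = "map (count M) ?hs"
      have "sum_list (blow_up ?J ?hs) = sum_mset (mset (blow_up ?J ?hs))" by (rule sum_mset_sum_list[symmetric])
      hence sl: "sum_list (blow_up ?J ?hs) = N" unfolding recon using xs by (simp add: comp_lists_def sum_mset_sum_list)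
      have "length (blow_up ?J ?hs) = size (mset (blow_up ?J ?hs))" by (rule size_mset[symmetric])
      hence "sum_list ?J = r" unfolding recon using xs length_blow_up[of ?J ?hs] by (simp add: comp_lists_def)
      moreover have "?hs \<noteq> []" using xs r by (auto simp: comp_lists_def)
      moreover have "\<forall>j\<in>set ?J. 0 < j" by auto
      ultimately have "?J \<in> Pr r" by (simp add: Pr_def)
      moreover have "?hs \<in> HS ?J"
        using xs sl by (simp add: HS_def comp_lists_def strict_sorted_list_of_set)
      ultimately show "(?J, ?hs) \<in> (SIGMA J:Pr r. HS J)" by blast
    qed
  qed
  have finMS: "finite MS" by (simp add: MS_def finite_comp_lists)
  have finS: "finite (SIGMA J:Pr r. HS J)" using bij_betw_finite[OF bij] finMS by simp
  have finHS: "finite (HS J)" if "J \<in> Pr r" for J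
  proof -
    have "HS J \<subseteq> snd ` (SIGMA J:Pr r. HS J)" using that by force
    thus ?thesis using finS by (meson finite_imageI finite_subset)
  qed
  have finPr: "finite (Pr r)"
  proof (rule finite_subset)
    show "Pr r \<subseteq> {J. set J \<subseteq> {..r} \<and> length J \<le> r}"
    proof
      fix J assume J: "J \<in> Pr r"
      have "length J \<le> sum_list J" using J sum_list_mono[of J "\<lambda>_. 1" id] by (fastforce simp: Pr_def sum_list_triv Suc_leI)
      moreover have "set J \<subseteq> {..r}" using J by (auto simp: Pr_def intro: member_le_sum_list)
      ultimately show "J \<in> {J. set J \<subseteq> {..r} \<and> length J \<le> r}" using J by (simp add: Pr_def)
    qed
  qed (rule finite_lists_length_le, simp)
  have ArF: "(\<Sum>x\<in>Ar d N J. F x) = (\<Sum>hs\<in>HS J. h (mset (blow_up J hs)))" if J: "J \<in> Pr r" for J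
  proof -
    have "Ar d N J = (\<lambda>hs. concat (map2 (\<lambda>j h. replicate j (2 * d * h)) J hs)) ` HS J"
      unfolding Ar_def HS_def by blast
    also have "\<dots> = (\<lambda>hs. map (times (2 * d)) (blow_up J hs)) ` HS J"
      by (rule image_cong[OF refl]) (rule blow_up_scale, simp add: HS_def)
    finally have "Ar d N J = (\<lambda>hs. map (times (2 * d)) (blow_up J hs)) ` HS J" .
    moreover have "inj_on (\<lambda>hs. map (times (2 * d)) (blow_up J hs)) (HS J)"
    proof (rule inj_onI)
      fix hs hs' assume hs: "hs \<in> HS J" "hs' \<in> HS J" and eq: "map (times (2 * d)) (blow_up J hs) = map (times (2 * d)) (blow_up J hs')"
      have "inj (times (2 * d))" using d by (intro injI) simp
      hence "blow_up J hs = blow_up J hs'" using eq by (simp only: inj_map_eq_map)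
      thus "hs = hs'" using rec(2)[OF J hs(1)] rec(2)[OF J hs(2)] by simp
    qed
    ultimately show ?thesis by (simp add: sum.reindex hF o_def)
  qed
  have factJ: "(\<Prod>j\<leftarrow>J. of_nat (fact j)) = (\<Prod>x\<in>set_mset (mset (blow_up J hs)). of_nat (fact (count (mset (blow_up J hs)) x)) :: complex)"
    if J: "J \<in> Pr r" and hs: "hs \<in> HS J" for J hs
  proof -
    let ?M = "mset (blow_up J hs)"
    have dist: "distinct hs" using hs by (simp add: HS_def strict_sorted_iff)
    have s: "set_mset ?M = set hs" using J hs set_blow_up[of J hs] by (simp add: HS_def Pr_def)
    have "(\<Prod>x\<in>set hs. of_nat (fact (count ?M x)) :: complex) = (\<Prod>x\<leftarrow>hs. of_nat (fact (count ?M x)))"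
      by (rule prod.distinct_set_conv_list[OF dist])
    also have "\<dots> = (\<Prod>j\<leftarrow>map (count ?M) hs. of_nat (fact j))" by (simp add: o_def)
    also have "map (count ?M) hs = J" by (rule rec(1)[OF J hs])
    finally show ?thesis unfolding s ..
  qed
  have "(\<Sum>J\<in>Pr r. 1 / (\<Prod>j\<leftarrow>J. of_nat (fact j)) * (\<Sum>x\<in>Ar d N J. F x))
     = (\<Sum>J\<in>Pr r. \<Sum>hs\<in>HS J. h (mset (blow_up J hs)) / (\<Prod>x\<in>set_mset (mset (blow_up J hs)). of_nat (fact (count (mset (blow_up J hs)) x))))"
  proof (rule sum.cong[OF refl])
    fix J assume J: "J \<in> Pr r"
    show "1 / (\<Prod>j\<leftarrow>J. of_nat (fact j)) * (\<Sum>x\<in>Ar d N J. F x)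
      = (\<Sum>hs\<in>HS J. h (mset (blow_up J hs)) / (\<Prod>x\<in>set_mset (mset (blow_up J hs)). of_nat (fact (count (mset (blow_up J hs)) x))))"
      unfolding ArF[OF J] sum_distrib_left by (rule sum.cong[OF refl]) (simp only: factJ[OF J] times_divide_eq_left mult_1_left)
  qed
  also have "\<dots> = (\<Sum>(J, hs)\<in>(SIGMA J:Pr r. HS J). h (mset (blow_up J hs)) / (\<Prod>x\<in>set_mset (mset (blow_up J hs)). of_nat (fact (count (mset (blow_up J hs)) x))))"
    by (rule sum.Sigma[OF finPr]) (use finHS in blast)
  also have "\<dots> = (\<Sum>M\<in>MS. h M / (\<Prod>x\<in>set_mset M. of_nat (fact (count M x))))"
    by (subst sum.reindex_bij_betw[OF bij, symmetric]) (simp add: case_prod_unfold)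
  also have "\<dots> = (\<Sum>M\<in>MS. of_nat (card (permutations_of_multiset M)) * h M) / fact r"
    unfolding sum_divide_distrib
  proof (rule sum.cong[OF refl])
    fix M assume "M \<in> MS"
    hence sz: "size M = r" by (auto simp: MS_def comp_lists_def)
    define p where "p = (\<Prod>x\<in>set_mset M. fact (count M x) :: nat)"
    have dv: "p dvd fact r" and c: "card (permutations_of_multiset M) = fact r div p"
      using card_permutations_of_multiset[of M] by (simp_all add: sz p_def)
    have p0: "p \<noteq> 0" by (simp add: p_def)
    have "card (permutations_of_multiset M) * p = fact r" unfolding c using dv by simp
    hence "of_nat (card (permutations_of_multiset M)) * of_nat p = (fact r :: complex)" by (metis of_nat_fact of_nat_mult)
    moreover have "(\<Prod>x\<in>set_mset M. of_nat (fact (count M x))) = (of_nat p :: complex)" by (simp add: p_def)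
    moreover have "(of_nat p :: complex) \<noteq> 0" using p0 by simp
    ultimately have "of_nat (card (permutations_of_multiset M)) * h M / fact r
        = (of_nat (card (permutations_of_multiset M)) * h M) / (of_nat (card (permutations_of_multiset M)) * of_nat p)"
      and pe: "(\<Prod>x\<in>set_mset M. of_nat (fact (count M x))) = (of_nat p :: complex)" by simp_all
    moreover have "of_nat (card (permutations_of_multiset M)) \<noteq> (0 :: complex)"
      using c p0 dv by (auto dest: dvd_imp_le simp: div_eq_0_iff not_less)
    ultimately show "h M / (\<Prod>x\<in>set_mset M. of_nat (fact (count M x))) = of_nat (card (permutations_of_multiset M)) * h M / fact r"
      unfolding pe by simp
  qed
  \<comment> \<open>The orderings of a multiset are exactly the compositions lying over it, since
    length, positivity and sum depend on the multiset only.\<close>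
  also have "(\<Sum>M\<in>MS. of_nat (card (permutations_of_multiset M)) * h M) = (\<Sum>M\<in>MS. \<Sum>xs\<in>{xs\<in>comp_lists r N. mset xs = M}. h (mset xs))"
  proof (rule sum.cong[OF refl])
    fix M assume "M \<in> MS"
    then obtain ys where ys: "ys \<in> comp_lists r N" "M = mset ys" by (auto simp: MS_def)
    have "xs \<in> comp_lists r N" if "mset xs = M" for xs
      using ys that mset_eq_length[of xs ys] mset_eq_setD[of xs ys] sum_mset_sum_list[of xs] sum_mset_sum_list[of ys]
      by (simp add: comp_lists_def)
    hence "{xs\<in>comp_lists r N. mset xs = M} = permutations_of_multiset M" by (auto simp: permutations_of_multiset_def)
    thus "of_nat (card (permutations_of_multiset M)) * h M = (\<Sum>xs\<in>{xs\<in>comp_lists r N. mset xs = M}. h (mset xs))"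
      by (simp add: permutations_of_multiset_def)
  qed
  also have "\<dots> = (\<Sum>xs\<in>comp_lists r N. h (mset xs))"
    unfolding MS_def by (rule sum.image_gen[OF finite_comp_lists, symmetric])
  finally show ?thesis by (simp add: hF)
qed

section \<open>The hyperoctahedral group\<close>

definition regular_lattice :: "nat \<Rightarrow> (nat \<Rightarrow> int) set" where
  "regular_lattice r = {l\<in>nz_lattice r. regular r l}"

definition increasing_seqs :: "nat \<Rightarrow> (nat \<Rightarrow> nat) set" where
  "increasing_seqs r = {n. (\<forall>i\<ge>r. n i = 0) \<and> (\<forall>i<r. 0 < n i) \<and> (\<forall>i. Suc i < r \<longrightarrow> n i < n (Suc i))}"

lemma regular_lattice_iff:
  "l \<in> regular_lattice r \<longleftrightarrow> (\<forall>i<r. l i \<noteq> 0) \<and> (\<forall>i\<ge>r. l i = 0) \<and> inj_on (\<lambda>i. \<bar>l i\<bar>) {..<r}"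
  by (auto simp: regular_lattice_def nz_lattice_def fun_box_def regular_def)

lemma increasing_less:
  assumes "n \<in> increasing_seqs r" "i < j" "j < r" shows "n i < n j"
  using assms(2,3)
proof (induction j)
  case (Suc j)
  have "n j < n (Suc j)" using assms(1) Suc.prems by (simp add: increasing_seqs_def)
  thus ?case using Suc by (cases "i = j") auto
qed simp

lemma increasing_inj: "n \<in> increasing_seqs r \<Longrightarrow> inj_on n {..<r}"
proof (rule inj_onI, rule ccontr)
  fix i j assume "n \<in> increasing_seqs r" "i \<in> {..<r}" "j \<in> {..<r}" "n i = n j" "i \<noteq> j"
  thus False using increasing_less[of n r i j] increasing_less[of n r j i] by (cases "i < j") auto
qed

lemma increasing_unique:
  assumes n: "n \<in> increasing_seqs r" and m: "m \<in> increasing_seqs r" and eq: "n ` {..<r} = m ` {..<r}"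
  shows "n = m"
proof -
  have s: "sorted_wrt (<) (map k [0..<r])" if "k \<in> increasing_seqs r" for k
    using increasing_less[OF that] by (simp add: sorted_wrt_iff_nth_less)
  have "map n [0..<r] = map m [0..<r]"
    by (rule strict_sorted_equal[OF s[OF m] s[OF n]]) (use eq in \<open>simp add: atLeast0LessThan\<close>)
  hence e: "n i = m i" if "i < r" for i using that by simp
  show ?thesis
  proof
    fix i show "n i = m i" using e n m by (cases "i < r") (auto simp: increasing_seqs_def)
  qed
qed

definition signed_perm :: "nat \<Rightarrow> (nat \<Rightarrow> nat) \<Rightarrow> (nat \<Rightarrow> nat) \<Rightarrow> (nat \<Rightarrow> int) \<Rightarrow> nat \<Rightarrow> int" where
  "signed_perm r n \<pi> s i = (if i < r then s i * int (n (\<pi> i)) else 0)"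

text \<open>Freeness comes from distinct absolute values: their set determines the increasing
  sequence, their positions the permutation, and the nonzero coordinates the signs.\<close>

lemma bij_signed_perm:
  "bij_betw (\<lambda>(n, \<pi>, s). signed_perm r n \<pi> s)
    (increasing_seqs r \<times> {\<pi>. \<pi> permutes {..<r}} \<times> PiE {..<r} (\<lambda>_. {1, - 1})) (regular_lattice r)"
proof -
  let ?Sg = "PiE {..<r} (\<lambda>_. {1, - 1 :: int})"
  let ?X = "increasing_seqs r \<times> {\<pi>. \<pi> permutes {..<r}} \<times> ?Sg"
  have s1: "s i = 1 \<or> s i = - 1" if "s \<in> ?Sg" "i < r" for s i using PiE_mem[OF that(1), of i] that(2) by auto
  have ab: "\<bar>signed_perm r n \<pi> s i\<bar> = int (n (\<pi> i))" if "s \<in> ?Sg" "i < r" for n \<pi> s i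
    using s1[OF that] that(2) by (auto simp: signed_perm_def)
  have pr: "\<pi> i < r" if "\<pi> permutes {..<r}" "i < r" for \<pi> i using permutes_in_image[OF that(1), of i] that(2) by simp
  have "inj_on (\<lambda>(n, \<pi>, s). signed_perm r n \<pi> s) ?X"
  proof (rule inj_onI)
    fix p q assume p: "p \<in> ?X" and q: "q \<in> ?X"
      and eq: "(\<lambda>(n, \<pi>, s). signed_perm r n \<pi> s) p = (\<lambda>(n, \<pi>, s). signed_perm r n \<pi> s) q"
    obtain n \<pi> s m \<tau> t where pq: "p = (n, \<pi>, s)" "q = (m, \<tau>, t)" by (metis surj_pair)
    have n: "n \<in> increasing_seqs r" "\<pi> permutes {..<r}" "s \<in> ?Sg" and m: "m \<in> increasing_seqs r" "\<tau> permutes {..<r}" "t \<in> ?Sg"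
      using p q unfolding pq by auto
    have e: "signed_perm r n \<pi> s i = signed_perm r m \<tau> t i" for i using eq unfolding pq by simp
    have nm: "n (\<pi> i) = m (\<tau> i)" if "i < r" for i
      using ab[OF n(3) that, of n \<pi>] ab[OF m(3) that, of m \<tau>] e[of i] by simp
    have "n ` {..<r} = (\<lambda>i. n (\<pi> i)) ` {..<r}" using permutes_image[OF n(2)] by (metis image_image)
    also have "\<dots> = (\<lambda>i. m (\<tau> i)) ` {..<r}" using nm by (intro image_cong) auto
    also have "\<dots> = m ` {..<r}" using permutes_image[OF m(2)] by (metis image_image)
    finally have "n = m" by (rule increasing_unique[OF n(1) m(1)])
    moreover have "\<pi> i = \<tau> i" for i
    proof (cases "i < r")
      case True
      thus ?thesis using nm[OF True] inj_onD[OF increasing_inj[OF n(1)], of "\<pi> i" "\<tau> i"] pr[OF n(2) True] pr[OF m(2) True] \<open>n = m\<close> by simp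
    next
      case False
      thus ?thesis using permutes_not_in[OF n(2), of i] permutes_not_in[OF m(2), of i] by simp
    qed
    hence "\<pi> = \<tau>" by blast
    moreover have "s = t"
    proof (rule PiE_ext[OF n(3) m(3)])
      fix i assume "i \<in> {..<r}"
      hence i: "i < r" by simp
      have "n (\<pi> i) > 0" using n(1) pr[OF n(2) i] by (simp add: increasing_seqs_def)
      thus "s i = t i" using e[of i] i nm[OF i] by (simp add: signed_perm_def)
    qed
    ultimately show "p = q" by (simp add: pq)
  qed
  moreover have "(\<lambda>(n, \<pi>, s). signed_perm r n \<pi> s) ` ?X = regular_lattice r"
  proof (intro subset_antisym image_subsetI subsetI)
    fix p assume p: "p \<in> ?X"
    obtain n \<pi> s where pq: "p = (n, \<pi>, s)" by (metis surj_pair)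
    have n: "n \<in> increasing_seqs r" "\<pi> permutes {..<r}" "s \<in> ?Sg" using p unfolding pq by auto
    have "signed_perm r n \<pi> s \<in> regular_lattice r"
      unfolding regular_lattice_iff
    proof (intro conjI allI impI)
      fix i assume i: "i < r"
      have "n (\<pi> i) > 0" using n(1) pr[OF n(2) i] by (simp add: increasing_seqs_def)
      thus "signed_perm r n \<pi> s i \<noteq> 0" using s1[OF n(3) i] i by (auto simp: signed_perm_def)
    next
      show "inj_on (\<lambda>i. \<bar>signed_perm r n \<pi> s i\<bar>) {..<r}"
      proof (rule inj_onI)
        fix i j assume i: "i \<in> {..<r}" "j \<in> {..<r}" and eq: "\<bar>signed_perm r n \<pi> s i\<bar> = \<bar>signed_perm r n \<pi> s j\<bar>"
        have "n (\<pi> i) = n (\<pi> j)" using eq ab[OF n(3)] i by simp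
        hence "\<pi> i = \<pi> j" using inj_onD[OF increasing_inj[OF n(1)], of "\<pi> i" "\<pi> j"] pr[OF n(2)] i by simp
        thus "i = j" using permutes_inj[OF n(2)] by (simp add: inj_eq)
      qed
    qed (simp add: signed_perm_def)
    thus "(\<lambda>(n, \<pi>, s). signed_perm r n \<pi> s) p \<in> regular_lattice r" unfolding pq by simp
  next
    fix l assume l: "l \<in> regular_lattice r"
    have l0: "\<And>i. i < r \<Longrightarrow> l i \<noteq> 0" "\<And>i. \<not> i < r \<Longrightarrow> l i = 0" and inj: "inj_on (\<lambda>i. \<bar>l i\<bar>) {..<r}"
      using l by (auto simp: regular_lattice_iff)
    define f where "f i = nat \<bar>l i\<bar>" for i
    have injf: "inj_on f {..<r}" using inj by (auto simp: inj_on_def f_def)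
    define A where "A = f ` {..<r}"
    have cA: "card A = r" unfolding A_def using card_image[OF injf] by simp
    define xs where "xs = sorted_list_of_set A"
    have xs: "length xs = r" "sorted_wrt (<) xs" "distinct xs" "set xs = A"
      using cA by (simp_all add: xs_def A_def strict_sorted_list_of_set)
    define n where "n i = (if i < r then xs ! i else 0)" for i
    have pos: "0 < xs ! i" if "i < r" for i
    proof -
      have "xs ! i \<in> A" using that xs nth_mem[of i xs] by simp
      then obtain j where "j < r" "xs ! i = f j" by (auto simp: A_def)
      thus ?thesis using l0(1)[of j] by (simp add: f_def)
    qed
    have n: "n \<in> increasing_seqs r"
      using pos sorted_wrt_nth_less[OF xs(2)] xs(1) by (auto simp: increasing_seqs_def n_def)
    have bf: "bij_betw f {..<r} A" unfolding A_def by (rule inj_on_imp_bij_betw[OF injf])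
    have bx: "bij_betw ((!) xs) {..<r} A" by (rule bij_betw_nth) (use xs in auto)
    \<comment> \<open>The position of the absolute value of \<open>l i\<close> in the sorted list of
      all absolute values, extended by the identity.\<close>
    define \<pi> where "\<pi> i = (if i < r then the_inv_into {..<r} ((!) xs) (f i) else i)" for i
    have p\<pi>: "\<pi> permutes {..<r}"
    proof (rule bij_imp_permutes)
      have "bij_betw (the_inv_into {..<r} ((!) xs) \<circ> f) {..<r} {..<r}"
        by (rule bij_betw_trans[OF bf bij_betw_the_inv_into[OF bx]])
      thus "bij_betw \<pi> {..<r} {..<r}" by (rule bij_betw_cong[THEN iffD1, rotated]) (simp add: \<pi>_def)
    qed (simp add: \<pi>_def)
    have x\<pi>: "xs ! (\<pi> i) = f i" if i: "i < r" for i
    proof -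
      have "f i \<in> (!) xs ` {..<r}" using bij_betw_imp_surj_on[OF bx] i by (simp add: A_def)
      thus ?thesis using f_the_inv_into_f[OF bij_betw_imp_inj_on[OF bx], of "f i"] i by (simp add: \<pi>_def)
    qed
    define s where "s = restrict (\<lambda>i. sgn (l i)) {..<r}"
    have s: "s \<in> ?Sg" using l0(1) by (auto simp: s_def sgn_if)
    have "signed_perm r n \<pi> s = l"
    proof
      fix i
      show "signed_perm r n \<pi> s i = l i"
      proof (cases "i < r")
        case True
        thus ?thesis using pr[OF p\<pi> True] x\<pi>[OF True] by (simp add: signed_perm_def n_def s_def f_def sgn_mult_abs)
      next
        case False
        thus ?thesis using l0(2)[OF False] by (simp add: signed_perm_def)
      qed
    qed
    moreover have "(n, \<pi>, s) \<in> ?X" using n p\<pi> s by simp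
    ultimately show "l \<in> (\<lambda>(n, \<pi>, s). signed_perm r n \<pi> s) ` ?X" by (auto intro!: image_eqI[of _ _ "(n, \<pi>, s)"])
  qed
  ultimately show ?thesis by (simp add: bij_betw_def)
qed

section \<open>Averaging lattice sums over signed permutations\<close>

lemma finite_comps: "finite (comps r N)"
proof (rule finite_subset)
  show "comps r N \<subseteq> {a. \<forall>i. (i \<in> {..<r} \<longrightarrow> a i \<in> {..N}) \<and> (i \<notin> {..<r} \<longrightarrow> a i = 0)}"
    using member_le_sum[of _ "{..<r}"] by (auto simp: comps_def)
qed (rule finite_set_of_finite_funs, auto)

lemma comps_permute:
  assumes "\<pi> permutes {..<r}" "a \<in> comps r N" shows "a \<circ> \<pi> \<in> comps r N"
proof -
  have p: "\<pi> i < r \<longleftrightarrow> i < r" for i using permutes_in_image[OF assms(1), of i] by simp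
  have "(\<Sum>i<r. (a \<circ> \<pi>) i) = N" using assms(2) sum.permute[OF assms(1), of a] by (simp add: comps_def)
  thus ?thesis using assms(2) p by (auto simp: comps_def not_less[symmetric])
qed

lemma regular_lattice_permute:
  assumes "\<pi> permutes {..<r}" "l \<in> regular_lattice r" shows "l \<circ> \<pi> \<in> regular_lattice r"
proof -
  have p: "\<pi> i < r \<longleftrightarrow> i < r" for i using permutes_in_image[OF assms(1), of i] by simp
  have "inj_on ((\<lambda>i. \<bar>l i\<bar>) \<circ> \<pi>) {..<r}"
    using assms(2) permutes_image[OF assms(1)] permutes_inj_on[OF assms(1)]
    by (intro comp_inj_on) (auto simp: regular_lattice_iff)
  thus ?thesis using assms(2) p by (auto simp: regular_lattice_iff not_less[symmetric] o_def)
qed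

text \<open>Permuting exponents is undone by permuting the coordinates of the lattice points, and
  regularity is symmetric. Lattice sums therefore depend only on the multiset of exponents.\<close>

lemma infsum_lwt_permute:
  assumes \<pi>: "\<pi> permutes {..<r}"
  shows "infsum (lwt r (k \<circ> \<pi>)) (regular_lattice r) = infsum (lwt r k) (regular_lattice r)"
proof -
  have inv: "inv \<pi> permutes {..<r}" by (rule permutes_inv[OF \<pi>])
  have bij: "bij_betw (\<lambda>l. l \<circ> \<pi>) (regular_lattice r) (regular_lattice r)"
    by (rule bij_betw_byWitness[where f' = "\<lambda>l. l \<circ> inv \<pi>"])
       (auto simp: o_assoc[symmetric] permutes_inv_o[OF \<pi>] regular_lattice_permute \<pi> inv)
  have "lwt r (k \<circ> \<pi>) (l \<circ> \<pi>) = lwt r k l" for l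
    unfolding lwt_def using prod.permute[OF \<pi>, of "\<lambda>i. 1 / (of_int (l i) :: complex) ^ k i"] by (simp add: o_def)
  thus ?thesis using infsum_reindex_bij_betw[OF bij, of "lwt r (k \<circ> \<pi>)"] by simp
qed

lemma sum_comp_lists:
  "(\<Sum>xs\<in>comp_lists r N. G (\<lambda>i. if i < r then xs ! i else 0)) = (\<Sum>a\<in>comps r N. G a :: 'b :: comm_monoid_add)"
proof (rule sum.reindex_bij_witness[of _ "\<lambda>a. map a [0..<r]" "\<lambda>xs i. if i < r then xs ! i else 0"])
  fix xs assume xs: "xs \<in> comp_lists r N"
  show "map (\<lambda>i. if i < r then xs ! i else 0) [0..<r] = xs"
    using xs by (intro nth_equalityI) (auto simp: comp_lists_def)
  have "(\<Sum>i<r. xs ! i) = N" using xs by (auto simp: comp_lists_def sum_list_sum_nth atLeast0LessThan)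
  thus "(\<lambda>i. if i < r then xs ! i else 0) \<in> comps r N" using xs by (auto simp: comps_def comp_lists_def)
next
  fix a assume a: "a \<in> comps r N"
  show "(\<lambda>i. if i < r then map a [0..<r] ! i else 0) = a" using a by (auto simp: comps_def fun_eq_iff)
  show "map a [0..<r] \<in> comp_lists r N"
    using a by (auto simp: comps_def comp_lists_def interv_sum_list_conv_sum_set_nat atLeast0LessThan)
qed simp

text \<open>Each increasing sequence stands for an orbit of \<open>2 ^ r * fact r\<close> regular
  points, and on an orbit the weight summed over all compositions is constant.\<close>

lemma lattice_sum_comps:
  assumes d: "1 \<le> d" and sm: "\<And>k. (\<And>i. i < r \<Longrightarrow> even (k i) \<and> 2 \<le> k i) \<Longrightarrow> lwt r k summable_on regular_lattice r"
  shows "(\<Sum>a\<in>comps r N. infsum (lwt r (\<lambda>i. 2 * d * a i)) (regular_lattice r))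
    = 2 ^ r * fact r * of_real (\<Sum>a\<in>comps r N. EZ_zeta r (\<lambda>i. 2 * d * a i))"
proof -
  define w where "w a = lwt r (\<lambda>i. 2 * d * a i)" for a
  define W where "W l = (\<Sum>a\<in>comps r N. w a l)" for l
  let ?G = "{\<pi>. \<pi> permutes {..<r}} \<times> PiE {..<r} (\<lambda>_. {1, - 1 :: int})"
  have wsm: "w a summable_on regular_lattice r" if "a \<in> comps r N" for a
    unfolding w_def using that d by (intro sm) (auto simp: comps_def)
  have "((\<lambda>l. \<Sum>a\<in>comps r N. w a l) has_sum (\<Sum>a\<in>comps r N. infsum (w a) (regular_lattice r))) (regular_lattice r)"
    by (intro has_sum_finite_sum finite_comps has_sum_infsum wsm)
  hence hW: "(W has_sum (\<Sum>a\<in>comps r N. infsum (w a) (regular_lattice r))) (regular_lattice r)"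
    by (simp only: W_def[abs_def])
  \<comment> \<open>Even exponents remove the signs, and the permutation is moved onto the
    composition, where the sum over all compositions absorbs it.\<close>
  have Winv: "W (signed_perm r n \<pi> s) = W (int \<circ> n)" if \<pi>: "\<pi> permutes {..<r}" and s: "s \<in> PiE {..<r} (\<lambda>_. {1, - 1 :: int})" for n \<pi> s
  proof -
    have "w a (signed_perm r n \<pi> s) = w (a \<circ> inv \<pi>) (int \<circ> n)" for a
    proof -
      have "w a (signed_perm r n \<pi> s) = (\<Prod>i<r. 1 / of_nat (n (\<pi> i)) ^ (2 * d * a i))"
        unfolding w_def lwt_def
      proof (intro prod.cong refl)
        fix i assume i: "i \<in> {..<r}"
        have "s i = 1 \<or> s i = - 1" using PiE_mem[OF s i] by auto
        hence "(of_int (s i) :: complex) ^ (2 * d * a i) = 1" by auto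
        thus "1 / (of_int (signed_perm r n \<pi> s i) :: complex) ^ (2 * d * a i) = 1 / of_nat (n (\<pi> i)) ^ (2 * d * a i)"
          using i by (simp add: signed_perm_def power_mult_distrib)
      qed
      also have "\<dots> = (\<Prod>i<r. 1 / of_nat (n i) ^ (2 * d * (a \<circ> inv \<pi>) i))"
        using prod.permute[OF \<pi>, of "\<lambda>i. 1 / (of_nat (n i) :: complex) ^ (2 * d * (a \<circ> inv \<pi>) i)"]
        by (simp add: o_def permutes_inverses[OF \<pi>])
      finally show ?thesis by (simp add: w_def lwt_def)
    qed
    hence "W (signed_perm r n \<pi> s) = (\<Sum>a\<in>comps r N. w (a \<circ> inv \<pi>) (int \<circ> n))" by (simp add: W_def)
    also have "\<dots> = W (int \<circ> n)"
      unfolding W_def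
      by (rule sum.reindex_bij_witness[of _ "\<lambda>a. a \<circ> \<pi>" "\<lambda>a. a \<circ> inv \<pi>"])
         (auto simp: o_assoc[symmetric] permutes_inv_o[OF \<pi>] comps_permute \<pi> permutes_inv[OF \<pi>])
    finally show ?thesis .
  qed
  have "((\<lambda>(n, \<pi>, s). W (signed_perm r n \<pi> s)) has_sum (\<Sum>a\<in>comps r N. infsum (w a) (regular_lattice r))) (increasing_seqs r \<times> ?G)"
    using hW unfolding has_sum_reindex_bij_betw[OF bij_signed_perm, where f = W, symmetric] by (simp only: case_prod_unfold)
  hence h2: "((\<lambda>(n, g). W (int \<circ> n)) has_sum (\<Sum>a\<in>comps r N. infsum (w a) (regular_lattice r))) (increasing_seqs r \<times> ?G)"
    by (rule has_sum_cong[THEN iffD1, rotated]) (use Winv in auto)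
  have cG: "card ?G = fact r * 2 ^ r"
    using card_permutations[of "{..<r}" r] by (simp add: card_cartesian_product card_PiE numeral_2_eq_2)
  have finG: "finite ?G" by (intro finite_cartesian_product finite_permutations finite_PiE) auto
  have h3: "((\<lambda>n. of_nat (card ?G) * W (int \<circ> n)) has_sum (\<Sum>a\<in>comps r N. infsum (w a) (regular_lattice r))) (increasing_seqs r)"
  proof (rule has_sum_Sigma'[OF h2])
    fix n
    show "((\<lambda>g. case (n, g) of (n, g) \<Rightarrow> W (int \<circ> n)) has_sum of_nat (card ?G) * W (int \<circ> n)) ?G"
      using finG by (intro has_sum_finiteI) simp_all
  qed
  \<comment> \<open>\<open>EZ_zeta\<close> is an \<open>infsum\<close>, which is 0 for a divergent
    family; convergence is inherited from the lattice sum by restriction to increasing positive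
    points.\<close>
  have EZ: "((\<lambda>n. w a (int \<circ> n)) has_sum of_real (EZ_zeta r (\<lambda>i. 2 * d * a i))) (increasing_seqs r)" if a: "a \<in> comps r N" for a
  proof -
    have inj: "inj_on (\<lambda>n. int \<circ> n) (increasing_seqs r)" by (rule inj_onI) (simp add: fun_eq_iff)
    have "int \<circ> n \<in> regular_lattice r" if n: "n \<in> increasing_seqs r" for n
      using increasing_inj[OF n] n by (simp add: regular_lattice_iff increasing_seqs_def inj_on_def)
    hence "(\<lambda>n. int \<circ> n) ` increasing_seqs r \<subseteq> regular_lattice r" by blast
    hence "w a summable_on (\<lambda>n. int \<circ> n) ` increasing_seqs r" by (rule summable_on_subset[OF wsm[OF a]])
    hence "(\<lambda>n. w a (int \<circ> n)) summable_on increasing_seqs r"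
      using summable_on_reindex[OF inj, of "w a"] by (simp add: o_def)
    moreover have eq: "w a (int \<circ> n) = of_real (\<Prod>i<r. 1 / real (n i) ^ (2 * d * a i))" for n
      by (simp add: w_def lwt_def)
    ultimately have cs: "(\<lambda>n. complex_of_real (\<Prod>i<r. 1 / real (n i) ^ (2 * d * a i))) summable_on increasing_seqs r" by simp
    have "(\<lambda>n. Re (complex_of_real (\<Prod>i<r. 1 / real (n i) ^ (2 * d * a i)))) summable_on increasing_seqs r"
      by (rule summable_on_Re[OF cs])
    hence "(\<lambda>n. \<Prod>i<r. 1 / real (n i) ^ (2 * d * a i)) summable_on increasing_seqs r" by (simp only: Re_complex_of_real)
    hence "((\<lambda>n. \<Prod>i<r. 1 / real (n i) ^ (2 * d * a i)) has_sum EZ_zeta r (\<lambda>i. 2 * d * a i)) (increasing_seqs r)"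
      unfolding EZ_zeta_def increasing_seqs_def[symmetric] by (rule has_sum_infsum)
    from has_sum_of_real[OF this, where 'a = complex] show ?thesis unfolding eq .
  qed
  have "((\<lambda>n. \<Sum>a\<in>comps r N. w a (int \<circ> n)) has_sum (\<Sum>a\<in>comps r N. of_real (EZ_zeta r (\<lambda>i. 2 * d * a i)))) (increasing_seqs r)"
    by (intro has_sum_finite_sum finite_comps EZ)
  hence "((\<lambda>n. of_nat (card ?G) * W (int \<circ> n)) has_sum of_nat (card ?G) * (\<Sum>a\<in>comps r N. of_real (EZ_zeta r (\<lambda>i. 2 * d * a i)))) (increasing_seqs r)"
    unfolding W_def by (rule has_sum_cmult_right)
  from has_sum_unique[OF h3 this] show ?thesis unfolding cG w_def by (simp add: mult.commute)
qed

context type_C_data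
begin

text \<open>Only signs and the rational numbers \<open>bernc\<close> enter the coefficients, so all
  powers of pi sit in the explicit factor of the lattice sum.\<close>

lemma genF_coeff_Rats: "genF_coeff k \<in> \<rat>"
proof -
  have "blocks_coeff B k \<in> \<rat>" if B: "nbc r nus B" for B
  proof -
    have "blk_coeff b k \<in> \<rat>" for b
      using bernc_Rats by (auto simp: blk_coeff_def intro!: Rats_mult Rats_power)
    moreover have "complex_of_real (\<sigma> B i) \<in> \<rat>" if "i \<in> J B" for i
      using sigma_unit(1)[OF B, of i] that by (auto simp: J_def)
    ultimately show ?thesis unfolding blocks_coeff_def by (auto intro!: Rats_mult Rats_prod Rats_power)
  qed
  thus ?thesis unfolding genF_coeff_def by (auto intro!: Rats_sum Rats_mult Rats_power)
qed

lemma infsum_lwt: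
  assumes "distinct nus" "\<And>i. i < r \<Longrightarrow> even (k i) \<and> 2 \<le> k i"
  shows "lwt r k summable_on regular_lattice r"
    and "infsum (lwt r k) (regular_lattice r) = (- 1) ^ r * (genF_coeff k * (2 * pi * \<i>) ^ (\<Sum>i<r. k i))"
proof -
  have hs: "(lwt r k has_sum ((- 1) ^ r * (genF_coeff k * (2 * pi * \<i>) ^ (\<Sum>i<r. k i)))) (regular_lattice r)"
    unfolding regular_lattice_def by (rule genF_coeff_lattice_sum) (use assms in auto)
  show "lwt r k summable_on regular_lattice r" by (rule has_sum_imp_summable[OF hs])
  show "infsum (lwt r k) (regular_lattice r) = (- 1) ^ r * (genF_coeff k * (2 * pi * \<i>) ^ (\<Sum>i<r. k i))"
    by (rule infsumI[OF hs])
qed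

text \<open>The tuple is attached in reverse order: entry \<open>\<rho>\<close> belongs to
  coordinate \<open>r - 1 - \<rho>\<close>, hence the index \<open>r - Suc i\<close>.\<close>

lemma attach_long_lr:
  assumes "i < r" shows "attach_long r x (lr i) = x ! (r - Suc i)"
proof -
  have "lr (r - 1 - \<rho>) = lr i \<longleftrightarrow> \<rho> = r - Suc i" if "\<rho> < r" for \<rho>
    using that assms inj_lr by (auto simp: inj_eq)
  hence 1: "\<rho> < r \<and> lr i = (\<lambda>k. 2 * ev (r - 1 - \<rho>) k) \<longleftrightarrow> \<rho> = r - Suc i" for \<rho>
    using assms unfolding lr_def[symmetric, of "r - 1 - \<rho>"] by (metis diff_less zero_less_Suc less_nat_zero_code not_gr_zero)
  have "\<exists>\<rho><r. lr i = (\<lambda>k. 2 * ev (r - 1 - \<rho>) k)" using 1[of "r - Suc i"] by blast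
  thus ?thesis unfolding attach_long_def 1 by simp
qed

lemma attach_long_0: "\<alpha> \<notin> lr ` {..<r} \<Longrightarrow> attach_long r x \<alpha> = 0"
  by (auto simp: attach_long_def lr_def)

text \<open>The factorials of the Taylor normalisation cancel those of the formula. What is left is
  a regular lattice sum with the exponents in reversed order.\<close>

lemma coefP_attach_long:
  assumes dist: "distinct nus" and len: "length x = r" and x: "\<And>n. n \<in> set x \<Longrightarrow> even n \<and> 2 \<le> n"
  shows "coefP r \<phi> nus (\<lambda>_. 0) (attach_long r x) * (\<Prod>\<rho><r. (2 * of_real pi * \<i>) ^ (x ! \<rho>) / of_nat (fact (x ! \<rho>)))
    = (- 1) ^ r * infsum (lwt r (\<lambda>i. rev x ! i)) (regular_lattice r)"
proof -
  define k where "k i = (if i < r then rev x ! i else 0)" for i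
  have kx: "k i = x ! (r - Suc i)" if "i < r" for i using that len by (simp add: k_def rev_nth)
  have ek: "even (k i) \<and> 2 \<le> k i" if "i < r" for i
    unfolding kx[OF that] using x nth_mem[of "r - Suc i" x] that len by auto
  have "coefP r \<phi> nus (\<lambda>_. 0) (attach_long r x)
     = genF_coeff (\<lambda>i. if i < r then attach_long r x (lr i) else 0) * (\<Prod>i<r. of_nat (fact (attach_long r x (lr i))))"
    by (rule coefP_eq) (rule attach_long_0)
  also have "(\<lambda>i. if i < r then attach_long r x (lr i) else 0) = k"
    by (rule ext) (simp add: attach_long_lr kx, simp add: k_def)
  also have "(\<Prod>i<r. of_nat (fact (attach_long r x (lr i)))) = (\<Prod>i<r. of_nat (fact (k i)) :: complex)"
    by (intro prod.cong refl) (simp add: attach_long_lr kx)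
  finally have c: "coefP r \<phi> nus (\<lambda>_. 0) (attach_long r x) = genF_coeff k * (\<Prod>i<r. of_nat (fact (k i)))" .
  have "(\<Prod>\<rho><r. (2 * of_real pi * \<i>) ^ (x ! \<rho>) / of_nat (fact (x ! \<rho>)) :: complex)
     = (\<Prod>i<r. (2 * of_real pi * \<i>) ^ (x ! (r - Suc i)) / of_nat (fact (x ! (r - Suc i))))"
    by (rule prod.nat_diff_reindex[symmetric])
  also have "\<dots> = (\<Prod>i<r. (2 * of_real pi * \<i>) ^ k i / of_nat (fact (k i)))"
    by (intro prod.cong refl) (simp add: kx)
  also have "\<dots> = (2 * of_real pi * \<i>) ^ (\<Sum>i<r. k i) / (\<Prod>i<r. of_nat (fact (k i)))"
    unfolding prod_dividef power_sum ..
  finally have p: "(\<Prod>\<rho><r. (2 * of_real pi * \<i>) ^ (x ! \<rho>) / of_nat (fact (x ! \<rho>)) :: complex)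
     = (2 * of_real pi * \<i>) ^ (\<Sum>i<r. k i) / (\<Prod>i<r. of_nat (fact (k i)))" .
  have "lwt r (\<lambda>i. rev x ! i) = lwt r k"
    by (rule ext) (simp add: lwt_def k_def)
  hence i: "infsum (lwt r (\<lambda>i. rev x ! i)) (regular_lattice r) = (- 1) ^ r * (genF_coeff k * (2 * pi * \<i>) ^ (\<Sum>i<r. k i))"
    using infsum_lwt(2)[OF dist ek] by simp
  have f0: "(\<Prod>i<r. of_nat (fact (k i))) \<noteq> (0 :: complex)" by simp
  have m1: "(- 1 :: complex) ^ r * ((- 1) ^ r * z) = z" for z by (cases "even r") auto
  show ?thesis unfolding c p i m1 using f0 by simp
qed

end

lemma of_real_of_rat: "complex_of_real (of_rat q) = of_rat q"
  by (cases q) (simp add: of_rat_rat)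

lemma infsum_lwt_mset:
  assumes "mset xs = mset ys" "length xs = r"
  shows "infsum (lwt r ((!) xs)) (regular_lattice r) = infsum (lwt r ((!) ys)) (regular_lattice r)"
proof -
  obtain p where p: "p permutes {..<length ys}" "permute_list p ys = xs"
    using mset_eq_permutation[OF assms(1)] by blast
  have l: "length ys = r" using assms mset_eq_length by metis
  have "lwt r ((!) xs) = lwt r ((!) ys \<circ> p)"
    using p l by (auto simp: lwt_def fun_eq_iff permute_list_nth)
  thus ?thesis using infsum_lwt_permute[of p r "(!) ys"] p l by simp
qed

theorem theorem7p1:
  fixes r d N :: nat and \<phi> :: "nat \<Rightarrow> real" and nus :: "(nat \<Rightarrow> real) list"
  assumes "1 \<le> r" and "1 \<le> d" and "r \<le> N"
    and "\<phi> \<in> Vsp r"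
    and "\<forall>V\<in>bases_C r. \<forall>\<beta>\<in>V. ipr r \<phi> (mu r V \<beta>) \<noteq> 0"
    and "distinct nus" and "set nus = posroots_C r - long_posroots_C r"
  shows "complex_of_real (\<Sum>a\<in>comps r N. EZ_zeta r (\<lambda>i. 2 * d * a i))
           = (-1) ^ r / 2 ^ r *
             (\<Sum>J\<in>Pr r. 1 / (\<Prod>j\<leftarrow>J. of_nat (fact j)) *
                (\<Sum>x\<in>Ar d N J. coefP r \<phi> nus (\<lambda>_. 0) (attach_long r x) *
                   (\<Prod>\<rho><r. (2 * of_real pi * \<i>) ^ (x ! \<rho>) / of_nat (fact (x ! \<rho>)))))
         \<and> (\<exists>q::rat. (\<Sum>a\<in>comps r N. EZ_zeta r (\<lambda>i. 2 * d * a i)) = of_rat q * pi ^ (2 * d * N))"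
proof -
  have nus: "set nus = short_roots r" using assms(7) by (simp add: short_roots_eq)
  \<comment> \<open>The choice of one signed partition per \<open>B\<close> that the locale takes as
    a parameter.\<close>
  have "\<forall>B. \<exists>p e. nbc r nus B \<longrightarrow> represents r p e B" using nbc_represents[OF _ nus] by blast
  then obtain P E where rep: "\<And>B. nbc r nus B \<Longrightarrow> represents r (P B) (E B) B" by metis
  interpret type_C_data r \<phi> nus P E
    by unfold_locales (use nus assms(5) rep in blast)+
  define S where "S = (\<Sum>a\<in>comps r N. EZ_zeta r (\<lambda>i. 2 * d * a i))"
  \<comment> \<open>The default 0 at other lengths makes invariance under reordering hold for all
    lists, as \<open>sum_Pr_Ar\<close> asks.\<close>
  define F where "F x = (if length x = r then infsum (lwt r ((!) x)) (regular_lattice r) else 0)" for x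
  have Finv: "F xs = F ys" if "mset xs = mset ys" for xs ys
    using infsum_lwt_mset[OF that, of r] mset_eq_length[OF that] by (simp add: F_def)
  have Ar: "length x = r \<and> (\<forall>n\<in>set x. even n \<and> 2 \<le> n)" if J: "J \<in> Pr r" and x: "x \<in> Ar d N J" for J x
  proof -
    obtain hs where hs: "x = map (times (2 * d)) (blow_up J hs)" "length hs = length J" "\<forall>h\<in>set hs. 0 < h"
      using x blow_up_scale[of J _ "2 * d"] unfolding Ar_def by (auto simp only: mem_Collect_eq)
    have "length x = r" using hs J length_blow_up[of J hs] unfolding hs(1) by (simp add: Pr_def)
    moreover have pos: "\<forall>h\<in>set (blow_up J hs). 0 < h" using hs J set_blow_up[of J hs] unfolding Pr_def by simp
    have "even n \<and> 2 \<le> n" if n: "n \<in> set x" for n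
    proof -
      obtain h where h: "n = 2 * d * h" "h \<in> set (blow_up J hs)"
        using n unfolding hs(1) set_map by (rule imageE)
      have "0 < d * h" using bspec[OF pos h(2)] assms(2) by (intro mult_pos_pos) linarith+
      thus ?thesis unfolding h(1) mult.assoc by (intro conjI dvd_triv_left) linarith
    qed
    ultimately show ?thesis by blast
  qed
  have Sval: "(\<Sum>a\<in>comps r N. infsum (lwt r (\<lambda>i. 2 * d * a i)) (regular_lattice r)) = 2 ^ r * fact r * of_real S"
    unfolding S_def by (rule lattice_sum_comps[OF assms(2) infsum_lwt(1)[OF assms(6)]])
  have "(\<Sum>J\<in>Pr r. 1 / (\<Prod>j\<leftarrow>J. of_nat (fact j)) *
                (\<Sum>x\<in>Ar d N J. coefP r \<phi> nus (\<lambda>_. 0) (attach_long r x) *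
                   (\<Prod>\<rho><r. (2 * of_real pi * \<i>) ^ (x ! \<rho>) / of_nat (fact (x ! \<rho>)))))
     = (\<Sum>J\<in>Pr r. 1 / (\<Prod>j\<leftarrow>J. of_nat (fact j)) * (\<Sum>x\<in>Ar d N J. (- 1) ^ r * F x))"
  proof (rule sum.cong[OF refl])
    fix J assume J: "J \<in> Pr r"
    have "(\<Sum>x\<in>Ar d N J. coefP r \<phi> nus (\<lambda>_. 0) (attach_long r x) *
        (\<Prod>\<rho><r. (2 * of_real pi * \<i>) ^ (x ! \<rho>) / of_nat (fact (x ! \<rho>)))) = (\<Sum>x\<in>Ar d N J. (- 1) ^ r * F x)"
    proof (rule sum.cong[OF refl])
      fix x assume x: "x \<in> Ar d N J"
      have l: "length x = r" and ev: "\<And>n. n \<in> set x \<Longrightarrow> even n \<and> 2 \<le> n" using Ar[OF J x] by blast+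
      \<comment> \<open>The reversed attachment of the tuple is harmless because \<open>F\<close> is
        symmetric.\<close>
      have "F (rev x) = F x" by (rule Finv) simp
      thus "coefP r \<phi> nus (\<lambda>_. 0) (attach_long r x) * (\<Prod>\<rho><r. (2 * of_real pi * \<i>) ^ (x ! \<rho>) / of_nat (fact (x ! \<rho>))) = (- 1) ^ r * F x"
        using coefP_attach_long[OF assms(6) l ev] l by (simp add: F_def)
    qed
    thus "1 / (\<Prod>j\<leftarrow>J. of_nat (fact j)) * (\<Sum>x\<in>Ar d N J. coefP r \<phi> nus (\<lambda>_. 0) (attach_long r x) *
        (\<Prod>\<rho><r. (2 * of_real pi * \<i>) ^ (x ! \<rho>) / of_nat (fact (x ! \<rho>))))
      = 1 / (\<Prod>j\<leftarrow>J. of_nat (fact j)) * (\<Sum>x\<in>Ar d N J. (- 1) ^ r * F x)" by (simp only:)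
  qed
  also have "\<dots> = (- 1) ^ r * (\<Sum>J\<in>Pr r. 1 / (\<Prod>j\<leftarrow>J. of_nat (fact j)) * (\<Sum>x\<in>Ar d N J. F x))"
    unfolding sum_distrib_left by (intro sum.cong refl) (simp add: mult_ac)
  also have "\<dots> = (- 1) ^ r * ((\<Sum>xs\<in>comp_lists r N. F (map (times (2 * d)) xs)) / fact r)"
    by (subst sum_Pr_Ar[OF assms(1,2) Finv]) auto
  also have "(\<Sum>xs\<in>comp_lists r N. F (map (times (2 * d)) xs))
     = (\<Sum>xs\<in>comp_lists r N. infsum (lwt r (\<lambda>i. 2 * d * (if i < r then xs ! i else 0))) (regular_lattice r))"
  proof (rule sum.cong[OF refl])
    fix xs assume "xs \<in> comp_lists r N"
    hence l: "length xs = r" by (simp add: comp_lists_def)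
    have "lwt r ((!) (map (times (2 * d)) xs)) = lwt r (\<lambda>i. 2 * d * (if i < r then xs ! i else 0))"
      using l by (auto simp: lwt_def fun_eq_iff)
    thus "F (map (times (2 * d)) xs) = infsum (lwt r (\<lambda>i. 2 * d * (if i < r then xs ! i else 0))) (regular_lattice r)"
      using l by (simp add: F_def)
  qed
  also have "\<dots> = 2 ^ r * fact r * of_real S"
    unfolding Sval[symmetric] by (rule sum_comp_lists[where G = "\<lambda>a. infsum (lwt r (\<lambda>i. 2 * d * a i)) (regular_lattice r)"])
  finally have main: "(\<Sum>J\<in>Pr r. 1 / (\<Prod>j\<leftarrow>J. of_nat (fact j)) *
                (\<Sum>x\<in>Ar d N J. coefP r \<phi> nus (\<lambda>_. 0) (attach_long r x) *
                   (\<Prod>\<rho><r. (2 * of_real pi * \<i>) ^ (x ! \<rho>) / of_nat (fact (x ! \<rho>)))))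
     = (- 1) ^ r * (2 ^ r * of_real S)" by simp
  have m1: "(- 1 :: complex) ^ r * (- 1) ^ r = 1" by (cases "even r") auto
  have part1: "complex_of_real S = (-1) ^ r / 2 ^ r * ((- 1) ^ r * (2 ^ r * of_real S))"
  proof -
    have "(-1) ^ r / 2 ^ r * ((- 1) ^ r * (2 ^ r * complex_of_real S)) = ((- 1) ^ r * (- 1) ^ r) * (2 ^ r / 2 ^ r) * of_real S"
      by (simp only: times_divide_eq_left times_divide_eq_right mult_ac)
    thus ?thesis unfolding m1 by simp
  qed
  \<comment> \<open>For rationality the lattice sums are replaced by coefficients: all compositions
    have total exponent \<open>2 * d * N\<close>, so the same power of 2 pi i comes out of each
    summand.\<close>
  have "2 ^ r * fact r * complex_of_real S = (\<Sum>a\<in>comps r N. (- 1) ^ r * (genF_coeff (\<lambda>i. 2 * d * a i) * (2 * pi * \<i>) ^ (2 * d * N)))"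
    unfolding Sval[symmetric]
  proof (rule sum.cong[OF refl])
    fix a assume a: "a \<in> comps r N"
    have "even (2 * d * a i) \<and> 2 \<le> 2 * d * a i" if "i < r" for i
      using a that assms(2) by (auto simp: comps_def)
    moreover have "(\<Sum>i<r. 2 * d * a i) = 2 * d * N"
      using a by (simp add: comps_def flip: sum_distrib_left)
    ultimately show "infsum (lwt r (\<lambda>i. 2 * d * a i)) (regular_lattice r) = (- 1) ^ r * (genF_coeff (\<lambda>i. 2 * d * a i) * (2 * pi * \<i>) ^ (2 * d * N))"
      using infsum_lwt(2)[OF assms(6), of "\<lambda>i. 2 * d * a i"] by simp
  qed
  also have "\<dots> = (\<Sum>a\<in>comps r N. (- 1) ^ r * genF_coeff (\<lambda>i. 2 * d * a i)) * (2 * pi * \<i>) ^ (2 * d * N)"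
    unfolding sum_distrib_right by (simp only: mult.assoc)
  \<comment> \<open>The exponent is even and the square of 2 pi i is -4 pi^2, so the power of pi is
    real up to the integer factor \<open>(- 4) ^ (d * N)\<close>.\<close>
  also have "(2 * pi * \<i>) ^ (2 * d * N) = (- 4) ^ (d * N) * complex_of_real (pi ^ (2 * d * N))"
  proof -
    have "(2 * pi * \<i>) ^ (2 * d * N) = ((2 * pi * \<i>)\<^sup>2) ^ (d * N)" by (simp only: power_mult mult.assoc)
    also have "(2 * pi * \<i>)\<^sup>2 = - 4 * (complex_of_real pi)\<^sup>2" by (simp add: power_mult_distrib)
    also have "(- 4 * (complex_of_real pi)\<^sup>2) ^ (d * N) = (- 4) ^ (d * N) * ((complex_of_real pi)\<^sup>2) ^ (d * N)"
      by (rule power_mult_distrib)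
    also have "((complex_of_real pi)\<^sup>2) ^ (d * N) = complex_of_real (pi ^ (2 * d * N))"
      by (simp only: power_mult mult.assoc of_real_power)
    finally show ?thesis .
  qed
  finally have S2: "2 ^ r * fact r * complex_of_real S
     = (\<Sum>a\<in>comps r N. (- 1) ^ r * genF_coeff (\<lambda>i. 2 * d * a i)) * ((- 4) ^ (d * N) * complex_of_real (pi ^ (2 * d * N)))" .
  define Q where "Q = (\<Sum>a\<in>comps r N. (- 1) ^ r * genF_coeff (\<lambda>i. 2 * d * a i)) * (- 4) ^ (d * N) / (2 ^ r * fact r)"
  have "Q \<in> \<rat>"
    unfolding Q_def
  proof (intro Rats_divide Rats_mult Rats_sum Rats_power genF_coeff_Rats)
    show "(fact r :: complex) \<in> \<rat>" using Rats_of_nat[of "fact r", where 'a = complex] by simp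
  qed auto
  then obtain q where q: "Q = of_rat q" by (auto elim: Rats_cases)
  have nz: "2 ^ r * fact r \<noteq> (0 :: complex)" by simp
  have "complex_of_real S = Q * complex_of_real (pi ^ (2 * d * N))"
  proof -
    have "complex_of_real S = (2 ^ r * fact r * complex_of_real S) / (2 ^ r * fact r)" using nz by simp
    thus ?thesis unfolding S2 Q_def by (simp only: times_divide_eq_left mult.assoc)
  qed
  also have "\<dots> = complex_of_real (of_rat q * pi ^ (2 * d * N))" unfolding q by (simp only: of_real_mult of_real_of_rat)
  finally have "S = of_rat q * pi ^ (2 * d * N)" by (simp only: of_real_eq_iff)
  thus ?thesis unfolding main S_def[symmetric] using part1 by blast
qed

end
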